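(* The Basilica Thompson group $T_B$ is not of type $\mathrm{FP}_2$. In particular, $T_B$ is not finitely presented.
   Context: An edge replacement rule $e\to R$ consists of a directed non-loop edge $e$ from a vertex $v$ to a vertex $w$ and a finite directed graph $R$ containing $v,w$. For a finite directed graph $G$ and an edge $\varepsilon$ of $G$ (loops allowed), the simple expansion $G\lhd\varepsilon$ is obtained by deleting $\varepsilon$ and gluing in a copy of $R$, with $v,w$ identified with the initial and terminal vertex of $\varepsilon$; new edges/vertices are addressed by concatenation ($\varepsilon r$ for $r$ an edge or vertex of $R$). The Basilica rule: $R$ has vertices $v,w,4$ and edges $1\colon v\to 4$, a loop $2$ at $4$, and $3\colon 4\to w$. The Basilica base graph $G_0$ has two vertices $x,y$, a loop $a$ at $x$, a loop $c$ at $y$, an edge $b\colon x\to y$ and an edge $d\colon y\to x$. Let $G_n$ be obtained from $G_{n-1}$ by expanding every edge once. The limit space $X$ is the quotient of the set of sequences $\varepsilon_0\varepsilon_1\varepsilon_2\cdots$ ($\varepsilon_0\in E(G_0)$, $\varepsilon_i\in E(R)$ for $i\ge1$) by the relation: two sequences are equivalent if for every $n$ the edges of $G_n$ with addresses $\varepsilon_0\cdots\varepsilon_n$ and $\varepsilon_0'\cdots\varepsilon_n'$ share a vertex. For an edge $\varepsilon$ of an expansion of $G_0$, the cell $C(\varepsilon)\subseteq X$ is the set of classes represented by sequences with prefix $\varepsilon$; if $\varepsilon,\varepsilon'$ are both loops or both non-loops, the canonical homeomorphism $C(\varepsilon)\to C(\varepsilon')$ is $[\varepsilon\zeta_1\zeta_2\cdots]\mapsto[\varepsilon'\zeta_1\zeta_2\cdots]$.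 A rearrangement is a homeomorphism $f\colon X\to X$ for which there exist expansions $E_-,E_+$ of $G_0$ (graphs obtained from $G_0$ by finitely many simple expansions) and a directed graph isomorphism $\varphi\colon E_-\to E_+$ such that for every edge $\varepsilon$ of $E_-$, $f$ restricts to the canonical homeomorphism $C(\varepsilon)\to C(\varphi(\varepsilon))$. The rearrangements form a group; $T_B$ is this group for the Basilica rule and base graph $G_0$. *)

theory Defs
  imports "HOL-Analysis.Analysis" "HOL-Algebra.Bij"
begin

text \<open>Edges of the base graph G0: a (loop at x), b (x to y), c (loop at y), d (y to x).
  Edges of the replacement graph R: 1 (v to 4), 2 (loop at 4), 3 (4 to w).\<close>
datatype bedge = Ea | Eb | Ec | Ed
datatype redge = R1 | R2 | R3

text \<open>An edge address in an expansion of G0: a base edge followed by a finite word over E(R).\<close>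
type_synonym addr = "bedge \<times> redge list"

text \<open>Vertices: the base vertices x, y, and the vertex (epsilon 4) created when
  the edge with address epsilon is expanded.\<close>
datatype vtx = Vx | Vy | Mid addr

fun base_orig :: "bedge \<Rightarrow> vtx" where
  "base_orig Ea = Vx" | "base_orig Eb = Vx" | "base_orig Ec = Vy" | "base_orig Ed = Vy"

fun base_term :: "bedge \<Rightarrow> vtx" where
  "base_term Ea = Vx" | "base_term Eb = Vy" | "base_term Ec = Vy" | "base_term Ed = Vx"

text \<open>Initial / terminal vertex of an edge; the word is given reversed.\<close>
primrec orig_rev :: "bedge \<Rightarrow> redge list \<Rightarrow> vtx" where
  "orig_rev e [] = base_orig e"
| "orig_rev e (r # rs) = (case r of R1 \<Rightarrow> orig_rev e rs | _ \<Rightarrow> Mid (e, rev rs))"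

primrec term_rev :: "bedge \<Rightarrow> redge list \<Rightarrow> vtx" where
  "term_rev e [] = base_term e"
| "term_rev e (r # rs) = (case r of R3 \<Rightarrow> term_rev e rs | _ \<Rightarrow> Mid (e, rev rs))"

definition origin :: "addr \<Rightarrow> vtx" where
  "origin w = orig_rev (fst w) (rev (snd w))"

definition terminus :: "addr \<Rightarrow> vtx" where
  "terminus w = term_rev (fst w) (rev (snd w))"

inductive_set expansions :: "addr set set" where
  base: "{(e, []) | e. True} \<in> expansions"
| step: "E \<in> expansions \<Longrightarrow> w \<in> E \<Longrightarrow>
     (E - {w}) \<union> {(fst w, snd w @ [R1]), (fst w, snd w @ [R2]), (fst w, snd w @ [R3])} \<in> expansions"

definition vertices :: "addr set \<Rightarrow> vtx set" where
  "vertices E = origin ` E \<union> terminus ` E"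

definition graph_iso :: "addr set \<Rightarrow> addr set \<Rightarrow> (addr \<Rightarrow> addr) \<Rightarrow> bool" where
  "graph_iso E1 E2 \<phi> \<longleftrightarrow> bij_betw \<phi> E1 E2 \<and>
     (\<exists>\<psi>. bij_betw \<psi> (vertices E1) (vertices E2) \<and>
        (\<forall>e\<in>E1. origin (\<phi> e) = \<psi> (origin e) \<and> terminus (\<phi> e) = \<psi> (terminus e)))"

type_synonym bseq = "bedge \<times> (nat \<Rightarrow> redge)"

text \<open>The edge of G_n with address epsilon_0 ... epsilon_n.\<close>
definition trunc :: "bseq \<Rightarrow> nat \<Rightarrow> addr" where
  "trunc s n = (fst s, map (snd s) [0..<n])"

definition seq_rel :: "bseq rel" where
  "seq_rel = {(s, t). \<forall>n. {origin (trunc s n), terminus (trunc s n)} \<inter>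
                          {origin (trunc t n), terminus (trunc t n)} \<noteq> {}}"

definition proj :: "bseq \<Rightarrow> bseq set" where
  "proj s = seq_rel `` {s}"

definition Xlim :: "bseq set set" where
  "Xlim = UNIV // seq_rel"

definition seq_top :: "bseq topology" where
  "seq_top = prod_topology (discrete_topology UNIV)
               (product_topology (\<lambda>_. discrete_topology UNIV) UNIV)"

definition X_top :: "bseq set topology" where
  "X_top = topology (\<lambda>U. U \<subseteq> Xlim \<and> openin seq_top {s. proj s \<in> U})"

definition cat_seq :: "addr \<Rightarrow> (nat \<Rightarrow> redge) \<Rightarrow> bseq" where
  "cat_seq w \<zeta> = (fst w, \<lambda>i. if i < length (snd w) then snd w ! i else \<zeta> (i - length (snd w)))"

definition rearrangement :: "(bseq set \<Rightarrow> bseq set) \<Rightarrow> bool" where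
  "rearrangement f \<longleftrightarrow> homeomorphic_map X_top X_top f \<and>
     (\<exists>Em Ep \<phi>. Em \<in> expansions \<and> Ep \<in> expansions \<and> graph_iso Em Ep \<phi> \<and>
        (\<forall>e\<in>Em. \<forall>\<zeta>. f (proj (cat_seq e \<zeta>)) = proj (cat_seq (\<phi> e) \<zeta>)))"

definition T_B :: "(bseq set \<Rightarrow> bseq set) monoid" where
  "T_B = (BijGroup Xlim)\<lparr>carrier := {f \<in> Bij Xlim. rearrangement f}\<rparr>"

text \<open>The free ZG-module ZG^n: finitely supported integer functions on {..<n} x G.\<close>
definition free_mod :: "('g, 'b) monoid_scheme \<Rightarrow> nat \<Rightarrow> (nat \<times> 'g \<Rightarrow> int) set" where
  "free_mod G n = {v. finite {p. v p \<noteq> 0} \<and>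
      (\<forall>i g. v (i, g) \<noteq> 0 \<longrightarrow> i < n \<and> g \<in> carrier G)}"

definition gact :: "('g, 'b) monoid_scheme \<Rightarrow> 'g \<Rightarrow> (nat \<times> 'g \<Rightarrow> int) \<Rightarrow> (nat \<times> 'g \<Rightarrow> int)" where
  "gact G h v = (\<lambda>(i, g). if g \<in> carrier G then v (i, inv\<^bsub>G\<^esub> h \<otimes>\<^bsub>G\<^esub> g) else 0)"

definition vadd :: "(nat \<times> 'g \<Rightarrow> int) \<Rightarrow> (nat \<times> 'g \<Rightarrow> int) \<Rightarrow> (nat \<times> 'g \<Rightarrow> int)" where
  "vadd u v = (\<lambda>p. u p + v p)"

definition gmap :: "('g, 'b) monoid_scheme \<Rightarrow> (nat \<times> 'g \<Rightarrow> int) set \<Rightarrow> (nat \<times> 'g \<Rightarrow> int) set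
     \<Rightarrow> ((nat \<times> 'g \<Rightarrow> int) \<Rightarrow> (nat \<times> 'g \<Rightarrow> int)) \<Rightarrow> bool" where
  "gmap G A B f \<longleftrightarrow> (\<forall>v\<in>A. f v \<in> B) \<and>
     (\<forall>u\<in>A. \<forall>v\<in>A. f (vadd u v) = vadd (f u) (f v)) \<and>
     (\<forall>h\<in>carrier G. \<forall>v\<in>A. f (gact G h v) = gact G h (f v))"

definition gmap_triv :: "('g, 'b) monoid_scheme \<Rightarrow> (nat \<times> 'g \<Rightarrow> int) set
     \<Rightarrow> ((nat \<times> 'g \<Rightarrow> int) \<Rightarrow> int) \<Rightarrow> bool" where
  "gmap_triv G A f \<longleftrightarrow>
     (\<forall>u\<in>A. \<forall>v\<in>A. f (vadd u v) = f u + f v) \<and>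
     (\<forall>h\<in>carrier G. \<forall>v\<in>A. f (gact G h v) = f v)"

text \<open>Finitely generated projective ZG-modules, realised (up to isomorphism) as
  direct summands of ZG^n, i.e. images of idempotent ZG-endomorphisms of ZG^n.\<close>
definition fg_proj :: "('g, 'b) monoid_scheme \<Rightarrow> nat \<Rightarrow> (nat \<times> 'g \<Rightarrow> int) set \<Rightarrow> bool" where
  "fg_proj G n P \<longleftrightarrow> (\<exists>e. gmap G (free_mod G n) (free_mod G n) e \<and>
      (\<forall>v\<in>free_mod G n. e (e v) = e v) \<and> P = e ` free_mod G n)"

definition FP2 :: "('g, 'b) monoid_scheme \<Rightarrow> bool" where
  "FP2 G \<longleftrightarrow> (\<exists>n0 n1 n2 P0 P1 P2 d1 d2 \<epsilon>.
     fg_proj G n0 P0 \<and> fg_proj G n1 P1 \<and> fg_proj G n2 P2 \<and>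
     gmap G P2 P1 d2 \<and> gmap G P1 P0 d1 \<and> gmap_triv G P0 \<epsilon> \<and>
     \<epsilon> ` P0 = UNIV \<and>
     {v\<in>P0. \<epsilon> v = 0} = d1 ` P1 \<and>
     {v\<in>P1. d1 v = (\<lambda>_. 0)} = d2 ` P2)"

text \<open>Words in generators 0,1,2,...; (i, True) denotes the inverse of generator i.\<close>
type_synonym word = "(nat \<times> bool) list"

definition eval_word :: "('g, 'b) monoid_scheme \<Rightarrow> (nat \<Rightarrow> 'g) \<Rightarrow> word \<Rightarrow> 'g" where
  "eval_word G f w = foldr (\<lambda>(i, b) acc. (if b then inv\<^bsub>G\<^esub> (f i) else f i) \<otimes>\<^bsub>G\<^esub> acc) w \<one>\<^bsub>G\<^esub>"

definition inv_word :: "word \<Rightarrow> word" where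
  "inv_word w = rev (map (\<lambda>(i, b). (i, \<not> b)) w)"

definition pres_move :: "word set \<Rightarrow> word \<Rightarrow> word \<Rightarrow> bool" where
  "pres_move Rs u v \<longleftrightarrow> (\<exists>p q r. u = p @ q \<and> v = p @ r @ q \<and>
      ((\<exists>i b. r = [(i, b), (i, \<not> b)]) \<or> r \<in> Rs \<or> inv_word r \<in> Rs))"

definition finitely_presented :: "('g, 'b) monoid_scheme \<Rightarrow> bool" where
  "finitely_presented G \<longleftrightarrow> (\<exists>n f Rs. finite Rs \<and> f ` {..<n} \<subseteq> carrier G \<and>
     (\<forall>r\<in>Rs. fst ` set r \<subseteq> {..<n}) \<and>
     (\<forall>g\<in>carrier G. \<exists>w. fst ` set w \<subseteq> {..<n} \<and> eval_word G f w = g) \<and>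
     (\<forall>w. fst ` set w \<subseteq> {..<n} \<longrightarrow>
        (eval_word G f w = \<one>\<^bsub>G\<^esub> \<longleftrightarrow> equivclp (pres_move Rs) w [])))"

end

theory Submission
  imports Defs "HOL-Library.Function_Algebras" "HOL-Library.Confluence"
begin

text \<open>
  The Basilica is a tree of circles. Let \<open>C\<close> be the stabilizer of the branch \<open>C(a)\<close> hanging at the
  vertex \<open>x\<close>. The set \<open>N\<close> of all branches that are loop cells is almost invariant in the orbit \<open>T\<^sub>B/C\<close>,
  so \<open>d(f) = 1\<^sub>N - f 1\<^sub>N\<close> is a derivation with values in \<open>\<int>[T\<^sub>B/C]\<close>. The group \<open>C\<close> is the increasing union
  of subgroups \<open>C\<^sub>m\<close> whose elements respect the germs at the base points of all loop cells at distance
  more than \<open>m\<close> from \<open>x\<close>. For a group of type \<open>FP\<^sub>2\<close>, and likewise for a finitely presented group,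
  \<open>H\<^sup>1\<close> commutes with direct limits, so \<open>d\<close> would lift to \<open>\<int>[T\<^sub>B/C\<^sub>m]\<close> for some \<open>m\<close>, keeping its values
  at finitely many chosen elements.

  Let \<open>t\<close> be the rotation \<open>a \<leftrightarrow> c\<close>, \<open>b \<leftrightarrow> d\<close>, let \<open>s\<close> swap the two sides of \<open>x\<close>, and let \<open>k\<^sub>0\<close> act on the
  circle of \<open>b\<close> and \<open>d\<close> by an element of Thompson's group \<open>F\<close>. Then \<open>d(t) = d(k\<^sub>0) = 0\<close> and
  \<open>d(s) = [1] - [s]\<close>. The elements \<open>k\<^sub>j\<^sub>+\<^sub>1 = t s k\<^sub>j s t\<close> of \<open>C\<close> act deeper and deeper, hence are not all in
  \<open>C\<^sub>m\<close>, but the lift vanishes on them up to the first one outside \<open>C\<^sub>m\<close>. This \<open>k\<close> commutes with \<open>s k s\<close>,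
  whose support is disjoint, and comparing the lift on both products gives a contradiction.
\<close>

section \<open>Derivations and finiteness properties\<close>

text \<open>The modules \<open>\<int>[T_B/C_m]\<close> have no common carrier, so the direct system
  is kept inside one module: each is the quotient of \<open>\<int>[T_B]\<close> by a kernel growing
  with m, and a derivation into it is a function with values in \<open>\<int>[T_B]\<close> obeying
  the product rule modulo that kernel. Both finiteness conditions enter only through the property
  \<open>derivations_lift\<close>.

  The shape of \<open>C_m\<close> is dictated by three demands. The chain must exhaust C: an element
  is described by finitely many edges, so it maps all sufficiently deep loop cells canonically. It
  must omit some \<open>k_j\<close> at every stage: \<open>k_(m+1)\<close> slides the germ at the
  base point of a loop cell of depth m+1. It must be stable under conjugation by s, since this makes
  the four terms of the lifted value on \<open>s k_j s\<close> cancel while \<open>k_j\<close> lies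
  in \<open>C_m\<close>; for this reason depth is counted alike on both sides of x. Nothing of the
  kind is asked of t, which moves x: passing from \<open>s k_j s\<close> to \<open>k_(j+1)\<close>
  uses only d(t) = 0 and the product rule.\<close>

lemma vadd_eq_plus: "vadd u v = u + v"
  by (simp add: vadd_def plus_fun_def)

lemma additive_on_zero:
  fixes f :: "'p::ab_group_add \<Rightarrow> 'q::ab_group_add"
  assumes "0 \<in> A" "\<And>u v. u \<in> A \<Longrightarrow> v \<in> A \<Longrightarrow> f (u + v) = f u + f v"
  shows "f 0 = 0"
  using assms(2)[OF assms(1) assms(1)] by simp

lemma additive_on_diff:
  fixes f :: "'p::ab_group_add \<Rightarrow> 'q::ab_group_add"
  assumes "\<And>u v. u \<in> A \<Longrightarrow> v \<in> A \<Longrightarrow> u - v \<in> A"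
    and "\<And>u v. u \<in> A \<Longrightarrow> v \<in> A \<Longrightarrow> f (u + v) = f u + f v"
    and "u \<in> A" "v \<in> A"
  shows "f (u - v) = f u - f v"
  using assms(2)[OF assms(1)[OF assms(3,4)] assms(4)] by simp

lemma scale_in_additive_subgroup:
  fixes u :: "'p \<Rightarrow> int"
  assumes S: "0 \<in> S" "\<And>u w. u \<in> S \<Longrightarrow> w \<in> S \<Longrightarrow> u - w \<in> S" and u: "u \<in> S"
  shows "(\<lambda>q. k * u q) \<in> S"
proof -
  have neg: "- w \<in> S" if "w \<in> S" for w using S(2)[OF S(1) that] by simp
  have mult: "(\<lambda>q. int n * u q) \<in> S" for n
  proof (induction n)
    case 0 show ?case using S(1) by (simp add: zero_fun_def)
  next
    case (Suc n)
    have "(\<lambda>q. int (Suc n) * u q) = u - - (\<lambda>q. int n * u q)"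
      by (auto simp: fun_eq_iff algebra_simps)
    then show ?case using S(2)[OF u neg[OF Suc]] by simp
  qed
  show ?thesis
  proof (cases "k \<ge> 0")
    case True then show ?thesis using mult[of "nat k"] by simp
  next
    case False
    then have "(\<lambda>q. k * u q) = - (\<lambda>q. int (nat (- k)) * u q)" by (auto simp: fun_eq_iff)
    then show ?thesis using neg[OF mult] by metis
  qed
qed

section \<open>Finitely generated free modules over the integral group ring and their direct
  summands\<close>

context group begin

lemma free_mod_zero: "0 \<in> free_mod G n"
  by (simp add: free_mod_def)

lemma free_mod_diff:
  assumes "u \<in> free_mod G n" "v \<in> free_mod G n"
  shows "u - v \<in> free_mod G n"
proof -
  have "{p. (u - v) p \<noteq> 0} \<subseteq> {p. u p \<noteq> 0} \<union> {p. v p \<noteq> 0}" by auto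
  moreover have "finite ({p. u p \<noteq> 0} \<union> {p. v p \<noteq> 0})"
    using assms by (simp add: free_mod_def)
  ultimately have "finite {p. (u - v) p \<noteq> 0}" by (rule finite_subset)
  moreover have "u (i, g) - v (i, g) \<noteq> 0 \<longrightarrow> i < n \<and> g \<in> carrier G" for i g
    using assms by (cases "u (i,g) = 0") (auto simp: free_mod_def)
  ultimately show ?thesis by (simp add: free_mod_def)
qed

lemma free_mod_add:
  assumes "u \<in> free_mod G n" "v \<in> free_mod G n"
  shows "u + v \<in> free_mod G n"
  using free_mod_diff[OF assms(1) free_mod_diff[OF free_mod_zero assms(2)]] by simp

definition unit_vec :: "nat \<times> 'a \<Rightarrow> nat \<times> 'a \<Rightarrow> int" where
  "unit_vec p = (\<lambda>q. if q = p then 1 else 0)"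

lemma unit_vec_free_mod: "i < n \<Longrightarrow> g \<in> carrier G \<Longrightarrow> unit_vec (i, g) \<in> free_mod G n"
  by (auto simp: free_mod_def unit_vec_def)

lemma gact_unit_vec:
  assumes "g \<in> carrier G" "h \<in> carrier G"
  shows "gact G h (unit_vec (i, g)) = unit_vec (i, h \<otimes> g)"
  using assms by (auto simp: gact_def unit_vec_def fun_eq_iff inv_solve_left' simp flip: m_assoc)

lemma gact_free_mod:
  assumes "h \<in> carrier G" "v \<in> free_mod G n"
  shows "gact G h v \<in> free_mod G n"
proof -
  have "{p. gact G h v p \<noteq> 0} \<subseteq> (\<lambda>(i, g). (i, h \<otimes> g)) ` {p. v p \<noteq> 0}"
  proof
    fix p assume "p \<in> {p. gact G h v p \<noteq> 0}"
    then obtain i g where p: "p = (i, g)" "g \<in> carrier G" "v (i, inv h \<otimes> g) \<noteq> 0"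
      by (cases p) (auto simp: gact_def split: if_splits)
    moreover have "h \<otimes> (inv h \<otimes> g) = g" using p assms by (simp flip: m_assoc)
    ultimately show "p \<in> (\<lambda>(i, g). (i, h \<otimes> g)) ` {p. v p \<noteq> 0}"
      by (intro image_eqI[where x = "(i, inv h \<otimes> g)"]) auto
  qed
  moreover have "finite {p. v p \<noteq> 0}" using assms by (simp add: free_mod_def)
  ultimately have "finite {p. gact G h v p \<noteq> 0}" by (meson finite_imageI finite_subset)
  then show ?thesis using assms by (auto simp: free_mod_def gact_def)
qed

lemma gact_diff: "gact G h (u - v) = gact G h u - gact G h v"
  by (auto simp: gact_def fun_eq_iff)

lemma gact_mult:
  assumes "g \<in> carrier G" "h \<in> carrier G"
  shows "gact G (g \<otimes> h) v = gact G g (gact G h v)"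
  using assms by (auto simp: gact_def fun_eq_iff inv_mult_group m_assoc)

text \<open>Closure under differences yields negatives, sums and integer multiples, and a finitely
  supported vector is built up one point of its support at a time.\<close>

lemma free_mod_span:
  assumes "v \<in> free_mod G n" "0 \<in> S"
    and S: "\<And>u w. u \<in> S \<Longrightarrow> w \<in> S \<Longrightarrow> u - w \<in> S"
    and gen: "\<And>i g. i < n \<Longrightarrow> g \<in> carrier G \<Longrightarrow> unit_vec (i, g) \<in> S"
  shows "v \<in> S"
proof -
  have neg: "- u \<in> S" if "u \<in> S" for u using S[OF \<open>0 \<in> S\<close> that] by simp
  have add: "u + w \<in> S" if "u \<in> S" "w \<in> S" for u w using S[OF that(1) neg[OF that(2)]] by simp
  have "finite A \<Longrightarrow> A \<subseteq> {p. v p \<noteq> 0} \<Longrightarrow> (\<lambda>q. if q \<in> A then v q else 0) \<in> S" for A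
  proof (induction A rule: finite_induct)
    case empty then show ?case using \<open>0 \<in> S\<close> by (simp add: zero_fun_def)
  next
    case (insert p A)
    obtain i g where p: "p = (i, g)" by (cases p)
    then have "i < n" "g \<in> carrier G" using insert.prems assms(1) by (auto simp: free_mod_def)
    then have "(\<lambda>q. v p * unit_vec p q) \<in> S" using gen p scale_in_additive_subgroup[OF \<open>0 \<in> S\<close> S] by simp
    moreover have "(\<lambda>q. if q \<in> insert p A then v q else 0) =
        (\<lambda>q. v p * unit_vec p q) + (\<lambda>q. if q \<in> A then v q else 0)"
      using insert.hyps by (auto simp: fun_eq_iff unit_vec_def)
    ultimately show ?case using add insert by simp
  qed
  from this[of "{p. v p \<noteq> 0}"] have "(\<lambda>q. if q \<in> {p. v p \<noteq> 0} then v q else 0) \<in> S"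
    using assms(1) by (simp add: free_mod_def)
  moreover have "(\<lambda>q. if q \<in> {p. v p \<noteq> 0} then v q else 0) = v" by auto
  ultimately show ?thesis by simp
qed

lemma gmap_add: "gmap G A B f \<Longrightarrow> u \<in> A \<Longrightarrow> v \<in> A \<Longrightarrow> f (u + v) = f u + f v"
  by (simp add: gmap_def vadd_eq_plus)

lemma gmap_act: "gmap G A B f \<Longrightarrow> h \<in> carrier G \<Longrightarrow> v \<in> A \<Longrightarrow> f (gact G h v) = gact G h (f v)"
  by (simp add: gmap_def)

lemma gmap_closed: "gmap G A B f \<Longrightarrow> v \<in> A \<Longrightarrow> f v \<in> B"
  by (simp add: gmap_def)

text \<open>The idempotent that \<open>fg_proj\<close> quantifies away is an argument here, so that
  generators of the summand can be written as its values on unit vectors.\<close>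

definition retract :: "nat \<Rightarrow> (nat \<times> 'a \<Rightarrow> int) set \<Rightarrow> ((nat \<times> 'a \<Rightarrow> int) \<Rightarrow> nat \<times> 'a \<Rightarrow> int) \<Rightarrow> bool" where
  "retract n P e \<longleftrightarrow> gmap G (free_mod G n) (free_mod G n) e \<and>
     (\<forall>v\<in>free_mod G n. e (e v) = e v) \<and> P = e ` free_mod G n"

lemma retractD:
  assumes "retract n P e"
  shows "gmap G (free_mod G n) (free_mod G n) e" "\<And>v. v \<in> P \<Longrightarrow> e v = v"
    "\<And>v. v \<in> free_mod G n \<Longrightarrow> e v \<in> P" "P \<subseteq> free_mod G n" "0 \<in> P"
    "\<And>u v. u \<in> P \<Longrightarrow> v \<in> P \<Longrightarrow> u + v \<in> P"
    "\<And>u v. u \<in> P \<Longrightarrow> v \<in> P \<Longrightarrow> u - v \<in> P"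
    "\<And>h v. h \<in> carrier G \<Longrightarrow> v \<in> P \<Longrightarrow> gact G h v \<in> P"
    "\<And>u v. u \<in> free_mod G n \<Longrightarrow> v \<in> free_mod G n \<Longrightarrow> e (u - v) = e u - e v"
    "\<And>i g. i < n \<Longrightarrow> g \<in> carrier G \<Longrightarrow> e (unit_vec (i, g)) = gact G g (e (unit_vec (i, \<one>)))"
proof -
  have e: "gmap G (free_mod G n) (free_mod G n) e"
    "\<And>v. v \<in> free_mod G n \<Longrightarrow> e (e v) = e v" "P = e ` free_mod G n"
    using assms by (auto simp: retract_def)
  have PF: "P \<subseteq> free_mod G n" using e gmap_closed by blast
  have fix_P: "e v = v" if "v \<in> P" for v using that e by auto
  have diff_e: "e (u - v) = e u - e v" if "u \<in> free_mod G n" "v \<in> free_mod G n" for u v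
    by (rule additive_on_diff[of "free_mod G n", OF free_mod_diff gmap_add[OF e(1)] that])
  have in_P: "v \<in> P" if "v \<in> free_mod G n" "e v = v" for v using that unfolding e(3) by (metis imageI)
  show "gmap G (free_mod G n) (free_mod G n) e" by (rule e(1))
  show "e v = v" if "v \<in> P" for v using fix_P that .
  show "e v \<in> P" if "v \<in> free_mod G n" for v using e(3) that by blast
  show "P \<subseteq> free_mod G n" by (rule PF)
  show "0 \<in> P" using in_P free_mod_zero additive_on_zero gmap_add[OF e(1)] by blast
  show "e (u - v) = e u - e v" if "u \<in> free_mod G n" "v \<in> free_mod G n" for u v using diff_e that .
  have F: "v \<in> free_mod G n" if "v \<in> P" for v using that PF by auto
  show "u + v \<in> P" if uv: "u \<in> P" "v \<in> P" for u v
    using in_P[OF free_mod_add] gmap_add[OF e(1)] F[OF uv(1)] F[OF uv(2)] fix_P uv by simp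
  show "u - v \<in> P" if uv: "u \<in> P" "v \<in> P" for u v
    using in_P[OF free_mod_diff] diff_e F[OF uv(1)] F[OF uv(2)] fix_P uv by simp
  show "gact G h v \<in> P" if hv: "h \<in> carrier G" "v \<in> P" for h v
    using in_P[OF gact_free_mod[OF hv(1)]] gmap_act[OF e(1) hv(1)] F[OF hv(2)] fix_P hv by simp
  show "e (unit_vec (i, g)) = gact G g (e (unit_vec (i, \<one>)))" if i: "i < n" and g: "g \<in> carrier G" for i g
    using gmap_act[OF e(1) g unit_vec_free_mod[OF i one_closed]] g by (simp add: gact_unit_vec)
qed

end

text \<open>The value at v of the additive map with \<open>p \<mapsto> c p\<close> on basis vectors.
  It is meant for v of finite support; over an infinite support the sum is 0 by convention.\<close>

definition lin_ext :: "('p \<Rightarrow> int) \<Rightarrow> ('p \<Rightarrow> 'x \<Rightarrow> int) \<Rightarrow> 'x \<Rightarrow> int" where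
  "lin_ext v c = (\<lambda>x. \<Sum>p | v p \<noteq> 0. v p * c p x)"

lemma lin_ext_superset:
  assumes "finite A" "{p. v p \<noteq> 0} \<subseteq> A"
  shows "lin_ext v c x = (\<Sum>p\<in>A. v p * c p x)"
  unfolding lin_ext_def by (rule sum.mono_neutral_left) (use assms in auto)

lemma lin_ext_add:
  assumes "finite {p. u p \<noteq> 0}" "finite {p. v p \<noteq> 0}"
  shows "lin_ext (u + v) c = lin_ext u c + lin_ext v c"
proof
  fix x
  let ?A = "{p. u p \<noteq> 0} \<union> {p. v p \<noteq> 0}"
  have A: "finite ?A" using assms by simp
  have "lin_ext (u + v) c x = (\<Sum>p\<in>?A. (u + v) p * c p x)" by (rule lin_ext_superset[OF A]) auto
  also have "\<dots> = (\<Sum>p\<in>?A. u p * c p x) + (\<Sum>p\<in>?A. v p * c p x)"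
    by (simp add: sum.distrib distrib_right)
  also have "\<dots> = (lin_ext u c + lin_ext v c) x"
    using lin_ext_superset[OF A, of u c x] lin_ext_superset[OF A, of v c x] by auto
  finally show "lin_ext (u + v) c x = (lin_ext u c + lin_ext v c) x" .
qed

lemma (in group) lin_ext_gact:
  assumes "h \<in> carrier G" "v \<in> free_mod G n"
  shows "lin_ext (gact G h v) c = lin_ext v (\<lambda>(i, g). c (i, h \<otimes> g))"
proof
  fix x
  let ?S = "{p. v p \<noteq> 0}" and ?f = "\<lambda>(i, g). (i, h \<otimes> g)"
  have S: "g \<in> carrier G" if "(i, g) \<in> ?S" for i g using that assms by (auto simp: free_mod_def)
  have inj: "inj_on ?f ?S" using assms S by (auto simp: inj_on_def)
  have img: "{p. gact G h v p \<noteq> 0} = ?f ` ?S"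
  proof (intro equalityI subsetI)
    fix p assume "p \<in> {p. gact G h v p \<noteq> 0}"
    then obtain i g where p: "p = (i, g)" "g \<in> carrier G" "v (i, inv h \<otimes> g) \<noteq> 0"
      by (cases p) (auto simp: gact_def split: if_splits)
    moreover have "h \<otimes> (inv h \<otimes> g) = g" using p assms by (simp flip: m_assoc)
    ultimately show "p \<in> ?f ` ?S"
      by (intro image_eqI[where x = "(i, inv h \<otimes> g)"]) auto
  next
    fix p assume "p \<in> ?f ` ?S"
    then obtain i g where p: "p = (i, h \<otimes> g)" "(i, g) \<in> ?S" by auto
    then show "p \<in> {p. gact G h v p \<noteq> 0}" using S assms by (auto simp: gact_def simp flip: m_assoc)
  qed
  have "lin_ext (gact G h v) c x = (\<Sum>p\<in>?S. gact G h v (?f p) * c (?f p) x)"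
    unfolding lin_ext_def img by (subst sum.reindex[OF inj]) simp
  also have "\<dots> = lin_ext v (\<lambda>(i, g). c (i, h \<otimes> g)) x" unfolding lin_ext_def
    by (rule sum.cong) (use S assms in \<open>auto simp: gact_def simp flip: m_assoc\<close>)
  finally show "lin_ext (gact G h v) c x = lin_ext v (\<lambda>(i, g). c (i, h \<otimes> g)) x" .
qed

lemma (in group) lin_ext_unit_vec: "lin_ext (unit_vec p) c = c p"
  by (auto simp: lin_ext_def unit_vec_def fun_eq_iff)

section \<open>Derivations modulo an increasing chain of submodules of a function module\<close>

locale right_action = group +
  fixes \<tau> :: "'a \<Rightarrow> 'x \<Rightarrow> 'x"
  assumes \<tau>_mult: "g \<in> carrier G \<Longrightarrow> h \<in> carrier G \<Longrightarrow> \<tau> (g \<otimes> h) x = \<tau> h (\<tau> g x)"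
    and \<tau>_one: "\<tau> \<one> x = x"
begin

definition act :: "'a \<Rightarrow> ('x \<Rightarrow> int) \<Rightarrow> 'x \<Rightarrow> int" where
  "act g m = (\<lambda>x. m (\<tau> g x))"

definition submod :: "('x \<Rightarrow> int) set \<Rightarrow> bool" where
  "submod I \<longleftrightarrow> 0 \<in> I \<and> (\<forall>u\<in>I. \<forall>v\<in>I. u - v \<in> I) \<and> (\<forall>g\<in>carrier G. \<forall>u\<in>I. act g u \<in> I)"

text \<open>A crossed homomorphism into the quotient by I, written on representatives so that all
  stages of the direct system share one type of values.\<close>

definition derivation_mod :: "('x \<Rightarrow> int) set \<Rightarrow> ('a \<Rightarrow> 'x \<Rightarrow> int) \<Rightarrow> bool" where
  "derivation_mod I \<delta> \<longleftrightarrow>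
     (\<forall>g\<in>carrier G. \<forall>h\<in>carrier G. \<delta> (g \<otimes> h) - (\<delta> g + act g (\<delta> h)) \<in> I)"

text \<open>Surjectivity of the comparison map from the direct limit of the first cohomology groups
  to the cohomology of the limit. It is stated for the derivations themselves: the lift keeps every
  value modulo the union, not merely up to a principal derivation.\<close>

definition derivations_lift :: bool where
  "derivations_lift \<longleftrightarrow> (\<forall>I :: nat \<Rightarrow> ('x \<Rightarrow> int) set. \<forall>\<delta>. (\<forall>m. submod (I m)) \<and> incseq I \<and>
     derivation_mod (\<Union>m. I m) \<delta> \<longrightarrow>
     (\<exists>m \<delta>'. derivation_mod (I m) \<delta>' \<and> (\<forall>g\<in>carrier G. \<delta>' g - \<delta> g \<in> (\<Union>m. I m))))"

lemma act_add: "act g (u + v) = act g u + act g v" by (simp add: act_def fun_eq_iff)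
lemma act_diff: "act g (u - v) = act g u - act g v" by (simp add: act_def fun_eq_iff)
lemma act_mult: "g \<in> carrier G \<Longrightarrow> h \<in> carrier G \<Longrightarrow> act (g \<otimes> h) m = act g (act h m)"
  by (simp add: act_def \<tau>_mult)
lemma act_one: "act \<one> m = m" by (simp add: act_def \<tau>_one)
lemma act_lin_ext: "act h (lin_ext v c) = lin_ext v (\<lambda>p. act h (c p))"
  by (simp add: act_def lin_ext_def)

lemma submod_zero: "submod I \<Longrightarrow> 0 \<in> I" by (simp add: submod_def)
lemma submod_diff: "submod I \<Longrightarrow> u \<in> I \<Longrightarrow> v \<in> I \<Longrightarrow> u - v \<in> I" by (simp add: submod_def)
lemma submod_uminus: "submod I \<Longrightarrow> u \<in> I \<Longrightarrow> - u \<in> I"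
  using submod_diff[of I 0 u] submod_zero by simp
lemma submod_add: "submod I \<Longrightarrow> u \<in> I \<Longrightarrow> v \<in> I \<Longrightarrow> u + v \<in> I"
  using submod_diff[of I u "- v"] submod_uminus by simp
lemma submod_act: "submod I \<Longrightarrow> g \<in> carrier G \<Longrightarrow> u \<in> I \<Longrightarrow> act g u \<in> I" by (simp add: submod_def)

lemma submod_trans: "submod I \<Longrightarrow> a - b \<in> I \<Longrightarrow> b - c \<in> I \<Longrightarrow> a - c \<in> I"
  using submod_add[of I "a - b" "b - c"] by simp

lemma submod_sym: "submod I \<Longrightarrow> a - b \<in> I \<Longrightarrow> b - a \<in> I"
  using submod_uminus[of I "a - b"] by simp

lemma submod_add_cong: "submod I \<Longrightarrow> a - b \<in> I \<Longrightarrow> c - d \<in> I \<Longrightarrow> (a + c) - (b + d) \<in> I"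
  using submod_add[of I "a - b" "c - d"] by (simp add: algebra_simps)

lemma submod_act_cong: "submod I \<Longrightarrow> g \<in> carrier G \<Longrightarrow> a - b \<in> I \<Longrightarrow> act g a - act g b \<in> I"
  using submod_act[of I g "a - b"] by (simp add: act_diff)

lemma submod_Union:
  assumes "\<And>m. submod (I m)" "incseq I"
  shows "submod (\<Union>m :: nat. I m)"
  unfolding submod_def
proof (intro conjI ballI)
  show "0 \<in> (\<Union>m. I m)" using assms submod_zero by blast
next
  fix u v assume "u \<in> (\<Union>m. I m)" "v \<in> (\<Union>m. I m)"
  then obtain m k where "u \<in> I m" "v \<in> I k" by blast
  then have "u \<in> I (max m k)" "v \<in> I (max m k)"
    using assms(2) by (meson incseqD max.cobounded1 max.cobounded2 subsetD)+
  then show "u - v \<in> (\<Union>m. I m)" using submod_diff assms(1) by blast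
next
  fix g u assume "g \<in> carrier G" "u \<in> (\<Union>m. I m)"
  then show "act g u \<in> (\<Union>m. I m)" using submod_act assms(1) by blast
qed

lemma finite_subset_incseq:
  assumes "incseq I" "finite (S :: 'z set)" "\<And>i. i \<in> S \<Longrightarrow> f i \<in> (\<Union>m. I m)"
  shows "\<exists>m :: nat. \<forall>i\<in>S. f i \<in> I m"
  using assms(2,3)
proof (induction S rule: finite_induct)
  case (insert i S)
  then obtain m k where "\<forall>i\<in>S. f i \<in> I m" "f i \<in> I k" by blast
  then have "\<forall>i\<in>insert i S. f i \<in> I (max m k)"
    using assms(1) by (metis incseqD insert_iff max.cobounded1 max.cobounded2 subsetD)
  then show ?case by blast
qed simp

lemma free_mod_hom_in:
  assumes v: "v \<in> free_mod G n" and I: "submod I"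
    and diff: "\<And>u v. u \<in> free_mod G n \<Longrightarrow> v \<in> free_mod G n \<Longrightarrow> Q (u - v) = Q u - Q v"
    and gen: "\<And>i g. i < n \<Longrightarrow> g \<in> carrier G \<Longrightarrow> Q (unit_vec (i, g)) \<in> I"
  shows "Q v \<in> I"
proof -
  have "Q 0 = 0" using diff[OF free_mod_zero free_mod_zero] by simp
  then have "v \<in> {v \<in> free_mod G n. Q v \<in> I}"
    by (intro free_mod_span[OF v])
      (use I diff gen free_mod_zero free_mod_diff unit_vec_free_mod submod_zero submod_diff in auto)
  then show ?thesis by simp
qed

text \<open>A resolution \<open>P\<^sub>2 \<rightarrow> P\<^sub>1 \<rightarrow> P\<^sub>0 \<rightarrow> \<int>\<close> lets one read \<open>\<delta>\<close> off a module map
  \<open>F\<close> on \<open>P\<^sub>1\<close> whose composition with \<open>P\<^sub>2 \<rightarrow> P\<^sub>1\<close> lands in the union of the \<open>I m\<close>, hence in a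
  single \<open>I m\<close>, because \<open>P\<^sub>2\<close> is finitely generated.\<close>
lemma FP2_derivations_lift:
  assumes "FP2 G"
  shows derivations_lift
  unfolding derivations_lift_def
proof (intro allI impI, elim conjE)
  fix I :: "nat \<Rightarrow> ('x \<Rightarrow> int) set" and \<delta>
  assume I: "\<forall>m. submod (I m)" and inc: "incseq I" and der: "derivation_mod (\<Union>m. I m) \<delta>"
  define J where "J = (\<Union>m. I m)"
  have J: "submod J" unfolding J_def using submod_Union I inc by blast
  obtain n0 n1 n2 P0 P1 P2 d1 d2 \<epsilon> where
    P0: "fg_proj G n0 P0" and P1: "fg_proj G n1 P1" and P2: "fg_proj G n2 P2" and
    d2: "gmap G P2 P1 d2" and d1: "gmap G P1 P0 d1" and \<epsilon>: "gmap_triv G P0 \<epsilon>" and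
    surj: "\<epsilon> ` P0 = UNIV" and ex0: "{v\<in>P0. \<epsilon> v = 0} = d1 ` P1" and
    ex1: "{v\<in>P1. d1 v = (\<lambda>_. 0)} = d2 ` P2"
    using assms unfolding FP2_def by (elim exE conjE) (rule that; assumption)
  obtain e0 where "retract n0 P0 e0" using P0 by (auto simp: fg_proj_def retract_def)
  note e0 = retractD[OF this]
  obtain e1 where "retract n1 P1 e1" using P1 by (auto simp: fg_proj_def retract_def)
  note e1 = retractD[OF this]
  obtain e2 where "retract n2 P2 e2" using P2 by (auto simp: fg_proj_def retract_def)
  note e2 = retractD[OF this]
  have fin: "finite {p. v p \<noteq> 0}" if "v \<in> free_mod G n" for v and n :: nat
    using that by (simp add: free_mod_def)
  have \<epsilon>_add: "\<epsilon> (u + v) = \<epsilon> u + \<epsilon> v" if "u \<in> P0" "v \<in> P0" for u v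
    using \<epsilon> that by (simp add: gmap_triv_def vadd_eq_plus)
  have \<epsilon>_act: "\<epsilon> (gact G h v) = \<epsilon> v" if "h \<in> carrier G" "v \<in> P0" for h v
    using \<epsilon> that by (simp add: gmap_triv_def)
  have \<epsilon>_diff: "\<epsilon> (u - v) = \<epsilon> u - \<epsilon> v" if "u \<in> P0" "v \<in> P0" for u v
    using additive_on_diff[of P0 \<epsilon> u v] e0(7) \<epsilon>_add that by blast

  define w where "w i = \<epsilon> (e0 (unit_vec (i, \<one>)))" for i
  \<comment> \<open>\<open>A\<close> is additive but not equivariant. The weights \<open>w i\<close>
    make its defect at h equal to \<open>\<epsilon>\<close> times \<open>\<delta> h\<close> modulo
    J, so on the kernel of \<open>\<epsilon>\<close>, which is the image of \<open>d1\<close>, it is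
    equivariant modulo J.\<close>
  define A where "A v = lin_ext v (\<lambda>(i, g) x. w i * \<delta> g x)" for v :: "nat \<times> 'a \<Rightarrow> int"
  have A_add: "A (u + v) = A u + A v" if "u \<in> free_mod G n0" "v \<in> free_mod G n0" for u v
    unfolding A_def using lin_ext_add fin that by blast
  have A_diff: "A (u - v) = A u - A v" if "u \<in> free_mod G n0" "v \<in> free_mod G n0" for u v
    using additive_on_diff[of "free_mod G n0" A u v] free_mod_diff A_add that by blast
  have A_act_free: "A (gact G h v) - (act h (A v) + (\<lambda>x. \<epsilon> (e0 v) * \<delta> h x)) \<in> J"
    if v: "v \<in> free_mod G n0" and h: "h \<in> carrier G" for v h
  proof (rule free_mod_hom_in[OF v J, where Q = "\<lambda>v. A (gact G h v) - (act h (A v) + (\<lambda>x. \<epsilon> (e0 v) * \<delta> h x))"])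
    fix u v assume uv: "u \<in> free_mod G n0" "v \<in> free_mod G n0"
    have 1: "\<epsilon> (e0 (u - v)) = \<epsilon> (e0 u) - \<epsilon> (e0 v)" using \<epsilon>_diff e0(3,9) uv by simp
    have 2: "A (gact G h (u - v)) = A (gact G h u) - A (gact G h v)"
      using A_diff uv gact_free_mod[OF h] by (simp add: gact_diff)
    show "A (gact G h (u - v)) - (act h (A (u - v)) + (\<lambda>x. \<epsilon> (e0 (u - v)) * \<delta> h x)) =
        (A (gact G h u) - (act h (A u) + (\<lambda>x. \<epsilon> (e0 u) * \<delta> h x))) -
        (A (gact G h v) - (act h (A v) + (\<lambda>x. \<epsilon> (e0 v) * \<delta> h x)))"
      unfolding 1 2 A_diff[OF uv] act_diff by (auto simp: left_diff_distrib fun_eq_iff)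
  next
    fix i g assume i: "i < n0" and g: "g \<in> carrier G"
    have eb: "\<epsilon> (e0 (unit_vec (i, g))) = w i"
      using \<epsilon>_act[OF g] e0(3)[OF unit_vec_free_mod] e0(10)[OF i g] i by (simp add: w_def)
    have "\<delta> (h \<otimes> g) - (\<delta> h + act h (\<delta> g)) \<in> J"
      using der g h by (simp add: derivation_mod_def J_def)
    from scale_in_additive_subgroup[OF submod_zero[OF J] submod_diff[OF J] this]
    have "(\<lambda>x. w i * (\<delta> (h \<otimes> g) - (\<delta> h + act h (\<delta> g))) x) \<in> J" .
    moreover have "A (gact G h (unit_vec (i, g))) -
        (act h (A (unit_vec (i, g))) + (\<lambda>x. \<epsilon> (e0 (unit_vec (i, g))) * \<delta> h x)) =
        (\<lambda>x. w i * (\<delta> (h \<otimes> g) - (\<delta> h + act h (\<delta> g))) x)"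
      unfolding eb A_def gact_unit_vec[OF g h] lin_ext_unit_vec
      by (auto simp: act_def algebra_simps fun_eq_iff)
    ultimately show "A (gact G h (unit_vec (i, g))) -
        (act h (A (unit_vec (i, g))) + (\<lambda>x. \<epsilon> (e0 (unit_vec (i, g))) * \<delta> h x)) \<in> J" by simp
  qed
  have A_act: "A (gact G h v) - (act h (A v) + (\<lambda>x. \<epsilon> v * \<delta> h x)) \<in> J"
    if "v \<in> P0" "h \<in> carrier G" for v h
    using A_act_free[of v h] that e0(2,4) by auto

  \<comment> \<open>The composite of \<open>d1\<close> and \<open>A\<close> is equivariant only
    modulo J. \<open>F\<close> is its exactly equivariant replacement, prescribed on the free
    generators, and agrees with it modulo J on \<open>P1\<close>.\<close>
  define F where "F v = lin_ext v (\<lambda>(i, g). act g (A (d1 (e1 (unit_vec (i, \<one>))))))"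
    for v :: "nat \<times> 'a \<Rightarrow> int"
  have F_add: "F (u + v) = F u + F v" if "u \<in> free_mod G n1" "v \<in> free_mod G n1" for u v
    unfolding F_def using lin_ext_add fin that by blast
  have F_diff: "F (u - v) = F u - F v" if "u \<in> free_mod G n1" "v \<in> free_mod G n1" for u v
    using additive_on_diff[of "free_mod G n1" F u v] free_mod_diff F_add that by blast
  have F_act: "F (gact G h v) = act h (F v)" if "h \<in> carrier G" "v \<in> free_mod G n1" for h v
  proof -
    have gc: "g \<in> carrier G" if "v (i, g) \<noteq> 0" for i g
      using that \<open>v \<in> free_mod G n1\<close> by (auto simp: free_mod_def)
    show ?thesis unfolding F_def lin_ext_gact[OF that] act_lin_ext
      unfolding lin_ext_def using gc that(1)
      by (intro ext sum.cong refl) (auto simp: act_mult)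
  qed
  have d1_diff: "d1 (u - v) = d1 u - d1 v" if "u \<in> P1" "v \<in> P1" for u v
    using additive_on_diff[of P1 d1 u v] e1(7) gmap_add[OF d1] that by blast
  have \<epsilon>d1: "\<epsilon> (d1 u) = 0" "d1 u \<in> P0" if "u \<in> P1" for u using ex0 that by auto
  have F_A_free: "F v - A (d1 (e1 v)) \<in> J" if v: "v \<in> free_mod G n1" for v
  proof (rule free_mod_hom_in[OF v J, where Q = "\<lambda>v. F v - A (d1 (e1 v))"])
    fix u v assume uv: "u \<in> free_mod G n1" "v \<in> free_mod G n1"
    then have "d1 (e1 (u - v)) = d1 (e1 u) - d1 (e1 v)" using d1_diff e1(3,9) by simp
    then have "A (d1 (e1 (u - v))) = A (d1 (e1 u)) - A (d1 (e1 v))"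
      using A_diff[of "d1 (e1 u)" "d1 (e1 v)"] \<epsilon>d1(2) uv e1(3) e0(4) by (simp add: subset_iff)
    then show "F (u - v) - A (d1 (e1 (u - v))) = (F u - A (d1 (e1 u))) - (F v - A (d1 (e1 v)))"
      using uv F_diff by auto
  next
    fix i g assume i: "i < n1" and g: "g \<in> carrier G"
    let ?b = "unit_vec (i, g)" and ?b1 = "unit_vec (i, \<one>)"
    have b1: "?b1 \<in> free_mod G n1" using i unit_vec_free_mod by simp
    have "d1 (e1 ?b) = gact G g (d1 (e1 ?b1))" using gmap_act[OF d1 g] e1(3)[OF b1] e1(10)[OF i g] by simp
    moreover have "\<epsilon> (d1 (e1 ?b1)) = 0" "d1 (e1 ?b1) \<in> P0" using \<epsilon>d1 e1(3)[OF b1] by auto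
    ultimately have "A (d1 (e1 ?b)) - act g (A (d1 (e1 ?b1))) \<in> J"
      using A_act[of "d1 (e1 ?b1)" g] g by (simp flip: zero_fun_def)
    then show "F ?b - A (d1 (e1 ?b)) \<in> J" unfolding F_def lin_ext_unit_vec using submod_sym[OF J] by auto
  qed
  have F_A: "F v - A (d1 v) \<in> J" if "v \<in> P1" for v
    using F_A_free[of v] that e1(2,4) by auto

  have d2P: "d2 v \<in> P1" "d1 (d2 v) = 0" if "v \<in> P2" for v
    using ex1 that by (auto simp: zero_fun_def)
  have A_zero: "A 0 = 0" using A_diff[OF free_mod_zero free_mod_zero] by simp
  \<comment> \<open>As \<open>d1\<close> kills the image of \<open>d2\<close>, \<open>F\<close> maps
    that image into the union; the finitely many generators of \<open>P2\<close> then determine one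
    stage m.\<close>
  have "F (d2 (e2 (unit_vec (i, \<one>)))) \<in> (\<Union>m. I m)" if "i \<in> {..<n2}" for i
    using F_A[of "d2 (e2 (unit_vec (i, \<one>)))"] d2P e2(3) that unit_vec_free_mod A_zero
    by (simp flip: J_def)
  then obtain m where m: "\<And>i. i < n2 \<Longrightarrow> F (d2 (e2 (unit_vec (i, \<one>)))) \<in> I m"
    using finite_subset_incseq[OF inc, of "{..<n2}" "\<lambda>i. F (d2 (e2 (unit_vec (i, \<one>))))"] by auto
  have Im: "submod (I m)" using I by blast
  have F_d2_free: "F (d2 (e2 v)) \<in> I m" if v: "v \<in> free_mod G n2" for v
  proof (rule free_mod_hom_in[OF v Im, where Q = "\<lambda>v. F (d2 (e2 v))"])
    have d2_diff: "d2 (u - v) = d2 u - d2 v" if "u \<in> P2" "v \<in> P2" for u v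
      using additive_on_diff[of P2 d2 u v] e2(7) gmap_add[OF d2] that by blast
    fix u v assume uv: "u \<in> free_mod G n2" "v \<in> free_mod G n2"
    then have "d2 (e2 (u - v)) = d2 (e2 u) - d2 (e2 v)" using d2_diff e2(3,9) by simp
    then show "F (d2 (e2 (u - v))) = F (d2 (e2 u)) - F (d2 (e2 v))"
      using uv F_diff[of "d2 (e2 u)" "d2 (e2 v)"] d2P(1) e1(4) e2(3) by (simp add: subset_iff)
  next
    fix i g assume i: "i < n2" and g: "g \<in> carrier G"
    let ?b1 = "unit_vec (i, \<one>)"
    have b1: "?b1 \<in> free_mod G n2" using i unit_vec_free_mod by simp
    have "d2 (e2 (unit_vec (i, g))) = gact G g (d2 (e2 ?b1))"
      using gmap_act[OF d2 g] e2(3)[OF b1] e2(10)[OF i g] by simp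
    then have "F (d2 (e2 (unit_vec (i, g)))) = act g (F (d2 (e2 ?b1)))"
      using F_act[OF g] d2P(1) e2(3)[OF b1] e1(4) by auto
    then show "F (d2 (e2 (unit_vec (i, g)))) \<in> I m" using submod_act[OF Im g m[OF i]] by simp
  qed
  have F_ker: "F v \<in> I m" if "v \<in> P1" "d1 v = 0" for v
  proof -
    have "v \<in> d2 ` P2" using ex1 that by (auto simp: zero_fun_def)
    then show ?thesis using F_d2_free e2(2,4) by (metis imageE subsetD)
  qed

  obtain p0 where p0: "p0 \<in> P0" "\<epsilon> p0 = 1" using surj by (metis UNIV_I imageE)
  have "\<exists>q\<in>P1. d1 q = gact G g p0 - p0" if "g \<in> carrier G" for g
  proof -
    have "gact G g p0 - p0 \<in> P0" "\<epsilon> (gact G g p0 - p0) = 0"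
      using e0(7,8) \<epsilon>_act \<epsilon>_diff p0 that by auto
    then have "gact G g p0 - p0 \<in> d1 ` P1" using ex0 by blast
    then show ?thesis by (metis imageE)
  qed
  then obtain q where q: "\<And>g. g \<in> carrier G \<Longrightarrow> q g \<in> P1"
    "\<And>g. g \<in> carrier G \<Longrightarrow> d1 (q g) = gact G g p0 - p0" by metis
  \<comment> \<open>Modulo J, \<open>F (q g)\<close> is \<open>A (g p0) - A p0\<close>, that is
    \<open>\<delta> g\<close> plus the principal derivation of \<open>A p0\<close>. Removing the
    latter keeps the product rule and restores the value of \<open>\<delta>\<close>.\<close>
  define \<delta>' where "\<delta>' g = F (q g) - (act g (A p0) - A p0)" for g
  have "derivation_mod (I m) \<delta>'"
    unfolding derivation_mod_def
  proof (intro ballI)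
    fix g h assume gh: "g \<in> carrier G" "h \<in> carrier G"
    \<comment> \<open>The failure of \<open>q\<close> to be a derivation is a cycle, hence comes
      from \<open>P2\<close>, where \<open>F\<close> takes values in \<open>I m\<close>.\<close>
    let ?v = "q (g \<otimes> h) - (q g + gact G g (q h))"
    have P: "q (g \<otimes> h) \<in> P1" "q g \<in> P1" "gact G g (q h) \<in> P1" using q(1) gh e1(8) by auto
    then have v: "?v \<in> P1" using e1(6,7) by blast
    have "d1 ?v = d1 (q (g \<otimes> h)) - (d1 (q g) + gact G g (d1 (q h)))"
      using d1_diff gmap_add[OF d1] gmap_act[OF d1] P q(1) gh e1(6) by auto
    also have "\<dots> = 0" using q(2) gh by (simp add: gact_diff gact_mult)
    finally have "F ?v \<in> I m" using F_ker v by blast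
    moreover have "F ?v = F (q (g \<otimes> h)) - (F (q g) + act g (F (q h)))"
      using P gh q(1) e1(4,6) F_diff F_add F_act by (metis subsetD)
    moreover have "\<delta>' (g \<otimes> h) - (\<delta>' g + act g (\<delta>' h)) =
        F (q (g \<otimes> h)) - (F (q g) + act g (F (q h)))"
      using gh by (simp add: \<delta>'_def act_diff act_mult)
    ultimately show "\<delta>' (g \<otimes> h) - (\<delta>' g + act g (\<delta>' h)) \<in> I m" by simp
  qed
  moreover have "\<delta>' g - \<delta> g \<in> J" if g: "g \<in> carrier G" for g
  proof -
    have gp: "gact G g p0 \<in> P0" using e0(8) g p0 by blast
    have "F (q g) - (A (gact G g p0) - A p0) \<in> J"
      using F_A[OF q(1)[OF g]] q(2)[OF g] A_diff[of "gact G g p0" p0] gp p0 e0(4)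
      by (simp add: subset_iff)
    moreover have "A (gact G g p0) - (act g (A p0) + \<delta> g) \<in> J"
      using A_act[OF p0(1) g] p0(2) by simp
    ultimately have "(F (q g) - (A (gact G g p0) - A p0)) + (A (gact G g p0) - (act g (A p0) + \<delta> g)) \<in> J"
      using submod_add[OF J] by blast
    then show ?thesis by (simp add: \<delta>'_def algebra_simps)
  qed
  ultimately show "\<exists>m \<delta>'. derivation_mod (I m) \<delta>' \<and> (\<forall>g\<in>carrier G. \<delta>' g - \<delta> g \<in> (\<Union>m. I m))"
    unfolding J_def by blast
qed


section \<open>Fox calculus and finite presentations\<close>

primrec fox :: "(nat \<Rightarrow> 'a) \<Rightarrow> (nat \<Rightarrow> 'x \<Rightarrow> int) \<Rightarrow> word \<Rightarrow> 'x \<Rightarrow> int" where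
  "fox f c [] = 0"
| "fox f c (p # w) =
     (if snd p then - act (inv f (fst p)) (c (fst p)) else c (fst p)) +
     act (if snd p then inv f (fst p) else f (fst p)) (fox f c w)"

lemma eval_word_Nil [simp]: "eval_word G f [] = \<one>"
  by (simp add: eval_word_def)

lemma eval_word_Cons:
  "eval_word G f (p # w) = (if snd p then inv f (fst p) else f (fst p)) \<otimes> eval_word G f w"
  by (simp add: eval_word_def split_beta)

lemma eval_word_closed: "(\<And>i. f i \<in> carrier G) \<Longrightarrow> eval_word G f w \<in> carrier G"
  by (induction w) (auto simp: eval_word_Cons)

lemma eval_word_append:
  "(\<And>i. f i \<in> carrier G) \<Longrightarrow> eval_word G f (u @ v) = eval_word G f u \<otimes> eval_word G f v"
  by (induction u) (auto simp: eval_word_Cons eval_word_closed m_assoc)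

lemma eval_word_cong:
  "(\<And>p. p \<in> set w \<Longrightarrow> f (fst p) = f' (fst p)) \<Longrightarrow> eval_word G f w = eval_word G f' w"
  by (induction w) (auto simp: eval_word_Cons)

lemma inv_word_Cons: "inv_word (p # w) = inv_word w @ [(fst p, \<not> snd p)]"
  by (simp add: inv_word_def split_beta)

lemma inv_word_inv_word: "inv_word (inv_word w) = w"
  by (simp add: inv_word_def rev_map split_beta o_def)

lemma set_inv_word: "fst ` set (inv_word w) = fst ` set w"
  by (auto simp: inv_word_def image_image split_beta)

lemma eval_word_inv_word:
  assumes "\<And>i. f i \<in> carrier G"
  shows "eval_word G f (inv_word w) = inv (eval_word G f w)"
proof (induction w)
  case Nil show ?case by (simp add: inv_word_def)
next
  case (Cons p w)
  then show ?case using assms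
    by (simp add: inv_word_Cons eval_word_append eval_word_Cons eval_word_closed inv_mult_group)
qed

lemma act_zero: "act g 0 = 0" by (simp add: act_def fun_eq_iff)
lemma act_uminus: "act g (- u) = - act g u" by (simp add: act_def fun_eq_iff)

lemma act_inv_cancel: "g \<in> carrier G \<Longrightarrow> act g (act (inv g) m) = m"
  "g \<in> carrier G \<Longrightarrow> act (inv g) (act g m) = m"
  using act_mult[of g "inv g" m] act_mult[of "inv g" g m] act_one by simp_all

text \<open>This product rule is what \<open>fox\<close> is designed for: it is the derivation on
  words with value \<open>c i\<close> at the i-th generator, words acting through their values under
  \<open>f\<close>.\<close>

lemma fox_append:
  assumes "\<And>i. f i \<in> carrier G"
  shows "fox f c (u @ v) = fox f c u + act (eval_word G f u) (fox f c v)"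
  by (induction u)
    (use assms in \<open>auto simp: act_def fun_eq_iff eval_word_Cons \<tau>_mult \<tau>_one eval_word_closed\<close>)

lemma fox_inverse_pair:
  assumes "\<And>i. f i \<in> carrier G"
  shows "fox f c [(i, b), (i, \<not> b)] = 0"
  using assms[of i] by (cases b) (simp_all add: act_zero act_uminus act_inv_cancel)

lemma eval_inverse_pair:
  assumes "\<And>i. f i \<in> carrier G"
  shows "eval_word G f [(i, b), (i, \<not> b)] = \<one>"
  using assms[of i] by (cases b) (simp_all add: eval_word_Cons)

lemma fox_inv_word:
  assumes f: "\<And>i. f i \<in> carrier G"
  shows "fox f c (inv_word w) = - act (inv (eval_word G f w)) (fox f c w)"
proof (induction w)
  case Nil show ?case by (simp add: inv_word_def act_def fun_eq_iff)
next
  case (Cons p w)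
  have "\<tau> g (\<tau> (inv g) x) = x" "\<tau> (inv g) (\<tau> g x) = x" if "g \<in> carrier G" for g x
    using \<tau>_mult[of "inv g" g x] \<tau>_mult[of g "inv g" x] \<tau>_one that by simp_all
  then show ?case
    unfolding inv_word_Cons fox_append[OF f] Cons.IH
    using f by (auto simp: act_def fun_eq_iff eval_word_inv_word eval_word_Cons inv_mult_group
        eval_word_closed \<tau>_mult)
qed

text \<open>The Fox derivation with values \<open>\<delta> (f i)\<close> on the generators agrees
  with \<open>\<delta>\<close> modulo the union on every word, so its values on relators lie in the
  union. Finitely many relators fit into one \<open>I m\<close>. Modulo this \<open>I m\<close> the
  Fox derivation depends only on the group element that a word represents, and evaluating it on
  chosen words gives the lift.\<close>

lemma finitely_presented_derivations_lift:
  assumes "finitely_presented G"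
  shows derivations_lift
  unfolding derivations_lift_def
proof (intro allI impI, elim conjE)
  fix I :: "nat \<Rightarrow> ('x \<Rightarrow> int) set" and \<delta>
  assume I: "\<forall>m. submod (I m)" and inc: "incseq I" and der: "derivation_mod (\<Union>m. I m) \<delta>"
  define J where "J = (\<Union>m. I m)"
  have J: "submod J" unfolding J_def using submod_Union I inc by blast
  obtain n f0 Rs where Rs: "finite Rs" and f0: "f0 ` {..<n} \<subseteq> carrier G" and
    RsW: "\<forall>r\<in>Rs. fst ` set r \<subseteq> {..<n}" and
    gen: "\<forall>g\<in>carrier G. \<exists>w. fst ` set w \<subseteq> {..<n} \<and> eval_word G f0 w = g" and
    pres_all: "\<forall>w. fst ` set w \<subseteq> {..<n} \<longrightarrow>
        (eval_word G f0 w = \<one> \<longleftrightarrow> equivclp (pres_move Rs) w [])"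
    using assms unfolding finitely_presented_def by (elim exE conjE) (rule that; assumption)
  note RsW = bspec[OF RsW]
  have pres: "eval_word G f0 w = \<one> \<longleftrightarrow> equivclp (pres_move Rs) w []" if "fst ` set w \<subseteq> {..<n}" for w
    using pres_all that by simp
  \<comment> \<open>The chain of moves in \<open>equivclp\<close> may pass through letters \<open>\<ge> n\<close>, whose images are
    unconstrained; send those to \<open>\<one>\<close>.\<close>
  define f where "f i = (if i < n then f0 i else \<one>)" for i
  have f: "f i \<in> carrier G" for i using f0 by (auto simp: f_def)
  have ev: "eval_word G f w = eval_word G f0 w" if "fst ` set w \<subseteq> {..<n}" for w
    by (rule eval_word_cong) (use that in \<open>auto simp: f_def\<close>)
  let ?D = "fox f (\<lambda>i. \<delta> (f i))"
  have d1: "\<delta> \<one> \<in> J"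
  proof -
    have "\<delta> (\<one> \<otimes> \<one>) - (\<delta> \<one> + act \<one> (\<delta> \<one>)) \<in> J"
      using der by (simp only: derivation_mod_def J_def one_closed)
    moreover have "\<delta> \<one> - (\<delta> \<one> + act \<one> (\<delta> \<one>)) = - \<delta> \<one>"
      by (simp add: act_one fun_eq_iff)
    ultimately have "- \<delta> \<one> \<in> J" by simp
    from submod_uminus[OF J this] show ?thesis by (simp only: minus_minus)
  qed
  have dmult: "\<delta> (g \<otimes> h) - (\<delta> g + act g (\<delta> h)) \<in> J" if "g \<in> carrier G" "h \<in> carrier G" for g h
    using der that by (simp add: derivation_mod_def J_def)
  have D\<delta>: "?D w - \<delta> (eval_word G f w) \<in> J" for w
  proof (induction w)
    case Nil show ?case using submod_diff[OF J submod_zero[OF J] d1] by (simp only: fox.simps eval_word_Nil)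
  next
    case (Cons p w)
    define a where "a = (if snd p then inv f (fst p) else f (fst p))"
    have a: "a \<in> carrier G" using f by (simp add: a_def)
    have e: "eval_word G f w \<in> carrier G" using eval_word_closed f by blast
    define k where "k = (if snd p then - act (inv f (fst p)) (\<delta> (f (fst p))) else \<delta> (f (fst p)))"
    have k: "k - \<delta> a \<in> J"
    proof (cases "snd p")
      case True
      have "\<delta> \<one> - (\<delta> a + act a (\<delta> (f (fst p)))) \<in> J"
        using dmult[OF a, of "f (fst p)"] f True by (simp add: a_def)
      from submod_diff[OF J this d1] show ?thesis
        by (rule back_subst[where P = "\<lambda>v. v \<in> J"]) (auto simp: k_def a_def True fun_eq_iff)
    next
      case False then show ?thesis using submod_zero[OF J] by (simp add: k_def a_def)
    qed
    have "k + act a (?D w) - (\<delta> a + act a (\<delta> (eval_word G f w))) \<in> J"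
      using submod_add_cong[OF J k submod_act_cong[OF J a Cons.IH]] .
    moreover have "?D (p # w) = k + act a (?D w)" by (simp add: k_def a_def)
    moreover have "eval_word G f (p # w) = a \<otimes> eval_word G f w"
      by (simp add: a_def eval_word_Cons)
    ultimately show ?case using submod_trans[OF J _ submod_sym[OF J dmult[OF a e]]] by (simp only:)
  qed
  have Rs1: "eval_word G f r = \<one>" if "r \<in> Rs" for r
  proof -
    have "pres_move Rs [] r" using that by (auto simp: pres_move_def)
    then have "equivclp (pres_move Rs) r []"
      by (intro equivclp_sym[OF r_into_equivclp])
    then show ?thesis using pres[OF RsW[OF that]] ev[OF RsW[OF that]] by simp
  qed
  have "?D r \<in> (\<Union>m. I m)" if "r \<in> Rs" for r
    using submod_add[OF J D\<delta>[of r] d1] Rs1[OF that] by (simp add: J_def)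
  then obtain m where m: "\<And>r. r \<in> Rs \<Longrightarrow> ?D r \<in> I m"
    using finite_subset_incseq[OF inc Rs, of ?D] by blast
  have Im: "submod (I m)" using I by blast
  have move: "?D v - ?D u \<in> I m \<and> eval_word G f u = eval_word G f v" if mv: "pres_move Rs u v" for u v
  proof -
    obtain p q r where u: "u = p @ q" and v: "v = p @ r @ q"
      and r: "(\<exists>i b. r = [(i, b), (i, \<not> b)]) \<or> r \<in> Rs \<or> inv_word r \<in> Rs"
      using mv unfolding pres_move_def by blast
    have "?D r \<in> I m \<and> eval_word G f r = \<one>" using r
    proof (elim disjE exE)
      fix i b assume "r = [(i, b), (i, \<not> b)]"
      then show ?thesis using submod_zero[OF Im]
        by (simp only: fox_inverse_pair[where f = f, OF f] eval_inverse_pair[where f = f, OF f] simp_thms)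
    next
      assume "r \<in> Rs" then show ?thesis using m Rs1 by blast
    next
      assume "inv_word r \<in> Rs"
      then have *: "?D (inv_word r) \<in> I m" "eval_word G f (inv_word r) = \<one>" using m Rs1 by auto
      from fox_inv_word[where f = f, OF f, of "\<lambda>i. \<delta> (f i)" "inv_word r"] have "?D r = - ?D (inv_word r)"
        by (simp add: inv_word_inv_word * act_one)
      moreover have "eval_word G f r = \<one>"
        using eval_word_inv_word[where f = f, OF f, of "inv_word r"] by (simp add: inv_word_inv_word *)
      ultimately show ?thesis using submod_uminus[OF Im *(1)] by simp
    qed
    then have r': "?D r \<in> I m" "eval_word G f r = \<one>" by auto
    \<comment> \<open>The inserted word r evaluates to the identity, so the letters after it act as
      before and only the translated contribution of r itself appears.\<close>
    have "?D v - ?D u = act (eval_word G f p) (?D r)"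
      unfolding u v fox_append[where f = f, OF f] r'(2) act_one act_add by simp
    then show ?thesis
      using submod_act[OF Im eval_word_closed[where f = f, OF f] r'(1)] r'(2)
      by (simp add: u v eval_word_append[where f = f, OF f] eval_word_closed[where f = f, OF f])
  qed
  have equiv: "?D u - ?D v \<in> I m" if "equivclp (pres_move Rs) u v" for u v
    using that
  proof (induction rule: equivclp_induct)
    case base then show ?case using submod_zero[OF Im] by (simp only: diff_self)
  next
    case (step y z)
    then have "?D y - ?D z \<in> I m" using move submod_sym[OF Im] by blast
    then show ?case using submod_trans[OF Im step.IH] by blast
  qed
  have same: "?D u - ?D v \<in> I m"
    if u: "fst ` set u \<subseteq> {..<n}" and v: "fst ` set v \<subseteq> {..<n}"
      and uv: "eval_word G f u = eval_word G f v" for u v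
  proof -
    have "eval_word G f (u @ inv_word v) = \<one>"
      using uv eval_word_closed[where f = f, OF f] by (simp add: eval_word_append[where f = f, OF f] eval_word_inv_word[where f = f, OF f])
    moreover have "fst ` set (u @ inv_word v) \<subseteq> {..<n}"
      using u v set_inv_word[of v] by (simp add: image_Un)
    ultimately have "?D (u @ inv_word v) - ?D [] \<in> I m" by (intro equiv) (simp flip: pres add: ev)
    moreover have "?D (u @ inv_word v) = ?D u - ?D v"
      using eval_word_closed[where f = f, OF f] by (simp add: fox_append[where f = f, OF f] fox_inv_word[where f = f, OF f] uv act_uminus act_inv_cancel)
    ultimately show ?thesis by simp
  qed
  obtain wd where wd: "\<And>g. g \<in> carrier G \<Longrightarrow> fst ` set (wd g) \<subseteq> {..<n}"
    "\<And>g. g \<in> carrier G \<Longrightarrow> eval_word G f0 (wd g) = g" using gen by metis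
  have wd_f: "eval_word G f (wd g) = g" if "g \<in> carrier G" for g
    using wd[OF that] ev[OF wd(1)[OF that]] by simp
  have "derivation_mod (I m) (\<lambda>g. ?D (wd g))"
    unfolding derivation_mod_def
  proof (intro ballI)
    fix g h assume gh: "g \<in> carrier G" "h \<in> carrier G"
    have "?D (wd (g \<otimes> h)) - ?D (wd g @ wd h) \<in> I m"
      using gh wd(1) wd_f by (intro same) (simp_all add: eval_word_append[where f = f, OF f] image_Un)
    then show "?D (wd (g \<otimes> h)) - (?D (wd g) + act g (?D (wd h))) \<in> I m"
      using gh wd_f by (simp add: fox_append[where f = f, OF f])
  qed
  moreover have "?D (wd g) - \<delta> g \<in> J" if "g \<in> carrier G" for g
    using D\<delta>[of "wd g"] wd_f[OF that] by simp
  ultimately show "\<exists>m \<delta>'. derivation_mod (I m) \<delta>' \<and> (\<forall>g\<in>carrier G. \<delta>' g - \<delta> g \<in> (\<Union>m. I m))"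
    unfolding J_def by blast
qed

end

section \<open>Derivations into permutation modules\<close>

text \<open>With this \<open>\<tau>\<close>, \<open>act g\<close> is left translation of functions
  on the group. Points outside the carrier stay fixed, so the action laws hold on the whole
  type.\<close>

locale translation =
  right_action G "\<lambda>g x. if x \<in> carrier G then inv\<^bsub>G\<^esub> g \<otimes>\<^bsub>G\<^esub> x else x" for G (structure)

lemma (in group) translation: "translation G"
  by unfold_locales (auto simp: inv_mult_group m_assoc)

context translation begin

lemma act_apply: "x \<in> carrier G \<Longrightarrow> act g v x = v (inv g \<otimes> x)"
  by (simp add: act_def)

lemma in_coset_iff:
  assumes "subgroup K G" "g \<in> carrier G" "h \<in> carrier G" "inv g \<otimes> h \<in> K" "x \<in> carrier G"
  shows "inv g \<otimes> x \<in> K \<longleftrightarrow> inv h \<otimes> x \<in> K"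
proof -
  interpret K: subgroup K G by fact
  have "inv g \<otimes> x = (inv g \<otimes> h) \<otimes> (inv h \<otimes> x)" "inv h \<otimes> x = inv (inv g \<otimes> h) \<otimes> (inv g \<otimes> x)"
    using assms(2,3,5) by (simp_all add: m_assoc inv_mult_group) (simp_all flip: m_assoc)
  then show ?thesis using assms(4) K.m_closed K.m_inv_closed by metis
qed

section \<open>Permutation modules on cosets as quotients of the group ring\<close>

definition fin_supp :: "('a \<Rightarrow> int) \<Rightarrow> bool" where
  "fin_supp v \<longleftrightarrow> finite {x. v x \<noteq> 0} \<and> {x. v x \<noteq> 0} \<subseteq> carrier G"

text \<open>The coefficient of the coset gK in the image of v in \<open>\<int>[G/K]\<close>; it
  replaces an explicit quotient map.\<close>

definition coset_sum :: "'a set \<Rightarrow> ('a \<Rightarrow> int) \<Rightarrow> 'a \<Rightarrow> int" where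
  "coset_sum K v g = (\<Sum>x | v x \<noteq> 0 \<and> inv g \<otimes> x \<in> K. v x)"

text \<open>The kernel of \<open>\<int>[G] \<rightarrow> \<int>[G/K]\<close>.\<close>
definition coset_null :: "'a set \<Rightarrow> ('a \<Rightarrow> int) set" where
  "coset_null K = {v. fin_supp v \<and> (\<forall>g\<in>carrier G. coset_sum K v g = 0)}"

lemma coset_sum_superset:
  assumes "finite S" "{x. v x \<noteq> 0} \<subseteq> S"
  shows "coset_sum K v g = (\<Sum>x\<in>S. if inv g \<otimes> x \<in> K then v x else 0)"
proof -
  have "(\<Sum>x\<in>S. if inv g \<otimes> x \<in> K then v x else 0) = (\<Sum>x\<in>{x \<in> S. inv g \<otimes> x \<in> K}. v x)"
    using assms(1) by (simp add: sum.inter_filter)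
  also have "\<dots> = coset_sum K v g"
    unfolding coset_sum_def by (rule sum.mono_neutral_right) (use assms in auto)
  finally show ?thesis by simp
qed

lemma fin_supp_zero: "fin_supp 0"
  by (simp add: fin_supp_def)

lemma fin_supp_diff: "fin_supp u \<Longrightarrow> fin_supp v \<Longrightarrow> fin_supp (u - v)"
proof -
  assume *: "fin_supp u" "fin_supp v"
  have "{x. (u - v) x \<noteq> 0} \<subseteq> {x. u x \<noteq> 0} \<union> {x. v x \<noteq> 0}" by auto
  with * show ?thesis unfolding fin_supp_def by (meson finite_Un finite_subset le_sup_iff order_trans)
qed

lemma fin_supp_add: "fin_supp u \<Longrightarrow> fin_supp v \<Longrightarrow> fin_supp (u + v)"
  using fin_supp_diff[of u "0 - v"] fin_supp_diff[OF fin_supp_zero, of v] by simp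

lemma coset_sum_diff:
  assumes "fin_supp u" "fin_supp v"
  shows "coset_sum K (u - v) g = coset_sum K u g - coset_sum K v g"
proof -
  let ?S = "{x. u x \<noteq> 0} \<union> {x. v x \<noteq> 0}"
  have S: "finite ?S" using assms by (simp add: fin_supp_def)
  have "coset_sum K (u - v) g = (\<Sum>x\<in>?S. if inv g \<otimes> x \<in> K then (u - v) x else 0)"
    by (rule coset_sum_superset[OF S]) auto
  also have "\<dots> = (\<Sum>x\<in>?S. if inv g \<otimes> x \<in> K then u x else 0) - (\<Sum>x\<in>?S. if inv g \<otimes> x \<in> K then v x else 0)"
    unfolding sum_subtractf[symmetric] by (rule sum.cong) auto
  also have "\<dots> = coset_sum K u g - coset_sum K v g"
    using coset_sum_superset[OF S, of u] coset_sum_superset[OF S, of v] by auto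
  finally show ?thesis .
qed

lemma coset_sum_zero: "coset_sum K 0 g = 0"
  by (simp add: coset_sum_def)

lemma coset_sum_add:
  assumes "fin_supp u" "fin_supp v"
  shows "coset_sum K (u + v) g = coset_sum K u g + coset_sum K v g"
proof -
  have "coset_sum K (u + v - v) g = coset_sum K (u + v) g - coset_sum K v g"
    by (rule coset_sum_diff[OF fin_supp_add[OF assms] assms(2)])
  then show ?thesis by simp
qed

lemma supp_act:
  assumes "fin_supp v" "f \<in> carrier G"
  shows "{x. act f v x \<noteq> 0} = (\<lambda>x. f \<otimes> x) ` {x. v x \<noteq> 0}"
proof (intro equalityI subsetI)
  fix x assume x: "x \<in> {x. act f v x \<noteq> 0}"
  have xc: "x \<in> carrier G"
  proof (rule ccontr)
    assume "x \<notin> carrier G"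
    then show False using x assms(1) by (auto simp: act_def fin_supp_def)
  qed
  then have "x = f \<otimes> (inv f \<otimes> x)" using assms(2) by (simp flip: m_assoc)
  then show "x \<in> (\<lambda>x. f \<otimes> x) ` {x. v x \<noteq> 0}" using x xc by (auto simp: act_apply)
next
  fix y assume "y \<in> (\<lambda>x. f \<otimes> x) ` {x. v x \<noteq> 0}"
  then obtain x where x: "y = f \<otimes> x" "v x \<noteq> 0" "x \<in> carrier G" using assms(1) by (auto simp: fin_supp_def)
  then show "y \<in> {x. act f v x \<noteq> 0}" using assms(2) by (simp add: act_apply flip: m_assoc)
qed

lemma fin_supp_act: "fin_supp v \<Longrightarrow> f \<in> carrier G \<Longrightarrow> fin_supp (act f v)"
  using supp_act[of v f] unfolding fin_supp_def by auto

lemma coset_sum_act: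
  assumes "fin_supp v" "f \<in> carrier G" "g \<in> carrier G"
  shows "coset_sum K (act f v) g = coset_sum K v (inv f \<otimes> g)"
proof -
  have S: "x \<in> carrier G" if "v x \<noteq> 0" for x using that assms(1) by (auto simp: fin_supp_def)
  have *: "inv g \<otimes> (f \<otimes> x) = inv (inv f \<otimes> g) \<otimes> x" if "x \<in> carrier G" for x
    using assms(2,3) that by (simp add: inv_mult_group m_assoc)
  have "{x. act f v x \<noteq> 0 \<and> inv g \<otimes> x \<in> K} = (\<lambda>x. f \<otimes> x) ` {x. v x \<noteq> 0 \<and> inv (inv f \<otimes> g) \<otimes> x \<in> K}"
  proof -
    have "{x. act f v x \<noteq> 0 \<and> inv g \<otimes> x \<in> K} = {y \<in> (\<lambda>x. f \<otimes> x) ` {x. v x \<noteq> 0}. inv g \<otimes> y \<in> K}"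
      unfolding supp_act[OF assms(1,2), symmetric] by simp
    also have "\<dots> = (\<lambda>x. f \<otimes> x) ` {x \<in> {x. v x \<noteq> 0}. inv g \<otimes> (f \<otimes> x) \<in> K}" by blast
    also have "{x \<in> {x. v x \<noteq> 0}. inv g \<otimes> (f \<otimes> x) \<in> K} = {x. v x \<noteq> 0 \<and> inv (inv f \<otimes> g) \<otimes> x \<in> K}"
      using * S by auto
    finally show ?thesis .
  qed
  moreover have "inj_on (\<lambda>x. f \<otimes> x) {x. v x \<noteq> 0 \<and> inv (inv f \<otimes> g) \<otimes> x \<in> K}"
    using S assms(2) by (auto simp: inj_on_def)
  ultimately have "coset_sum K (act f v) g =
      (\<Sum>x | v x \<noteq> 0 \<and> inv (inv f \<otimes> g) \<otimes> x \<in> K. act f v (f \<otimes> x))"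
    unfolding coset_sum_def by (simp add: sum.reindex)
  also have "\<dots> = coset_sum K v (inv f \<otimes> g)"
    unfolding coset_sum_def
    by (rule sum.cong) (use S assms(2) in \<open>auto simp: act_apply simp flip: m_assoc\<close>)
  finally show ?thesis .
qed

lemma submod_coset_null: "submod (coset_null K)"
  unfolding submod_def coset_null_def
  using fin_supp_zero coset_sum_zero fin_supp_diff coset_sum_diff fin_supp_act coset_sum_act
  by auto

text \<open>A coset of the larger group is a disjoint union of cosets of the smaller one. Grouping
  the support accordingly turns a sum over the former into a sum of sums that vanish;
  \<open>cls\<close> names a small coset by its trace on the support.\<close>

lemma coset_null_mono:
  assumes K: "subgroup K G" and K': "subgroup K' G" and sub: "K \<subseteq> K'"
  shows "coset_null K \<subseteq> coset_null K'"
proof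
  fix v assume v: "v \<in> coset_null K"
  then have fs: "fin_supp v" and null: "\<And>g. g \<in> carrier G \<Longrightarrow> coset_sum K v g = 0"
    by (auto simp: coset_null_def)
  have "coset_sum K' v g = 0" if g: "g \<in> carrier G" for g
  proof -
    define S where "S = {x. v x \<noteq> 0 \<and> inv g \<otimes> x \<in> K'}"
    define cls where "cls y = {x. v x \<noteq> 0 \<and> inv y \<otimes> x \<in> K}" for y
    have fin: "finite S" using fs by (simp add: S_def fin_supp_def)
    have Sc: "x \<in> carrier G" if "v x \<noteq> 0" for x using that fs by (auto simp: fin_supp_def)
    have "(\<Sum>x | x \<in> S \<and> cls x = c. v x) = 0" if "c \<in> cls ` S" for c
    proof -
      obtain y where y: "y \<in> S" "c = cls y" using \<open>c \<in> cls ` S\<close> by blast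
      have yc: "y \<in> carrier G" using y Sc by (simp add: S_def)
      have "x \<in> S \<and> cls x = cls y \<longleftrightarrow> v x \<noteq> 0 \<and> inv y \<otimes> x \<in> K" for x
      proof
        assume x: "x \<in> S \<and> cls x = cls y"
        then have vx: "v x \<noteq> 0" "x \<in> carrier G" using Sc by (auto simp: S_def)
        then have "x \<in> cls x" using subgroup.one_closed[OF K] by (simp add: cls_def)
        then show "v x \<noteq> 0 \<and> inv y \<otimes> x \<in> K" using x by (auto simp: cls_def)
      next
        assume x: "v x \<noteq> 0 \<and> inv y \<otimes> x \<in> K"
        then have xc: "x \<in> carrier G" using Sc by blast
        have "cls x = cls y"
          using in_coset_iff[OF K yc xc] x Sc by (auto simp: cls_def)
        moreover have "inv g \<otimes> x \<in> K'"
          using in_coset_iff[OF K' g yc _ xc] y x sub by (auto simp: S_def)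
        ultimately show "x \<in> S \<and> cls x = cls y" using x by (simp add: S_def)
      qed
      then show ?thesis using null[OF yc] by (simp add: coset_sum_def y)
    qed
    then have "(\<Sum>c\<in>cls ` S. \<Sum>x | x \<in> S \<and> cls x = c. v x) = 0" by (rule sum.neutral[OF ballI])
    then show ?thesis using sum.group[OF fin finite_imageI[OF fin] order_refl, of v cls]
      by (simp add: coset_sum_def S_def)
  qed
  then show "v \<in> coset_null K'" using fs by (simp add: coset_null_def)
qed

lemma incseq_coset_null:
  assumes "\<And>m. subgroup (K m) G" "incseq K"
  shows "incseq (\<lambda>m :: nat. coset_null (K m))"
  using assms coset_null_mono by (simp add: incseq_def)

text \<open>The group ring modulo these kernels commutes with the union because supports are finite.
  There are finitely many pairs of support points in a common coset of the union, and some
  \<open>K m\<close> already contains all their quotients; from then on both subgroups partition the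
  support in the same way.\<close>

lemma Union_coset_null:
  assumes K: "\<And>m. subgroup (K m) G" and inc: "incseq K" and C: "subgroup (\<Union>m. K m) G"
  shows "(\<Union>m :: nat. coset_null (K m)) = coset_null (\<Union>m. K m)"
proof (intro equalityI subsetI)
  fix v assume "v \<in> (\<Union>m. coset_null (K m))"
  then show "v \<in> coset_null (\<Union>m. K m)" using coset_null_mono[OF K C] by blast
next
  fix v assume v: "v \<in> coset_null (\<Union>m. K m)"
  then have fs: "fin_supp v" by (simp add: coset_null_def)
  define S where "S = {x. v x \<noteq> 0}"
  have fin: "finite S" and Sc: "S \<subseteq> carrier G" using fs by (auto simp: S_def fin_supp_def)
  let ?P = "{(x, y) \<in> S \<times> S. inv x \<otimes> y \<in> (\<Union>m. K m)}"
  have "finite ?P" using fin by (rule_tac finite_subset[of _ "S \<times> S"]) auto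
  then obtain m where "\<forall>p\<in>?P. inv (fst p) \<otimes> snd p \<in> K m"
    using finite_subset_incseq[OF inc, of ?P "\<lambda>p. inv (fst p) \<otimes> snd p"] by fastforce
  then have m: "inv x \<otimes> y \<in> K m" if "x \<in> S" "y \<in> S" "inv x \<otimes> y \<in> (\<Union>m. K m)" for x y
    using that by fastforce
  have "coset_sum (K m) v g = 0" if g: "g \<in> carrier G" for g
  proof (cases "\<exists>y\<in>S. inv g \<otimes> y \<in> K m")
    case False
    then have "{x. v x \<noteq> 0 \<and> inv g \<otimes> x \<in> K m} = {}" by (auto simp: S_def)
    then show ?thesis by (simp only: coset_sum_def sum.empty)
  next
    case True
    then obtain y where y: "y \<in> S" "inv g \<otimes> y \<in> K m" by blast
    have yc: "y \<in> carrier G" using y Sc by blast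
    have "{x. v x \<noteq> 0 \<and> inv g \<otimes> x \<in> K m} = {x. v x \<noteq> 0 \<and> inv y \<otimes> x \<in> (\<Union>m. K m)}"
    proof (intro equalityI subsetI)
      fix x assume x: "x \<in> {x. v x \<noteq> 0 \<and> inv g \<otimes> x \<in> K m}"
      then have "inv y \<otimes> x \<in> K m" using in_coset_iff[OF K g yc y(2)] Sc by (auto simp: S_def)
      then show "x \<in> {x. v x \<noteq> 0 \<and> inv y \<otimes> x \<in> (\<Union>m. K m)}" using x by blast
    next
      fix x assume x: "x \<in> {x. v x \<noteq> 0 \<and> inv y \<otimes> x \<in> (\<Union>m. K m)}"
      then have "inv y \<otimes> x \<in> K m" "x \<in> carrier G" using m[OF y(1)] Sc by (auto simp: S_def)
      then show "x \<in> {x. v x \<noteq> 0 \<and> inv g \<otimes> x \<in> K m}"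
        using in_coset_iff[OF K g yc y(2)] x by simp
    qed
    then have "coset_sum (K m) v g = coset_sum (\<Union>m. K m) v y" by (simp only: coset_sum_def)
    then show ?thesis using v yc by (simp add: coset_null_def)
  qed
  then show "v \<in> (\<Union>m. coset_null (K m))" using fs by (auto simp: coset_null_def)
qed

definition pt :: "'a \<Rightarrow> 'a \<Rightarrow> int" where
  "pt x = (\<lambda>y. if y = x then 1 else 0)"

lemma fin_supp_pt: "x \<in> carrier G \<Longrightarrow> fin_supp (pt x)"
  by (auto simp: fin_supp_def pt_def)

lemma act_pt: "f \<in> carrier G \<Longrightarrow> x \<in> carrier G \<Longrightarrow> act f (pt x) = pt (f \<otimes> x)"
  by (auto simp: act_def pt_def fun_eq_iff inv_solve_left' simp flip: m_assoc)

lemma coset_sum_pt: "coset_sum K (pt x) g = (if inv g \<otimes> x \<in> K then 1 else 0)"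
  by (subst coset_sum_superset[of "{x}"]) (auto simp: pt_def)

lemma pt_diff_coset_null:
  assumes "subgroup K G" "x \<in> carrier G" "y \<in> carrier G" "inv x \<otimes> y \<in> K"
  shows "pt x - pt y \<in> coset_null K"
proof -
  have "inv g \<otimes> x \<in> K \<longleftrightarrow> inv g \<otimes> y \<in> K" if g: "g \<in> carrier G" for g
  proof -
    have *: "inv (inv g \<otimes> z) = inv z \<otimes> g" if "z \<in> carrier G" for z
      using that g by (simp add: inv_mult_group)
    have "inv g \<otimes> z \<in> K \<longleftrightarrow> inv z \<otimes> g \<in> K" if "z \<in> carrier G" for z
      using subgroup.m_inv_closed[OF assms(1)] *[OF that] that g by (metis inv_closed inv_inv m_closed)
    then show ?thesis using in_coset_iff[OF assms g] assms(2,3) by simp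
  qed
  then show ?thesis
    using fin_supp_pt assms(2,3) by (simp add: coset_null_def fin_supp_diff coset_sum_diff coset_sum_pt)
qed

text \<open>An almost invariant function \<open>M\<close> on \<open>G/C\<close> has coboundary \<open>f \<mapsto> M - f M\<close> with values in
  \<open>\<int>[G/C]\<close>; here it is lifted to \<open>\<int>[G]\<close> along a choice of coset representatives.\<close>
lemma almost_invariant_derivation:
  fixes M :: "'a \<Rightarrow> int"
  assumes C: "subgroup C G"
    and M: "\<And>g c. g \<in> carrier G \<Longrightarrow> c \<in> C \<Longrightarrow> M (g \<otimes> c) = M g"
    and fin: "\<And>f. f \<in> carrier G \<Longrightarrow> \<exists>D. finite D \<and> D \<subseteq> carrier G \<and>
        (\<forall>g\<in>carrier G. M g \<noteq> M (inv f \<otimes> g) \<longrightarrow> (\<exists>d\<in>D. inv d \<otimes> g \<in> C))"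
  obtains \<delta> where "derivation_mod (coset_null C) \<delta>" "\<And>f. f \<in> carrier G \<Longrightarrow> fin_supp (\<delta> f)"
    "\<And>f g. f \<in> carrier G \<Longrightarrow> g \<in> carrier G \<Longrightarrow> coset_sum C (\<delta> f) g = M g - M (inv f \<otimes> g)"
proof -
  interpret C: subgroup C G by fact
  \<comment> \<open>The condition under \<open>SOME\<close> depends only on the coset of g, so all
    members of a coset receive the same representative.\<close>
  define rep where "rep g = (SOME x. x \<in> carrier G \<and> inv g \<otimes> x \<in> C)" for g
  have rep: "rep g \<in> carrier G" "inv g \<otimes> rep g \<in> C" if "g \<in> carrier G" for g
    unfolding rep_def using someI[of "\<lambda>x. x \<in> carrier G \<and> inv g \<otimes> x \<in> C" g] that C.one_closed by auto
  have rep_eq: "rep g = rep h" if "g \<in> carrier G" "h \<in> carrier G" "inv g \<otimes> h \<in> C" for g h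
    unfolding rep_def using in_coset_iff[OF C that] by (metis (no_types, lifting))
  have M_coset: "M g = M h" if "g \<in> carrier G" "h \<in> carrier G" "inv g \<otimes> h \<in> C" for g h
  proof -
    have "g \<otimes> (inv g \<otimes> h) = h" using that by (simp flip: m_assoc)
    then show ?thesis using M[OF that(1,3)] by simp
  qed
  define \<delta> where "\<delta> f = (\<lambda>g. if g \<in> carrier G \<and> g = rep g then M g - M (inv f \<otimes> g) else 0)" for f
  have fs: "fin_supp (\<delta> f)" if f: "f \<in> carrier G" for f
  proof -
    obtain D where D: "finite D" "D \<subseteq> carrier G"
      "\<And>g. g \<in> carrier G \<Longrightarrow> M g \<noteq> M (inv f \<otimes> g) \<Longrightarrow> \<exists>d\<in>D. inv d \<otimes> g \<in> C"
      using fin[OF f] by metis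
    have "{x. \<delta> f x \<noteq> 0} \<subseteq> rep ` D"
    proof
      fix x assume "x \<in> {x. \<delta> f x \<noteq> 0}"
      then have x: "x \<in> carrier G" "x = rep x" "M x \<noteq> M (inv f \<otimes> x)"
        by (auto simp: \<delta>_def split: if_splits)
      then obtain d where d: "d \<in> D" "inv d \<otimes> x \<in> C" using D(3) by blast
      then have "rep d = x" using rep_eq[of d x] D(2) x by auto
      then show "x \<in> rep ` D" using d by blast
    qed
    then show ?thesis using D(1) unfolding fin_supp_def
      by (auto simp: \<delta>_def finite_subset split: if_splits)
  qed
  have sum: "coset_sum C (\<delta> f) g = M g - M (inv f \<otimes> g)" if f: "f \<in> carrier G" and g: "g \<in> carrier G" for f g
  proof -
    have rr: "rep (rep g) = rep g" using rep_eq[OF g rep(1)[OF g] rep(2)[OF g]] by simp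
    have "x = rep g" if x: "x \<in> carrier G" "x = rep x" "inv g \<otimes> x \<in> C" for x
      using rep_eq[OF g x(1,3)] x(2) by simp
    then have sub: "{x. \<delta> f x \<noteq> 0 \<and> inv g \<otimes> x \<in> C} \<subseteq> {rep g}" by (auto simp: \<delta>_def split: if_splits)
    have "coset_sum C (\<delta> f) g = (\<Sum>x\<in>{rep g}. \<delta> f x)"
      unfolding coset_sum_def
      by (rule sum.mono_neutral_left) (use sub rep[OF g] in auto)
    also have "\<dots> = M (rep g) - M (inv f \<otimes> rep g)" using rr rep(1)[OF g] by (simp add: \<delta>_def)
    also have "M (rep g) = M g" using M_coset[OF g rep[OF g]] by simp
    also have "M (inv f \<otimes> rep g) = M (inv f \<otimes> g)"
    proof (rule M_coset[symmetric])
      show "inv (inv f \<otimes> g) \<otimes> (inv f \<otimes> rep g) \<in> C"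
      proof -
        have "inv (inv f \<otimes> g) \<otimes> (inv f \<otimes> rep g) = inv g \<otimes> (f \<otimes> inv f) \<otimes> rep g"
          using f g rep(1)[OF g] by (simp only: inv_mult_group m_assoc inv_inv inv_closed m_closed)
        then show ?thesis using f g rep[OF g] by simp
      qed
    qed (use f g rep in auto)
    finally show ?thesis .
  qed
  have "derivation_mod (coset_null C) \<delta>"
    unfolding derivation_mod_def
  proof (intro ballI)
    fix f h assume fh: "f \<in> carrier G" "h \<in> carrier G"
    have "coset_sum C (\<delta> (f \<otimes> h) - (\<delta> f + act f (\<delta> h))) g = 0" if g: "g \<in> carrier G" for g
    proof -
      have "coset_sum C (\<delta> (f \<otimes> h) - (\<delta> f + act f (\<delta> h))) g =
          coset_sum C (\<delta> (f \<otimes> h)) g - (coset_sum C (\<delta> f) g + coset_sum C (\<delta> h) (inv f \<otimes> g))"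
        using fh g fs by (simp add: coset_sum_diff coset_sum_add fin_supp_add fin_supp_act coset_sum_act)
      also have "\<dots> = 0" using fh g by (simp add: sum inv_mult_group m_assoc)
      finally show ?thesis .
    qed
    moreover have "fin_supp (\<delta> (f \<otimes> h) - (\<delta> f + act f (\<delta> h)))"
      using fh fs by (simp add: fin_supp_diff fin_supp_add fin_supp_act)
    ultimately show "\<delta> (f \<otimes> h) - (\<delta> f + act f (\<delta> h)) \<in> coset_null C"
      by (simp add: coset_null_def)
  qed
  then show thesis using that fs sum by blast
qed

text \<open>If \<open>\<delta>\<close> lifted to \<open>\<delta>'\<close> modulo the kernel of \<open>\<int>[G] \<rightarrow> \<int>[G/K m]\<close>, then \<open>\<delta>'\<close> would vanish on
  \<open>k 0, k 1, \<dots>\<close> up to the first \<open>k j\<close> outside \<open>K m\<close>. As \<open>k j\<close> commutes with \<open>s k j s\<close>, the element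
  \<open>\<delta>' (s k j s) = 1 - s + s k j - s k j s\<close> would be fixed by \<open>k j\<close>, but the coset \<open>K m\<close> has different
  coefficients in it and in its translate.\<close>
lemma no_lift:
  assumes K: "\<And>m. subgroup (K m) G" and inc: "incseq K" and C: "subgroup (\<Union>m. K m) G"
    and der: "derivation_mod (coset_null (\<Union>m. K m)) \<delta>"
    and carrier: "x \<in> carrier G" "t \<in> carrier G" "s \<in> carrier G"
    and \<delta>: "\<delta> x \<in> coset_null (\<Union>m. K m)" "\<delta> t \<in> coset_null (\<Union>m. K m)"
      "\<delta> s - (pt \<one> - pt s) \<in> coset_null (\<Union>m. K m)"
    and invol: "t \<otimes> t = \<one>" "s \<otimes> s = \<one>" and s: "s \<notin> (\<Union>m. K m)"
    and conj: "\<And>m g. g \<in> K m \<Longrightarrow> s \<otimes> g \<otimes> s \<in> K m"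
    and k: "k 0 = x" "\<And>j. k (Suc j) = t \<otimes> (s \<otimes> k j \<otimes> s) \<otimes> t"
    and kC: "\<And>j. k j \<in> (\<Union>m. K m)"
    and comm: "\<And>j. (s \<otimes> k j \<otimes> s) \<otimes> k j = k j \<otimes> (s \<otimes> k j \<otimes> s)"
    and unbounded: "\<And>m. \<exists>j. k j \<notin> K m"
  shows "\<not> derivations_lift"
proof
  assume derivations_lift
  define I where "I m = coset_null (K m)" for m
  have I: "submod (I m)" for m by (simp add: I_def submod_coset_null)
  have Iinc: "incseq I" unfolding I_def by (rule incseq_coset_null[OF K inc])
  have UI: "(\<Union>m. I m) = coset_null (\<Union>m. K m)" unfolding I_def by (rule Union_coset_null[OF K inc C])
  obtain m0 D where D: "derivation_mod (I m0) D" "\<And>g. g \<in> carrier G \<Longrightarrow> D g - \<delta> g \<in> (\<Union>m. I m)"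
    using \<open>derivations_lift\<close>[unfolded derivations_lift_def, rule_format, of I \<delta>] I Iinc der UI by auto
  have UIs: "submod (\<Union>m. I m)" using submod_Union[OF I Iinc] .
  have "D x \<in> (\<Union>m. I m)" "D t \<in> (\<Union>m. I m)"
    using submod_add[OF UIs D(2) , of x "\<delta> x"] submod_add[OF UIs D(2) , of t "\<delta> t"] carrier \<delta> UI by simp_all
  moreover have "D s - (pt \<one> - pt s) \<in> (\<Union>m. I m)"
    by (rule submod_trans[OF UIs D(2)[OF carrier(3)]]) (use \<delta>(3) UI in \<open>simp only:\<close>)
  ultimately obtain m1 m2 m3 where "D x \<in> I m1" "D t \<in> I m2" "D s - (pt \<one> - pt s) \<in> I m3"
    by (elim UN_E) (rule that)
  \<comment> \<open>Congruences persist at later stages, so the product rule and the three initial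
    values can be read at a single stage.\<close>
  define m where "m = Max {m0, m1, m2, m3}"
  have le: "m0 \<le> m" "m1 \<le> m" "m2 \<le> m" "m3 \<le> m" by (auto simp: m_def)
  define J where "J = I m"
  have J: "submod J" by (simp add: J_def I)
  have Dx: "D x \<in> J" and Dt: "D t \<in> J" and Ds: "D s - (pt \<one> - pt s) \<in> J"
    using \<open>D x \<in> I m1\<close> \<open>D t \<in> I m2\<close> \<open>D s - (pt \<one> - pt s) \<in> I m3\<close> incseqD[OF Iinc] le
    unfolding J_def by blast+
  have Dm: "D (g \<otimes> h) - (D g + act g (D h)) \<in> J" if "g \<in> carrier G" "h \<in> carrier G" for g h
    using D(1) that incseqD[OF Iinc le(1)] unfolding derivation_mod_def J_def by blast
  interpret Km: subgroup "K m" G by (rule K)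
  have kc: "k j \<in> carrier G" for j using kC subgroup.mem_carrier[OF C] by blast
  \<comment> \<open>This is D(s) + s D(g) + sg D(s) for D(s) = 1 - s and D(g) = 0: the value that
    the product rule forces on s g s.\<close>
  define e where "e g = pt \<one> - pt s + pt (s \<otimes> g) - pt (s \<otimes> g \<otimes> s)" for g
  have Dsks: "D (s \<otimes> g \<otimes> s) - e g \<in> J" if g: "g \<in> carrier G" and Dg: "D g \<in> J" for g
  proof -
    have sg: "s \<otimes> g \<in> carrier G" using carrier g by simp
    have "D (s \<otimes> g) - (D s + act s (D g)) \<in> J" using Dm carrier g by simp
    from submod_add[OF J this submod_act[OF J carrier(3) Dg]]
    have "D (s \<otimes> g) - D s \<in> J" by (simp add: algebra_simps)
    from submod_trans[OF J this Ds] have 1: "D (s \<otimes> g) - (pt \<one> - pt s) \<in> J" .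
    have "act (s \<otimes> g) (D s) - act (s \<otimes> g) (pt \<one> - pt s) \<in> J" by (rule submod_act_cong[OF J sg Ds])
    then have 2: "act (s \<otimes> g) (D s) - (pt (s \<otimes> g) - pt (s \<otimes> g \<otimes> s)) \<in> J"
      using sg carrier by (simp add: act_diff act_pt)
    have "D (s \<otimes> g \<otimes> s) - (D (s \<otimes> g) + act (s \<otimes> g) (D s)) \<in> J" using Dm sg carrier by simp
    from submod_trans[OF J this submod_add_cong[OF J 1 2]] show ?thesis
      by (simp add: e_def algebra_simps)
  qed
  \<comment> \<open>For g in \<open>K m\<close>, stability under conjugation by s puts 1 and s g s
    into one coset, while s and s g always share one; the terms cancel in pairs.\<close>
  have e0: "e g \<in> J" if "g \<in> K m" for g
  proof -
    have gc: "g \<in> carrier G" using that by simp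
    have "inv \<one> \<otimes> (s \<otimes> g \<otimes> s) \<in> K m" using conj[OF that] carrier gc by simp
    then have 1: "pt \<one> - pt (s \<otimes> g \<otimes> s) \<in> J"
      unfolding J_def I_def using carrier gc by (intro pt_diff_coset_null K) auto
    have "inv s \<otimes> (s \<otimes> g) = g" using carrier gc by (simp flip: m_assoc)
    then have 2: "pt s - pt (s \<otimes> g) \<in> J"
      unfolding J_def I_def using carrier gc that by (intro pt_diff_coset_null K) auto
    from submod_diff[OF J 1 2] show ?thesis by (simp add: e_def algebra_simps)
  qed
  have Dk: "D (k j) \<in> J" if "\<And>i. i < j \<Longrightarrow> k i \<in> K m" for j
    using that
  proof (induction j)
    case 0 then show ?case using Dx k by simp
  next
    case (Suc j)
    let ?y = "s \<otimes> k j \<otimes> s"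
    have y: "?y \<in> carrier G" using carrier kc by simp
    have "D (k j) \<in> J" using Suc by simp
    then have "D ?y - e (k j) \<in> J" using Dsks kc by blast
    from submod_add[OF J this e0[OF Suc.prems[of j]]] have Dy: "D ?y \<in> J" by simp
    have "D (t \<otimes> ?y) - (D t + act t (D ?y)) \<in> J" using Dm carrier y by simp
    from submod_add[OF J this submod_add[OF J Dt submod_act[OF J carrier(2) Dy]]]
    have Dty: "D (t \<otimes> ?y) \<in> J" by simp
    have ty: "t \<otimes> ?y \<in> carrier G" using carrier y by blast
    have "D (t \<otimes> ?y \<otimes> t) - (D (t \<otimes> ?y) + act (t \<otimes> ?y) (D t)) \<in> J" using Dm carrier ty by blast
    from submod_add[OF J this submod_add[OF J Dty submod_act[OF J ty Dt]]]
    show ?case by (simp add: k(2))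
  qed
  define j where "j = (LEAST j. k j \<notin> K m)"
  have kj: "k j \<notin> K m" unfolding j_def using LeastI_ex[OF unbounded] .
  have "k i \<in> K m" if "i < j" for i using not_less_Least that unfolding j_def by blast
  then have Dkj: "D (k j) \<in> J" using Dk by blast
  let ?k = "k j" and ?y = "s \<otimes> k j \<otimes> s"
  have y: "?y \<in> carrier G" using carrier kc by simp
  have Dy: "D ?y - e ?k \<in> J" using Dsks kc Dkj by blast
  have "D (?y \<otimes> ?k) - (D ?y + act ?y (D ?k)) \<in> J" using Dm y kc by blast
  from submod_add[OF J this submod_act[OF J y Dkj]] have "D (?y \<otimes> ?k) - D ?y \<in> J"
    by (simp add: algebra_simps)
  from submod_trans[OF J this Dy] have 1: "D (?y \<otimes> ?k) - e ?k \<in> J" .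
  have "D (?k \<otimes> ?y) - (D ?k + act ?k (D ?y)) \<in> J" using Dm y kc by blast
  from submod_add[OF J this Dkj] have "D (?k \<otimes> ?y) - act ?k (D ?y) \<in> J" by (simp add: algebra_simps)
  from submod_trans[OF J this submod_act_cong[OF J kc Dy]] have 2: "D (?k \<otimes> ?y) - act ?k (e ?k) \<in> J" .
  have "act ?k (e ?k) - e ?k \<in> J"
    using submod_trans[OF J submod_sym[OF J 2]] 1 comm by simp
  then have "coset_sum (K m) (act ?k (e ?k) - e ?k) \<one> = 0" by (simp add: J_def I_def coset_null_def)
  moreover have fe: "fin_supp (e ?k)"
    unfolding e_def using carrier kc by (intro fin_supp_diff fin_supp_add fin_supp_pt) auto
  moreover have esum: "coset_sum (K m) (e ?k) g =
      coset_sum (K m) (pt \<one>) g - coset_sum (K m) (pt s) g + coset_sum (K m) (pt (s \<otimes> ?k)) g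
        - coset_sum (K m) (pt ?y) g" for g
    unfolding e_def using carrier kc
    by (simp add: coset_sum_diff coset_sum_add fin_supp_diff fin_supp_add fin_supp_pt)
  ultimately have eq: "coset_sum (K m) (e ?k) (inv ?k) = coset_sum (K m) (e ?k) \<one>"
    using kc by (simp add: coset_sum_diff coset_sum_act fin_supp_act)
  interpret C: subgroup "\<Union>m. K m" G by (rule C)
  have KC: "g \<in> K m \<Longrightarrow> g \<in> (\<Union>m. K m)" for g by blast
  have sk: "s \<otimes> ?k \<notin> (\<Union>m. K m)" "?k \<otimes> s \<notin> (\<Union>m. K m)" "?k \<otimes> (s \<otimes> ?k) \<notin> (\<Union>m. K m)"
  proof -
    have *: "s = (s \<otimes> ?k) \<otimes> inv ?k" "s = inv ?k \<otimes> (?k \<otimes> s)"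
      using carrier kc by (simp_all add: m_assoc) (simp_all flip: m_assoc)
    show 1: "s \<otimes> ?k \<notin> (\<Union>m. K m)" "?k \<otimes> s \<notin> (\<Union>m. K m)"
      using * s C.m_closed C.m_inv_closed[OF kC] by metis+
    have "s \<otimes> ?k = inv ?k \<otimes> (?k \<otimes> (s \<otimes> ?k))"
      using carrier kc by (simp flip: m_assoc)
    then show "?k \<otimes> (s \<otimes> ?k) \<notin> (\<Union>m. K m)"
      using 1 C.m_closed C.m_inv_closed[OF kC] by metis
  qed
  have y': "?y \<notin> K m"
  proof
    assume "?y \<in> K m"
    from conj[OF this] have "s \<otimes> (s \<otimes> ?k \<otimes> s) \<otimes> s \<in> K m" .
    moreover have "s \<otimes> (s \<otimes> ?k \<otimes> s) \<otimes> s = (s \<otimes> s) \<otimes> ?k \<otimes> (s \<otimes> s)"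
      using carrier kc by (simp add: m_assoc)
    ultimately show False using kj invol kc by simp
  qed
  \<comment> \<open>Among 1, s, sk and sks only 1 lies in \<open>K m\<close>. In the coset of the
    inverse of k, the first three are absent, and sks, if present, has coefficient -1; hence an
    upper bound suffices there.\<close>
  have "coset_sum (K m) (e ?k) \<one> = 1"
    unfolding esum coset_sum_pt using carrier kc y' sk s KC y Km.one_closed by auto
  moreover have "coset_sum (K m) (e ?k) (inv ?k) \<le> 0"
    unfolding esum coset_sum_pt using carrier kc kj sk KC by auto
  ultimately show False using eq by simp
qed

end

section \<open>Addresses and their end vertices\<close>

definition extend :: "addr \<Rightarrow> redge list \<Rightarrow> addr" (infixl "\<rhd>" 70) where
  "w \<rhd> u = (fst w, snd w @ u)"

lemma extend_Nil [simp]: "w \<rhd> [] = w"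
  and extend_extend [simp]: "w \<rhd> u \<rhd> v = w \<rhd> (u @ v)"
  and extend_cancel [simp]: "w \<rhd> u = w \<rhd> v \<longleftrightarrow> u = v"
  and fst_extend [simp]: "fst (w \<rhd> u) = fst w"
  and snd_extend [simp]: "snd (w \<rhd> u) = snd w @ u"
  by (simp_all add: extend_def)

lemma extend_eq_self [simp]: "w \<rhd> u = w \<longleftrightarrow> u = []" "w = w \<rhd> u \<longleftrightarrow> u = []"
  using extend_cancel[of w u "[]"] by (simp_all del: extend_cancel) metis

lemma extend_comparable:
  assumes "w \<rhd> u = w' \<rhd> u'"
  shows "(\<exists>v. w' = w \<rhd> v) \<or> (\<exists>v. w = w' \<rhd> v)"
  using assms by (cases w; cases w') (auto simp: extend_def append_eq_append_conv2)

definition ends :: "addr \<Rightarrow> vtx set" where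
  "ends w = {origin w, terminus w}"

lemma origin_snoc [simp]:
  "origin (w \<rhd> (u @ [r])) = (case r of R1 \<Rightarrow> origin (w \<rhd> u) | _ \<Rightarrow> Mid (w \<rhd> u))"
  by (simp add: origin_def extend_def split: redge.split)

lemma terminus_snoc [simp]:
  "terminus (w \<rhd> (u @ [r])) = (case r of R3 \<Rightarrow> terminus (w \<rhd> u) | _ \<Rightarrow> Mid (w \<rhd> u))"
  by (simp add: terminus_def extend_def split: redge.split)

lemma origin_single [simp]: "origin (w \<rhd> [r]) = (case r of R1 \<Rightarrow> origin w | _ \<Rightarrow> Mid w)"
  using origin_snoc[of w "[]" r] by (cases r) simp_all

lemma terminus_single [simp]: "terminus (w \<rhd> [r]) = (case r of R3 \<Rightarrow> terminus w | _ \<Rightarrow> Mid w)"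
  using terminus_snoc[of w "[]" r] by (cases r) simp_all

lemma origin_base [simp]: "origin (b, []) = base_orig b"
  and terminus_base [simp]: "terminus (b, []) = base_term b"
  by (simp_all add: origin_def terminus_def)

lemma Mid_in_ends_single: "Mid w \<in> ends (w \<rhd> [r])"
  by (cases r) (simp_all add: ends_def)

lemma ends_single_subset: "ends (w \<rhd> [r]) \<subseteq> insert (Mid w) (ends w)"
  by (cases r) (auto simp: ends_def)

lemma ends_ne [simp]: "ends w \<noteq> {}" "finite (ends w)"
  by (simp_all add: ends_def)

lemma ends_extendD:
  "v \<in> ends (w \<rhd> u) \<Longrightarrow> v \<in> ends w \<or> (\<exists>u' u''. u'' \<noteq> [] \<and> u = u' @ u'' \<and> v = Mid (w \<rhd> u'))"
proof (induction u rule: rev_induct)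
  case (snoc r u)
  show ?case
  proof (cases "v = Mid (w \<rhd> u)")
    case False
    then have "v \<in> ends (w \<rhd> u)"
      using snoc.prems ends_single_subset[of "w \<rhd> u" r] by auto
    from snoc.IH[OF this] show ?thesis by force
  qed force
qed simp

text \<open>No base edge has a midpoint as an end, and lengthening an address only creates midpoints
  of its proper prefixes. Thus a vertex born inside z meets only edges strictly inside z.\<close>

lemma Mid_in_endsD:
  assumes "Mid z \<in> ends y"
  shows "\<exists>u. u \<noteq> [] \<and> y = z \<rhd> u"
proof -
  obtain b u where y: "y = (b, [] :: redge list) \<rhd> u" by (cases y) (auto simp: extend_def)
  have "Mid z \<notin> ends (b, [])" by (cases b) (auto simp: ends_def)
  then obtain u' u'' where "u'' \<noteq> []" "u = u' @ u''" "Mid z = Mid ((b, []) \<rhd> u')"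
    using ends_extendD[of "Mid z" "(b, [])" u] assms y by blast
  then show ?thesis using y by auto
qed

lemma Mid_in_ends_length: "Mid z \<in> ends y \<Longrightarrow> length (snd z) < length (snd y)"
  using Mid_in_endsD by fastforce

section \<open>Sequences\<close>

lemma length_snd_trunc [simp]: "length (snd (trunc s n)) = n"
  by (simp add: trunc_def)

lemma fst_trunc [simp]: "fst (trunc s n) = fst s"
  by (simp add: trunc_def)

lemma trunc_0: "trunc s 0 = (fst s, [])"
  by (simp add: trunc_def)

lemma trunc_add: "trunc s (m + n) = trunc s m \<rhd> map (snd s) [m..<m + n]"
  using upt_add_eq_append[of 0 m n] by (simp add: trunc_def extend_def)

lemma trunc_Suc: "trunc s (Suc n) = trunc s n \<rhd> [snd s n]"
  by (simp add: trunc_def extend_def)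

lemma trunc_le: "m \<le> n \<Longrightarrow> \<exists>u. trunc s n = trunc s m \<rhd> u"
  using trunc_add[of s m "n - m"] by auto

lemma trunc_eq_mono: "trunc s n = trunc t n \<Longrightarrow> m \<le> n \<Longrightarrow> trunc s m = trunc t m"
proof -
  assume "trunc s n = trunc t n" "m \<le> n"
  moreover obtain u v where "trunc s n = trunc s m \<rhd> u" "trunc t n = trunc t m \<rhd> v"
    using trunc_le \<open>m \<le> n\<close> by metis
  moreover have "length (snd (trunc s m)) = length (snd (trunc t m))" by simp
  ultimately show ?thesis unfolding extend_def by (metis append_eq_append_conv prod.collapse prod.inject)
qed

lemma seq_eqI: "(\<And>n. trunc s n = trunc t n) \<Longrightarrow> s = t"
proof -
  assume *: "\<And>n. trunc s n = trunc t n"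
  have "fst s = fst t" using arg_cong[OF *[of 0], of fst] by simp
  moreover have "snd s n = snd t n" for n
    using *[of "Suc n"] *[of n] by (simp add: trunc_Suc)
  ultimately show ?thesis by (intro prod_eqI) auto
qed

definition lcat :: "redge list \<Rightarrow> (nat \<Rightarrow> redge) \<Rightarrow> nat \<Rightarrow> redge" where
  "lcat u \<zeta> = (\<lambda>i. if i < length u then u ! i else \<zeta> (i - length u))"

lemma lcat_Nil [simp]: "lcat [] \<zeta> = \<zeta>" by (simp add: lcat_def)

lemma lcat_append: "lcat (u @ v) \<zeta> = lcat u (lcat v \<zeta>)"
  by (auto simp: lcat_def nth_append fun_eq_iff)

lemma cat_seq_lcat: "cat_seq w \<zeta> = (fst w, lcat (snd w) \<zeta>)"
  by (simp add: cat_seq_def lcat_def)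

lemma cat_seq_extend: "cat_seq (w \<rhd> u) \<zeta> = cat_seq w (lcat u \<zeta>)"
  by (simp add: cat_seq_lcat lcat_append)

lemma trunc_cat_seq: "trunc (cat_seq w \<zeta>) (length (snd w) + n) = w \<rhd> map \<zeta> [0..<n]"
proof -
  have "map (lcat u \<zeta>) [0..<length u + n] = u @ map \<zeta> [0..<n]" for u
    by (rule nth_equalityI) (auto simp: lcat_def nth_append)
  then show ?thesis by (simp add: trunc_def cat_seq_lcat extend_def)
qed

lemma trunc_cat_seq_self [simp]: "trunc (cat_seq w \<zeta>) (length (snd w)) = w"
  using trunc_cat_seq[of w \<zeta> 0] by simp

lemma cat_seq_trunc: "cat_seq (trunc s n) (\<lambda>i. snd s (n + i)) = s"
  by (cases s) (auto simp: cat_seq_lcat trunc_def lcat_def fun_eq_iff)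

lemma cat_seq_inj: "cat_seq w \<zeta> = cat_seq w \<zeta>' \<longleftrightarrow> \<zeta> = \<zeta>'"
proof
  assume "cat_seq w \<zeta> = cat_seq w \<zeta>'"
  then have "lcat (snd w) \<zeta> (length (snd w) + i) = lcat (snd w) \<zeta>' (length (snd w) + i)" for i
    by (simp add: cat_seq_lcat)
  then show "\<zeta> = \<zeta>'" by (auto simp: lcat_def fun_eq_iff)
qed simp

lemma cat_seq_eq_comparable:
  assumes "cat_seq w \<zeta> = cat_seq w' \<zeta>'"
  shows "(\<exists>v. w' = w \<rhd> v) \<or> (\<exists>v. w = w' \<rhd> v)"
  using trunc_le[of "length (snd w)" "length (snd w')" "cat_seq w \<zeta>"]
    trunc_le[of "length (snd w')" "length (snd w)" "cat_seq w \<zeta>"] trunc_cat_seq_self assms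
  by (metis nle_le)

text \<open>The class of \<open>s\<close> is the cut point coming from the vertex \<open>v\<close>.\<close>
definition vertex_at :: "bseq \<Rightarrow> vtx \<Rightarrow> bool" where
  "vertex_at s v \<longleftrightarrow> (\<exists>N. \<forall>n\<ge>N. v \<in> ends (trunc s n))"

lemma vertex_at_cat_seq: "vertex_at (cat_seq w \<zeta>) v \<longleftrightarrow> (\<exists>N. \<forall>n\<ge>N. v \<in> ends (w \<rhd> map \<zeta> [0..<n]))"
proof -
  let ?l = "length (snd w)"
  have "(\<exists>N. \<forall>n\<ge>N. v \<in> ends (trunc (cat_seq w \<zeta>) n)) \<longleftrightarrow>
      (\<exists>N. \<forall>n\<ge>N. v \<in> ends (trunc (cat_seq w \<zeta>) (?l + n)))"
  proof
    assume "\<exists>N. \<forall>n\<ge>N. v \<in> ends (trunc (cat_seq w \<zeta>) (?l + n))"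
    then obtain N where N: "\<And>n. n \<ge> N \<Longrightarrow> v \<in> ends (trunc (cat_seq w \<zeta>) (?l + n))" by blast
    have "v \<in> ends (trunc (cat_seq w \<zeta>) n)" if "n \<ge> ?l + N" for n
      using N[of "n - ?l"] that by simp
    then show "\<exists>N. \<forall>n\<ge>N. v \<in> ends (trunc (cat_seq w \<zeta>) n)" by blast
  qed (meson trans_le_add2)
  then show ?thesis by (simp add: vertex_at_def trunc_cat_seq)
qed

text \<open>Two distinct persistent vertices would exhaust the ends of all late truncations. But
  every truncation has the midpoint of the previous one as an end, and these midpoints are pairwise
  distinct, so three of them cannot fit into two places.\<close>

lemma vertex_at_unique:
  assumes "vertex_at s v" "vertex_at s v'"
  shows "v = v'"
proof (rule ccontr)
  assume "v \<noteq> v'"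
  obtain N where N: "\<And>n. n \<ge> N \<Longrightarrow> v \<in> ends (trunc s n) \<and> v' \<in> ends (trunc s n)"
    using assms unfolding vertex_at_def by (meson nle_le order_trans)
  have M: "Mid (trunc s n) \<in> {v, v'}" if "n \<ge> N" for n
  proof -
    have "Mid (trunc s n) \<in> ends (trunc s (Suc n))" by (simp add: trunc_Suc Mid_in_ends_single)
    then show ?thesis using N[of "Suc n"] that \<open>v \<noteq> v'\<close> by (auto simp: ends_def)
  qed
  have "Mid (trunc s m) \<noteq> Mid (trunc s n)" if "m \<noteq> n" for m n
    using that by (metis length_snd_trunc vtx.inject)
  then show False using M[of N] M[of "N + 1"] M[of "N + 2"]
    by (metis add_left_imp_eq insert_iff le_add1 nat.distinct(1) one_eq_numeral_iff order_refl
        semiring_norm(85) singletonD add_cancel_left_right zero_neq_one zero_neq_numeral)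
qed

text \<open>Once two truncations differ, a new midpoint of one address cannot be an end of the
  other, so the sets of common ends decrease. Being finite and nonempty, they have a common element.
  This form makes transitivity of \<open>seq_rel\<close> evident through uniqueness of the
  vertex.\<close>

lemma seq_rel_iff: "(s, t) \<in> seq_rel \<longleftrightarrow> s = t \<or> (\<exists>v. vertex_at s v \<and> vertex_at t v)"
proof -
  define S where "S n = ends (trunc s n) \<inter> ends (trunc t n)" for n
  have S: "(s, t) \<in> seq_rel \<longleftrightarrow> (\<forall>n. S n \<noteq> {})" by (simp add: seq_rel_def S_def ends_def)
  have step: "S (Suc n) \<subseteq> S n" if "trunc s n \<noteq> trunc t n" for n
  proof
    fix v assume v: "v \<in> S (Suc n)"
    then have 1: "v = Mid (trunc s n) \<or> v \<in> ends (trunc s n)"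
      and 2: "v = Mid (trunc t n) \<or> v \<in> ends (trunc t n)"
      using ends_single_subset[of "trunc s n" "snd s n"] ends_single_subset[of "trunc t n" "snd t n"]
      by (auto simp: S_def trunc_Suc)
    have "Mid (trunc s n) \<notin> ends (trunc t n)" "Mid (trunc t n) \<notin> ends (trunc s n)"
      using Mid_in_ends_length by fastforce+
    then show "v \<in> S n" using 1 2 that by (auto simp: S_def)
  qed
  have antimono: "S n \<subseteq> S m" if "N \<le> m" "m \<le> n" "trunc s N \<noteq> trunc t N" for N m n
    using that(2)
  proof (induction n rule: dec_induct)
    case (step k)
    then have "trunc s k \<noteq> trunc t k" using trunc_eq_mono that(1,3) by (meson order_trans)
    then show ?case using \<open>S k \<subseteq> S m\<close> \<open>trunc s k \<noteq> trunc t k \<Longrightarrow> S (Suc k) \<subseteq> S k\<close>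
        \<open>\<And>n. trunc s n \<noteq> trunc t n \<Longrightarrow> S (Suc n) \<subseteq> S n\<close> by blast
  qed simp
  show ?thesis
  proof
    assume rel: "(s, t) \<in> seq_rel"
    show "s = t \<or> (\<exists>v. vertex_at s v \<and> vertex_at t v)"
    proof (cases "s = t")
      case False
      then obtain N where N: "trunc s N \<noteq> trunc t N" using seq_eqI by blast
      have "\<exists>v\<in>S N. \<forall>n\<ge>N. v \<in> S n"
      proof (rule ccontr)
        assume "\<not> ?thesis"
        then obtain k where k: "\<And>v. v \<in> S N \<Longrightarrow> k v \<ge> N \<and> v \<notin> S (k v)" by metis
        have fin: "finite (S N)" by (simp add: S_def)
        define K where "K = Max (insert N (k ` S N))"
        have K: "K \<ge> N" "\<And>v. v \<in> S N \<Longrightarrow> K \<ge> k v" using fin by (auto simp: K_def)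
        obtain v where v: "v \<in> S K" using rel S by blast
        then have "v \<in> S N" using antimono[OF order_refl K(1) N] by blast
        then show False using k K(2) v antimono[of N "k v" K] N by blast
      qed
      then show ?thesis by (auto simp: S_def vertex_at_def)
    qed simp
  next
    assume "s = t \<or> (\<exists>v. vertex_at s v \<and> vertex_at t v)"
    then show "(s, t) \<in> seq_rel"
    proof
      assume "\<exists>v. vertex_at s v \<and> vertex_at t v"
      then obtain v M M' where "\<forall>n\<ge>M. v \<in> ends (trunc s n)" "\<forall>n\<ge>M'. v \<in> ends (trunc t n)"
        by (auto simp: vertex_at_def)
      then have large: "S n \<noteq> {}" if "n \<ge> max M M'" for n using that by (auto simp: S_def)
      have "S n \<noteq> {}" for n
      proof (cases "trunc s n = trunc t n")
        case False
        then show ?thesis using antimono[of n n "max n (max M M')"] large[of "max n (max M M')"]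
          by fastforce
      qed (simp add: S_def)
      then show ?thesis using S by blast
    qed (simp add: seq_rel_def)
  qed
qed

lemma equiv_seq_rel: "equiv UNIV seq_rel"
proof (rule equivI)
  show "refl_on UNIV seq_rel" by (simp add: refl_on_def seq_rel_iff)
  show "sym seq_rel" by (auto simp: sym_def seq_rel_iff)
  show "trans seq_rel" unfolding trans_def seq_rel_iff using vertex_at_unique by blast
qed simp

lemma proj_eq_iff: "proj s = proj t \<longleftrightarrow> (s, t) \<in> seq_rel"
  unfolding proj_def using eq_equiv_class_iff[OF equiv_seq_rel] by simp

lemma Xlim_eq: "Xlim = range proj"
  by (auto simp: Xlim_def proj_def quotient_def)

section \<open>Expansions\<close>

definition expand :: "addr set \<Rightarrow> addr \<Rightarrow> addr set" where
  "expand E w = (E - {w}) \<union> {w \<rhd> [R1], w \<rhd> [R2], w \<rhd> [R3]}"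

lemma in_expand_iff: "z \<in> expand E w \<longleftrightarrow> z \<in> E \<and> z \<noteq> w \<or> (\<exists>r. z = w \<rhd> [r])"
proof -
  have "(\<exists>r. z = w \<rhd> [r]) \<longleftrightarrow> z = w \<rhd> [R1] \<or> z = w \<rhd> [R2] \<or> z = w \<rhd> [R3]"
    by (metis redge.exhaust)
  then show ?thesis by (auto simp: expand_def)
qed

abbreviation base_edges :: "addr set" where
  "base_edges \<equiv> {(b, []) | b. True}"

lemma base_in_expansions: "base_edges \<in> expansions"
  by (rule expansions.base)

lemma expand_in_expansions: "E \<in> expansions \<Longrightarrow> w \<in> E \<Longrightarrow> expand E w \<in> expansions"
  using expansions.step[of E w] by (simp add: expand_def extend_def)

lemma expansions_induct [consumes 1, case_names base expand]:
  assumes "E \<in> expansions" "P base_edges"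
    "\<And>E w. E \<in> expansions \<Longrightarrow> P E \<Longrightarrow> w \<in> E \<Longrightarrow> P (expand E w)"
  shows "P E"
  using assms(1)
proof (induction rule: expansions.induct)
  case (step E w)
  then show ?case using assms(3)[of E w] by (simp add: expand_def extend_def)
qed (rule assms(2))

lemma base_edges_eq: "base_edges = {(Ea, []), (Eb, []), (Ec, []), (Ed, [])}"
  using bedge.exhaust by auto

lemma finite_expansion: "E \<in> expansions \<Longrightarrow> finite E"
  by (induction rule: expansions_induct) (simp_all only: base_edges_eq, simp_all add: expand_def)

lemma expansion_antichain:
  "E \<in> expansions \<Longrightarrow> e \<in> E \<Longrightarrow> e \<rhd> u \<in> E \<Longrightarrow> u = []"
proof (induction arbitrary: e u rule: expansions_induct)
  case base
  then show ?case by (auto simp: extend_def)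
next
  case (expand E w)
  have w: "w \<in> E" by fact
  consider "e \<in> E" "e \<noteq> w" | r where "e = w \<rhd> [r]" using expand.prems by (auto simp: in_expand_iff)
  then show ?case
  proof cases
    case 1
    show ?thesis
    proof (cases "e \<rhd> u \<in> E")
      case True then show ?thesis using expand.IH 1 by blast
    next
      case False
      then obtain r where r: "e \<rhd> u = w \<rhd> [r]" using expand.prems by (auto simp: in_expand_iff)
      then show ?thesis
        using extend_comparable[OF r] expand.IH[OF 1(1), of] expand.IH[OF w] 1 w by fastforce
    qed
  next
    case 2
    then have eu: "e \<rhd> u = w \<rhd> (r # u)" by simp
    then have "e \<rhd> u \<notin> E" using expand.IH[OF w] by fastforce
    then show ?thesis using expand.prems eu by (auto simp: in_expand_iff)
  qed
qed

lemma expansion_comparable: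
  assumes "E \<in> expansions" "e \<in> E" "e' \<in> E" "e \<rhd> u = e' \<rhd> u'"
  shows "e = e' \<and> u = u'"
proof -
  have "e = e'"
    using extend_comparable[OF assms(4)] expansion_antichain[OF assms(1)] assms(2,3) by fastforce
  then show ?thesis using assms(4) by simp
qed

lemma expansion_cat_seq_unique:
  assumes "E \<in> expansions" "e \<in> E" "e' \<in> E" "cat_seq e \<zeta> = cat_seq e' \<zeta>'"
  shows "e = e' \<and> \<zeta> = \<zeta>'"
proof -
  have "e = e'"
    using cat_seq_eq_comparable[OF assms(4)] expansion_antichain[OF assms(1)] assms(2,3) by fastforce
  then show ?thesis using assms(4) by (simp add: cat_seq_inj)
qed

lemma expansion_trunc: "E \<in> expansions \<Longrightarrow> \<exists>n. trunc s n \<in> E"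
proof (induction rule: expansions_induct)
  case base show ?case by (rule exI[of _ 0]) (simp add: trunc_0)
next
  case (expand E w)
  then obtain n where "trunc s n \<in> E" by blast
  then show ?case
    by (cases "trunc s n = w") (auto simp: in_expand_iff trunc_Suc intro: exI[of _ "Suc n"])
qed

lemma expansion_cover:
  assumes "E \<in> expansions"
  obtains e \<zeta> where "e \<in> E" "s = cat_seq e \<zeta>"
  using expansion_trunc[OF assms, of s] cat_seq_trunc[of s] by metis

lemma vertices_eq: "vertices E = \<Union> (ends ` E)"
  by (auto simp: vertices_def ends_def)

lemma Mid_notin_vertices:
  assumes "E \<in> expansions" "e \<in> E"
  shows "Mid (e \<rhd> u) \<notin> vertices E"
proof
  assume "Mid (e \<rhd> u) \<in> vertices E"
  then obtain e' where e': "e' \<in> E" "Mid (e \<rhd> u) \<in> ends e'" by (auto simp: vertices_eq)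
  obtain u' where "u' \<noteq> []" "e' = e \<rhd> u \<rhd> u'" using Mid_in_endsD[OF e'(2)] by blast
  then show False using expansion_antichain[OF assms, of "u @ u'"] e' by simp
qed

lemma vertices_expand:
  assumes "w \<in> E"
  shows "vertices (expand E w) = insert (Mid w) (vertices E)"
proof -
  have "vertices (expand E w) = \<Union> (ends ` (E - {w})) \<union> insert (Mid w) (ends w)"
    by (auto simp: vertices_eq expand_def ends_def)
  also have "\<dots> = insert (Mid w) (vertices E)" using assms by (auto simp: vertices_eq)
  finally show ?thesis .
qed

inductive expansion_step :: "addr set \<Rightarrow> addr set \<Rightarrow> bool" where
  "E \<in> expansions \<Longrightarrow> w \<in> E \<Longrightarrow> expansion_step E (expand E w)"

lemma expand_commute:
  assumes "E \<in> expansions" "w \<in> E" "w' \<in> E" "w \<noteq> w'"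
  shows "expand (expand E w) w' = expand (expand E w') w" "w' \<in> expand E w"
proof -
  have ne: "w \<rhd> [r] \<noteq> w'" "w' \<rhd> [r] \<noteq> w" for r
    using expansion_antichain[OF assms(1), of w "[r]"] expansion_antichain[OF assms(1), of w' "[r]"]
      assms(2,3) by auto
  show "expand (expand E w) w' = expand (expand E w') w" "w' \<in> expand E w"
    using assms(2-4) by (auto simp: expand_def ne ne[symmetric])
qed

text \<open>Expansions of two different edges commute, since neither edge lies inside the other.
  Confluence from the base graph then supplies common refinements without describing them
  explicitly.\<close>

lemma confluent_expansion_step: "confluentp expansion_step"
proof (rule strong_confluentp_imp_confluentp, rule strong_confluentpI)
  fix E E1 E2 assume "expansion_step E E1" "expansion_step E E2"
  then obtain w w' where E: "E \<in> expansions" "w \<in> E" "w' \<in> E" "E1 = expand E w" "E2 = expand E w'"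
    by (auto elim!: expansion_step.cases)
  show "\<exists>E'. expansion_step\<^sup>*\<^sup>* E1 E' \<and> expansion_step\<^sup>=\<^sup>= E2 E'"
  proof (cases "w = w'")
    case False
    have "w' \<in> E1" "w \<in> E2" "E1 \<in> expansions" "E2 \<in> expansions"
      using E False expand_commute(2)[of E w w'] expand_commute(2)[of E w' w] expand_in_expansions
      by simp_all
    then have "expansion_step E1 (expand E1 w')" "expansion_step E2 (expand E2 w)"
      by (simp_all add: expansion_step.intros)
    then show ?thesis using expand_commute(1)[OF E(1-3) False] E(4,5) by auto
  qed (use E in auto)
qed

lemma expansion_steps_base: "E \<in> expansions \<Longrightarrow> expansion_step\<^sup>*\<^sup>* base_edges E"
  by (induction rule: expansions_induct) (auto intro: expansion_step.intros rtranclp.rtrancl_into_rtrancl)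

lemma common_expansion:
  assumes "E1 \<in> expansions" "E2 \<in> expansions"
  obtains E where "expansion_step\<^sup>*\<^sup>* E1 E" "expansion_step\<^sup>*\<^sup>* E2 E"
  using confluentpD[OF confluent_expansion_step expansion_steps_base[OF assms(1)]
      expansion_steps_base[OF assms(2)]] by blast

section \<open>Graph isomorphisms between expansions\<close>

lemma graph_iso_bij: "graph_iso E1 E2 \<phi> \<Longrightarrow> bij_betw \<phi> E1 E2"
  by (simp add: graph_iso_def)

lemma graph_iso_in: "graph_iso E1 E2 \<phi> \<Longrightarrow> e \<in> E1 \<Longrightarrow> \<phi> e \<in> E2"
  using graph_iso_bij bij_betwE by blast

lemma graph_isoE:
  assumes "graph_iso E1 E2 \<phi>"
  obtains \<psi> where "bij_betw \<psi> (vertices E1) (vertices E2)"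
    "\<And>e. e \<in> E1 \<Longrightarrow> origin (\<phi> e) = \<psi> (origin e)" "\<And>e. e \<in> E1 \<Longrightarrow> terminus (\<phi> e) = \<psi> (terminus e)"
  using assms unfolding graph_iso_def by blast

lemma graph_iso_compose:
  assumes "graph_iso E1 E2 \<phi>" "graph_iso E2 E3 \<eta>"
  shows "graph_iso E1 E3 (\<eta> \<circ> \<phi>)"
proof -
  obtain \<psi> where \<psi>: "bij_betw \<psi> (vertices E1) (vertices E2)"
    "\<And>e. e \<in> E1 \<Longrightarrow> origin (\<phi> e) = \<psi> (origin e)" "\<And>e. e \<in> E1 \<Longrightarrow> terminus (\<phi> e) = \<psi> (terminus e)"
    by (rule graph_isoE[OF assms(1)]) (rule that; assumption)
  obtain \<psi>' where \<psi>': "bij_betw \<psi>' (vertices E2) (vertices E3)"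
    "\<And>e. e \<in> E2 \<Longrightarrow> origin (\<eta> e) = \<psi>' (origin e)" "\<And>e. e \<in> E2 \<Longrightarrow> terminus (\<eta> e) = \<psi>' (terminus e)"
    by (rule graph_isoE[OF assms(2)]) (rule that; assumption)
  have "bij_betw (\<eta> \<circ> \<phi>) E1 E3" using graph_iso_bij assms bij_betw_trans by blast
  moreover have "bij_betw (\<psi>' \<circ> \<psi>) (vertices E1) (vertices E3)" using \<psi> \<psi>' bij_betw_trans by blast
  ultimately show ?thesis
    unfolding graph_iso_def using \<psi> \<psi>' graph_iso_in[OF assms(1)] by (intro conjI exI[of _ "\<psi>' \<circ> \<psi>"]) auto
qed

lemma graph_iso_inverse:
  assumes "graph_iso E1 E2 \<phi>"
  shows "graph_iso E2 E1 (inv_into E1 \<phi>)"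
proof -
  obtain \<psi> where \<psi>: "bij_betw \<psi> (vertices E1) (vertices E2)"
    "\<And>e. e \<in> E1 \<Longrightarrow> origin (\<phi> e) = \<psi> (origin e)" "\<And>e. e \<in> E1 \<Longrightarrow> terminus (\<phi> e) = \<psi> (terminus e)"
    by (rule graph_isoE[OF assms]) (rule that; assumption)
  have bij: "bij_betw \<phi> E1 E2" using graph_iso_bij assms .
  let ?\<psi>' = "inv_into (vertices E1) \<psi>"
  have "origin (inv_into E1 \<phi> e) = ?\<psi>' (origin e) \<and> terminus (inv_into E1 \<phi> e) = ?\<psi>' (terminus e)"
    if e: "e \<in> E2" for e
  proof -
    obtain e' where e': "e' \<in> E1" "e = \<phi> e'" using e bij by (metis bij_betw_def imageE)
    then have "inv_into E1 \<phi> e = e'" using bij by (simp add: bij_betw_inv_into_left)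
    moreover have "origin e' \<in> vertices E1" "terminus e' \<in> vertices E1"
      using e' by (auto simp: vertices_def)
    ultimately show ?thesis using \<psi> e' by (simp add: bij_betw_inv_into_left)
  qed
  then show ?thesis
    unfolding graph_iso_def using bij_betw_inv_into[OF bij] bij_betw_inv_into[OF \<psi>(1)] by blast
qed

lemma graph_iso_expand:
  assumes E: "E1 \<in> expansions" "E2 \<in> expansions" and iso: "graph_iso E1 E2 \<phi>" and e: "e \<in> E1"
  obtains \<phi>' where "graph_iso (expand E1 e) (expand E2 (\<phi> e)) \<phi>'"
    "\<And>r. \<phi>' (e \<rhd> [r]) = \<phi> e \<rhd> [r]" "\<And>z. z \<in> E1 \<Longrightarrow> z \<noteq> e \<Longrightarrow> \<phi>' z = \<phi> z"
proof -
  obtain \<psi> where \<psi>: "bij_betw \<psi> (vertices E1) (vertices E2)"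
    "\<And>e. e \<in> E1 \<Longrightarrow> origin (\<phi> e) = \<psi> (origin e)" "\<And>e. e \<in> E1 \<Longrightarrow> terminus (\<phi> e) = \<psi> (terminus e)"
    by (rule graph_isoE[OF iso]) (rule that; assumption)
  have bij: "bij_betw \<phi> E1 E2" using graph_iso_bij iso .
  have \<phi>e: "\<phi> e \<in> E2" using bij e bij_betwE by blast
  \<comment> \<open>The children of \<open>e\<close> are not in \<open>E1\<close>, so they fall
    under the second case, where the last letter tells which child is meant.\<close>
  define \<phi>' where "\<phi>' z = (if z \<in> E1 \<and> z \<noteq> e then \<phi> z else \<phi> e \<rhd> [last (snd z)])" for z
  have ne: "e \<rhd> [r] \<notin> E1" "\<phi> e \<rhd> [r] \<notin> E2" for r
    using expansion_antichain[OF E(1) e] expansion_antichain[OF E(2) \<phi>e] by auto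
  have ch: "\<phi>' (e \<rhd> [r]) = \<phi> e \<rhd> [r]" for r by (simp add: \<phi>'_def ne)
  have old: "\<phi>' z = \<phi> z" if "z \<in> E1" "z \<noteq> e" for z using that by (simp add: \<phi>'_def)
  let ?K = "\<lambda>w. range (\<lambda>r. w \<rhd> [r])"
  have "bij_betw \<phi> (E1 - {e}) (E2 - {\<phi> e})"
    using bij e by (auto simp: bij_betw_def inj_on_def)
  then have "bij_betw \<phi>' (E1 - {e}) (E2 - {\<phi> e})"
    by (subst bij_betw_cong[of _ _ \<phi>]) (auto simp: old)
  moreover have "bij_betw \<phi>' (?K e) (?K (\<phi> e))"
    unfolding bij_betw_def 
    by (intro conjI inj_onI) (elim rangeE, simp add: ch, simp add: image_image ch)
  moreover have "(E2 - {\<phi> e}) \<inter> ?K (\<phi> e) = {}" using ne(2) by auto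
  ultimately have "bij_betw \<phi>' ((E1 - {e}) \<union> ?K e) ((E2 - {\<phi> e}) \<union> ?K (\<phi> e))"
    by (rule bij_betw_combine)
  moreover have "expand E w = (E - {w}) \<union> ?K w" for E w by (auto simp: in_expand_iff)
  ultimately have bij': "bij_betw \<phi>' (expand E1 e) (expand E2 (\<phi> e))" by simp
  define \<psi>' where "\<psi>' = \<psi>(Mid e := Mid (\<phi> e))"
  have M: "Mid e \<notin> vertices E1" "Mid (\<phi> e) \<notin> vertices E2"
    using Mid_notin_vertices[OF E(1) e, of "[]"] Mid_notin_vertices[OF E(2) \<phi>e, of "[]"] by simp_all
  have "bij_betw \<psi>' (vertices E1) (vertices E2)"
    using \<psi>(1) M by (subst bij_betw_cong[of _ _ \<psi>]) (auto simp: \<psi>'_def)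
  then have "bij_betw \<psi>' (insert (Mid e) (vertices E1)) (insert (Mid (\<phi> e)) (vertices E2))"
    using notIn_Un_bij_betw[of "Mid e" "vertices E1" \<psi>' "vertices E2"] M by (simp add: \<psi>'_def)
  then have "bij_betw \<psi>' (vertices (expand E1 e)) (vertices (expand E2 (\<phi> e)))"
    using vertices_expand e \<phi>e by simp
  moreover have "origin (\<phi>' z) = \<psi>' (origin z) \<and> terminus (\<phi>' z) = \<psi>' (terminus z)"
    if z: "z \<in> expand E1 e" for z
  proof -
    have on: "origin x \<noteq> Mid e" "terminus x \<noteq> Mid e" if "x \<in> E1" for x
      using that M(1) unfolding vertices_def by (metis UnCI imageI)+
    consider "z \<in> E1" "z \<noteq> e" | r where "z = e \<rhd> [r]" using z by (auto simp: in_expand_iff)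
    then show ?thesis
      by cases (auto simp: ch old \<psi> \<psi>'_def on e split: redge.split)
  qed
  ultimately have "graph_iso (expand E1 e) (expand E2 (\<phi> e)) \<phi>'"
    unfolding graph_iso_def using bij' by blast
  then show thesis using that ch old by blast
qed

section \<open>Maps of the limit space given by graph isomorphisms\<close>

text \<open>Replacement of the prefix e by its image. When E is an expansion, exactly one of its
  edges is a prefix of s, so the choice is determined.\<close>

definition seq_map :: "addr set \<Rightarrow> (addr \<Rightarrow> addr) \<Rightarrow> bseq \<Rightarrow> bseq" where
  "seq_map E \<phi> s = (SOME t. \<exists>e\<in>E. \<exists>\<zeta>. s = cat_seq e \<zeta> \<and> t = cat_seq (\<phi> e) \<zeta>)"

lemma seq_map_cat_seq:
  assumes "E \<in> expansions" "e \<in> E"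
  shows "seq_map E \<phi> (cat_seq e \<zeta>) = cat_seq (\<phi> e) \<zeta>"
  unfolding seq_map_def
proof (rule some_equality)
  show "\<exists>e'\<in>E. \<exists>\<zeta>'. cat_seq e \<zeta> = cat_seq e' \<zeta>' \<and> cat_seq (\<phi> e) \<zeta> = cat_seq (\<phi> e') \<zeta>'"
    using assms by blast
next
  fix t assume "\<exists>e'\<in>E. \<exists>\<zeta>'. cat_seq e \<zeta> = cat_seq e' \<zeta>' \<and> t = cat_seq (\<phi> e') \<zeta>'"
  then show "t = cat_seq (\<phi> e) \<zeta>" using expansion_cat_seq_unique[OF assms] by blast
qed

lemma seq_map_inverse:
  assumes "E1 \<in> expansions" "E2 \<in> expansions" "graph_iso E1 E2 \<phi>"
  shows "seq_map E2 (inv_into E1 \<phi>) (seq_map E1 \<phi> s) = s"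
proof -
  obtain e \<zeta> where e: "e \<in> E1" "s = cat_seq e \<zeta>" using expansion_cover[OF assms(1)] .
  then have "inv_into E1 \<phi> (\<phi> e) = e" "\<phi> e \<in> E2"
    using graph_iso_bij[OF assms(3)] graph_iso_in[OF assms(3)] by (simp_all add: bij_betw_inv_into_left)
  then show ?thesis using e assms by (simp add: seq_map_cat_seq)
qed

lemma seq_map_inverse':
  assumes "E1 \<in> expansions" "E2 \<in> expansions" "graph_iso E1 E2 \<phi>"
  shows "seq_map E1 \<phi> (seq_map E2 (inv_into E1 \<phi>) s) = s"
proof -
  obtain e \<zeta> where e: "e \<in> E2" "s = cat_seq e \<zeta>" using expansion_cover[OF assms(2)] .
  then have "\<phi> (inv_into E1 \<phi> e) = e" "inv_into E1 \<phi> e \<in> E1"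
    using graph_iso_bij[OF assms(3)] graph_iso_in[OF graph_iso_inverse[OF assms(3)]]
    by (simp_all add: bij_betw_inv_into_right)
  then show ?thesis using e assms by (simp add: seq_map_cat_seq)
qed

text \<open>An end of an edge inside e is either an old vertex, moved by the vertex map, or a
  midpoint born inside e, moved by prefix replacement. Induction on the last letter treats both ends
  at once.\<close>

lemma ends_transport:
  assumes \<psi>: "\<And>e. e \<in> E \<Longrightarrow> origin (\<phi> e) = \<psi> (origin e)" "\<And>e. e \<in> E \<Longrightarrow> terminus (\<phi> e) = \<psi> (terminus e)"
    and e: "e \<in> E"
  shows "(origin (e \<rhd> u) \<in> vertices E \<and> origin (\<phi> e \<rhd> u) = \<psi> (origin (e \<rhd> u)) \<or>
      (\<exists>u'. origin (e \<rhd> u) = Mid (e \<rhd> u') \<and> origin (\<phi> e \<rhd> u) = Mid (\<phi> e \<rhd> u'))) \<and>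
    (terminus (e \<rhd> u) \<in> vertices E \<and> terminus (\<phi> e \<rhd> u) = \<psi> (terminus (e \<rhd> u)) \<or>
      (\<exists>u'. terminus (e \<rhd> u) = Mid (e \<rhd> u') \<and> terminus (\<phi> e \<rhd> u) = Mid (\<phi> e \<rhd> u')))"
proof (induction u rule: rev_induct)
  case Nil then show ?case using \<psi> e by (auto simp: vertices_def)
next
  case (snoc r u)
  then show ?case by (cases r) auto
qed

text \<open>If the shared cut vertex belongs to \<open>E1\<close>, the vertex map moves it equally
  for both sequences. Otherwise it was born inside a single edge of \<open>E1\<close>, through which
  both sequences pass.\<close>

lemma seq_map_seq_rel:
  assumes "E1 \<in> expansions" "graph_iso E1 E2 \<phi>" "(s, t) \<in> seq_rel"
  shows "(seq_map E1 \<phi> s, seq_map E1 \<phi> t) \<in> seq_rel"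
proof -
  obtain \<psi> where \<psi>: "\<And>e. e \<in> E1 \<Longrightarrow> origin (\<phi> e) = \<psi> (origin e)"
    "\<And>e. e \<in> E1 \<Longrightarrow> terminus (\<phi> e) = \<psi> (terminus e)"
    by (rule graph_isoE[OF assms(2)]) (rule that; assumption)
  have at: "(v \<in> vertices E1 \<and> vertex_at (seq_map E1 \<phi> s) (\<psi> v)) \<or>
      (\<exists>e\<in>E1. \<exists>u. v = Mid (e \<rhd> u) \<and> vertex_at (seq_map E1 \<phi> s) (Mid (\<phi> e \<rhd> u)))"
    if s: "vertex_at s v" for s v
  proof -
    obtain e \<zeta> where e: "e \<in> E1" "s = cat_seq e \<zeta>" using expansion_cover[OF assms(1)] .
    then obtain N where N: "\<And>n. n \<ge> N \<Longrightarrow> v \<in> ends (e \<rhd> map \<zeta> [0..<n])"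
      using s by (auto simp: vertex_at_cat_seq)
    have F: "seq_map E1 \<phi> s = cat_seq (\<phi> e) \<zeta>" using seq_map_cat_seq assms(1) e by simp
    have tr: "v \<in> vertices E1 \<and> \<psi> v \<in> ends (\<phi> e \<rhd> map \<zeta> [0..<n]) \<or>
        (\<exists>u'. v = Mid (e \<rhd> u') \<and> Mid (\<phi> e \<rhd> u') \<in> ends (\<phi> e \<rhd> map \<zeta> [0..<n]))" if "n \<ge> N" for n
      using ends_transport[where \<phi> = \<phi> and \<psi> = \<psi>, OF \<psi> e(1), of "map \<zeta> [0..<n]"] N[OF that]
      unfolding ends_def by (metis insert_iff singletonD)
    show ?thesis
    proof (cases "v \<in> vertices E1")
      case True
      then have "\<psi> v \<in> ends (\<phi> e \<rhd> map \<zeta> [0..<n])" if "n \<ge> N" for n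
        using tr[OF that] Mid_notin_vertices[OF assms(1) e(1)] by metis
      then show ?thesis using True by (auto simp: F vertex_at_cat_seq)
    next
      case False
      then obtain u' where u': "v = Mid (e \<rhd> u')" using tr[of N] by auto
      then have "Mid (\<phi> e \<rhd> u') \<in> ends (\<phi> e \<rhd> map \<zeta> [0..<n])" if "n \<ge> N" for n
        using tr[OF that] False by auto
      then have "vertex_at (seq_map E1 \<phi> s) (Mid (\<phi> e \<rhd> u'))" by (auto simp: F vertex_at_cat_seq)
      then show ?thesis using u' e(1) by blast
    qed
  qed
  have "\<exists>v'. vertex_at (seq_map E1 \<phi> s) v' \<and> vertex_at (seq_map E1 \<phi> t) v'"
    if v: "vertex_at s v" "vertex_at t v" for v
  proof (cases "v \<in> vertices E1")
    case True
    then show ?thesis using at[OF v(1)] at[OF v(2)] Mid_notin_vertices[OF assms(1)] by blast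
  next
    case False
    then obtain e u e' u' where "e \<in> E1" "v = Mid (e \<rhd> u)" "vertex_at (seq_map E1 \<phi> s) (Mid (\<phi> e \<rhd> u))"
      "e' \<in> E1" "v = Mid (e' \<rhd> u')" "vertex_at (seq_map E1 \<phi> t) (Mid (\<phi> e' \<rhd> u'))"
      using at[OF v(1)] at[OF v(2)] by blast
    then show ?thesis using expansion_comparable[OF assms(1), of e e' u u'] by auto
  qed
  then show ?thesis using assms(3) unfolding seq_rel_iff by blast
qed

text \<open>Taking images of classes avoids a choice of representatives: \<open>seq_map\<close> of
  an isomorphism is a bijection respecting \<open>seq_rel\<close> in both directions. The
  restriction to \<open>Xlim\<close> gives the extensional function expected by
  \<open>Bij\<close>.\<close>

definition lim_map :: "addr set \<Rightarrow> (addr \<Rightarrow> addr) \<Rightarrow> bseq set \<Rightarrow> bseq set" where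
  "lim_map E \<phi> = (\<lambda>A\<in>Xlim. seq_map E \<phi> ` A)"

lemma proj_in_Xlim [simp]: "proj s \<in> Xlim"
  by (simp add: Xlim_eq)

lemma lim_map_proj:
  assumes "E1 \<in> expansions" "E2 \<in> expansions" "graph_iso E1 E2 \<phi>"
  shows "lim_map E1 \<phi> (proj s) = proj (seq_map E1 \<phi> s)"
proof -
  let ?F = "seq_map E1 \<phi>" and ?F' = "seq_map E2 (inv_into E1 \<phi>)"
  have "?F ` (seq_rel `` {s}) = seq_rel `` {?F s}"
  proof (intro equalityI subsetI)
    fix t assume "t \<in> ?F ` (seq_rel `` {s})"
    then show "t \<in> seq_rel `` {?F s}" using seq_map_seq_rel[OF assms(1,3)] by auto
  next
    fix t assume "t \<in> seq_rel `` {?F s}"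
    then have "(?F' (?F s), ?F' t) \<in> seq_rel"
      using seq_map_seq_rel[OF assms(2) graph_iso_inverse[OF assms(3)]] by simp
    then have "?F' t \<in> seq_rel `` {s}" using seq_map_inverse[OF assms] by simp
    then show "t \<in> ?F ` (seq_rel `` {s})" using seq_map_inverse'[OF assms] by (metis imageI)
  qed
  then show ?thesis by (simp add: lim_map_def proj_def[symmetric] flip: Image_singleton)
qed

section \<open>The topology of the limit space\<close>

lemma openin_seq_top_iff:
  "openin seq_top V \<longleftrightarrow> (\<forall>s\<in>V. \<exists>n. \<forall>t. trunc t n = trunc s n \<longrightarrow> t \<in> V)"
proof
  assume V: "openin seq_top V"
  show "\<forall>s\<in>V. \<exists>n. \<forall>t. trunc t n = trunc s n \<longrightarrow> t \<in> V"
  proof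
    fix s assume "s \<in> V"
    then obtain A B where AB: "fst s \<in> A" "openin (product_topology (\<lambda>_::nat. discrete_topology (UNIV :: redge set)) UNIV) B"
      "snd s \<in> B" "A \<times> B \<subseteq> V"
      using V unfolding seq_top_def openin_prod_topology_alt by (metis prod.collapse)
    then obtain X where X: "snd s \<in> Pi\<^sub>E UNIV X" "finite {i. X i \<noteq> (UNIV :: redge set)}" "Pi\<^sub>E UNIV X \<subseteq> B"
      using product_topology_open_contains_basis[OF AB(2,3)] by auto
    obtain n where n: "\<And>i. X i \<noteq> UNIV \<Longrightarrow> i < n"
      using finite_nat_set_iff_bounded[THEN iffD1, OF X(2)] by auto
    have "t \<in> V" if t: "trunc t n = trunc s n" for t
    proof -
      have "fst t = fst s" using arg_cong[OF t, of fst] by simp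
      moreover have "snd t i = snd s i" if "i < n" for i
        using t that by (simp add: trunc_def)
      then have "snd t \<in> Pi\<^sub>E UNIV X" using X(1) n by (auto simp: PiE_iff) (metis UNIV_I)
      ultimately show ?thesis using AB X(3) by (cases t) auto
    qed
    then show "\<exists>n. \<forall>t. trunc t n = trunc s n \<longrightarrow> t \<in> V" by blast
  qed
next
  assume V: "\<forall>s\<in>V. \<exists>n. \<forall>t. trunc t n = trunc s n \<longrightarrow> t \<in> V"
  show "openin seq_top V" unfolding openin_subopen[of _ V]
  proof
    fix s assume "s \<in> V"
    then obtain n where n: "\<And>t. trunc t n = trunc s n \<Longrightarrow> t \<in> V" using V by blast
    let ?X = "\<lambda>i. if i < n then {snd s i} else UNIV"
    let ?T = "{fst s} \<times> Pi\<^sub>E UNIV ?X"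
    have "openin (product_topology (\<lambda>_::nat. discrete_topology (UNIV :: redge set)) UNIV) (Pi\<^sub>E UNIV ?X)"
      unfolding openin_PiE_gen by (auto intro!: disjI2 finite_subset[of _ "{..<n}"])
    then have "openin seq_top ?T" unfolding seq_top_def openin_prod_Times_iff by simp
    moreover have "s \<in> ?T" by (cases s) auto
    moreover have "?T \<subseteq> V"
    proof
      fix t assume "t \<in> ?T"
      then have "fst t = fst s" and *: "snd t i \<in> ?X i" for i by (auto simp: PiE_iff mem_Times_iff)
      have "snd t i = snd s i" if "i < n" for i using *[of i] that by simp
      then show "t \<in> V" using \<open>fst t = fst s\<close> by (intro n) (simp add: trunc_def)
    qed
    ultimately show "\<exists>T. openin seq_top T \<and> s \<in> T \<and> T \<subseteq> V"
      by (intro exI[of _ ?T] conjI)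
  qed
qed

lemma openin_seq_map_vimage:
  assumes "E \<in> expansions" "openin seq_top V"
  shows "openin seq_top {s. seq_map E \<phi> s \<in> V}"
  unfolding openin_seq_top_iff
proof
  fix s assume s: "s \<in> {s. seq_map E \<phi> s \<in> V}"
  obtain e \<zeta> where e: "e \<in> E" "s = cat_seq e \<zeta>" using expansion_cover[OF assms(1)] .
  then have "cat_seq (\<phi> e) \<zeta> \<in> V" using s seq_map_cat_seq[OF assms(1)] by auto
  then obtain n where n: "\<And>t. trunc t n = trunc (cat_seq (\<phi> e) \<zeta>) n \<Longrightarrow> t \<in> V"
    using assms(2) unfolding openin_seq_top_iff by blast
  have "seq_map E \<phi> t \<in> V" if t: "trunc t (length (snd e) + n) = trunc s (length (snd e) + n)" for t
  proof -
    have "trunc t (length (snd e)) = e" using trunc_eq_mono[OF t, of "length (snd e)"] e(2) by simp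
    then obtain \<zeta>' where \<zeta>': "t = cat_seq e \<zeta>'" using cat_seq_trunc[of t "length (snd e)"] by metis
    then have "map \<zeta>' [0..<n] = map \<zeta> [0..<n]" using t e(2) by (simp only: trunc_cat_seq extend_cancel)
    then have "trunc (cat_seq (\<phi> e) \<zeta>') (length (snd (\<phi> e)) + n) = trunc (cat_seq (\<phi> e) \<zeta>) (length (snd (\<phi> e)) + n)"
      by (simp only: trunc_cat_seq)
    then have "trunc (cat_seq (\<phi> e) \<zeta>') n = trunc (cat_seq (\<phi> e) \<zeta>) n"
      using trunc_eq_mono by (metis le_add2)
    then show ?thesis using n \<zeta>' seq_map_cat_seq[OF assms(1) e(1)] by simp
  qed
  then show "\<exists>n. \<forall>t. trunc t n = trunc s n \<longrightarrow> t \<in> {s. seq_map E \<phi> s \<in> V}" by blast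
qed

lemma openin_X_top_iff: "openin X_top U \<longleftrightarrow> U \<subseteq> Xlim \<and> openin seq_top {s. proj s \<in> U}"
proof -
  have "istopology (\<lambda>U. U \<subseteq> Xlim \<and> openin seq_top {s. proj s \<in> U})"
    unfolding istopology_def
  proof (intro conjI allI impI; (elim conjE)?)
    fix S T assume "openin seq_top {s. proj s \<in> S}" "openin seq_top {s. proj s \<in> T}"
    then show "openin seq_top {s. proj s \<in> S \<inter> T}"
      using openin_Int[of seq_top "{s. proj s \<in> S}" "{s. proj s \<in> T}"] by (simp add: Int_def)
  next
    fix \<K> assume "\<forall>K\<in>\<K>. K \<subseteq> Xlim \<and> openin seq_top {s. proj s \<in> K}"
    then have "openin seq_top (\<Union>K\<in>\<K>. {s. proj s \<in> K})" by blast
    moreover have "(\<Union>K\<in>\<K>. {s. proj s \<in> K}) = {s. proj s \<in> \<Union>\<K>}" by auto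
    ultimately show "openin seq_top {s. proj s \<in> \<Union>\<K>}" by simp
  qed auto
  then show ?thesis unfolding X_top_def by (simp add: topology_inverse')
qed

lemma topspace_X_top: "topspace X_top = Xlim"
proof -
  have "openin X_top Xlim" unfolding openin_X_top_iff openin_seq_top_iff by simp
  then show ?thesis using openin_X_top_iff[of "topspace X_top"] openin_subset by blast
qed

lemma continuous_lim_map:
  assumes "E1 \<in> expansions" "E2 \<in> expansions" "graph_iso E1 E2 \<phi>"
  shows "continuous_map X_top X_top (lim_map E1 \<phi>)"
  unfolding continuous_map_def topspace_X_top
proof (intro conjI allI impI)
  show "lim_map E1 \<phi> \<in> Xlim \<rightarrow> Xlim" using lim_map_proj[OF assms] by (auto simp: Xlim_eq)
next
  fix U assume "openin X_top U"
  then have "openin seq_top {s. seq_map E1 \<phi> s \<in> {s. proj s \<in> U}}"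
    using openin_seq_map_vimage[OF assms(1)] openin_X_top_iff by blast
  then show "openin X_top {x \<in> Xlim. lim_map E1 \<phi> x \<in> U}"
    unfolding openin_X_top_iff by (simp add: lim_map_proj[OF assms])
qed

lemma homeomorphic_maps_lim_map:
  assumes "E1 \<in> expansions" "E2 \<in> expansions" "graph_iso E1 E2 \<phi>"
  shows "homeomorphic_maps X_top X_top (lim_map E1 \<phi>) (lim_map E2 (inv_into E1 \<phi>))"
  unfolding homeomorphic_maps_def topspace_X_top
  using continuous_lim_map[OF assms] continuous_lim_map[OF assms(2,1) graph_iso_inverse[OF assms(3)]]
    lim_map_proj[OF assms] lim_map_proj[OF assms(2,1) graph_iso_inverse[OF assms(3)]]
    seq_map_inverse[OF assms] seq_map_inverse'[OF assms]
  by (auto simp: Xlim_eq)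

section \<open>The group of rearrangements\<close>

definition diagram :: "(bseq set \<Rightarrow> bseq set) \<Rightarrow> addr set \<Rightarrow> addr set \<Rightarrow> (addr \<Rightarrow> addr) \<Rightarrow> bool" where
  "diagram f E1 E2 \<phi> \<longleftrightarrow> E1 \<in> expansions \<and> E2 \<in> expansions \<and> graph_iso E1 E2 \<phi> \<and>
     (\<forall>e\<in>E1. \<forall>\<zeta>. f (proj (cat_seq e \<zeta>)) = proj (cat_seq (\<phi> e) \<zeta>))"

lemma diagram_lim_map:
  assumes "E1 \<in> expansions" "E2 \<in> expansions" "graph_iso E1 E2 \<phi>"
  shows "diagram (lim_map E1 \<phi>) E1 E2 \<phi>"
  using assms by (simp add: diagram_def lim_map_proj seq_map_cat_seq)

lemma diagram_eq_lim_map: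
  assumes "diagram f E1 E2 \<phi>" "x \<in> Xlim"
  shows "f x = lim_map E1 \<phi> x"
proof -
  obtain s where s: "x = proj s" using assms by (auto simp: Xlim_eq)
  have E: "E1 \<in> expansions" "E2 \<in> expansions" "graph_iso E1 E2 \<phi>" using assms by (auto simp: diagram_def)
  obtain e \<zeta> where "e \<in> E1" "s = cat_seq e \<zeta>" using expansion_cover[OF E(1)] .
  then show ?thesis using s assms(1) E(1) by (simp add: diagram_def lim_map_proj[OF E] seq_map_cat_seq)
qed

lemma diagram_bij:
  assumes "diagram f E1 E2 \<phi>"
  shows "bij_betw f Xlim Xlim"
proof -
  have "homeomorphic_map X_top X_top (lim_map E1 \<phi>)"
    using homeomorphic_maps_lim_map assms homeomorphic_map_maps unfolding diagram_def by blast
  then have "bij_betw (lim_map E1 \<phi>) Xlim Xlim"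
    using homeomorphic_imp_injective_map homeomorphic_imp_surjective_map
    by (fastforce simp: bij_betw_def topspace_X_top)
  then show ?thesis using diagram_eq_lim_map[OF assms] bij_betw_cong by blast
qed

text \<open>A diagram determines f on \<open>Xlim\<close> as the corresponding
  \<open>lim_map\<close>, which supplies the homeomorphism. Membership in the group thereby becomes
  a statement about expansions and graph isomorphisms.\<close>

lemma carrier_T_B: "f \<in> carrier T_B \<longleftrightarrow> f \<in> extensional Xlim \<and> (\<exists>E1 E2 \<phi>. diagram f E1 E2 \<phi>)"
proof
  assume "f \<in> carrier T_B"
  then show "f \<in> extensional Xlim \<and> (\<exists>E1 E2 \<phi>. diagram f E1 E2 \<phi>)"
    by (auto simp: T_B_def rearrangement_def diagram_def Bij_def)
next
  assume f: "f \<in> extensional Xlim \<and> (\<exists>E1 E2 \<phi>. diagram f E1 E2 \<phi>)"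
  then obtain E1 E2 \<phi> where d: "diagram f E1 E2 \<phi>" by blast
  have "f = lim_map E1 \<phi>"
    by (rule extensionalityI[of _ Xlim]) (use f diagram_eq_lim_map[OF d] in \<open>auto simp: lim_map_def\<close>)
  then have "homeomorphic_map X_top X_top f"
    using homeomorphic_maps_lim_map d homeomorphic_map_maps unfolding diagram_def by blast
  then show "f \<in> carrier T_B"
    using f d diagram_bij[OF d] by (auto simp: T_B_def Bij_def rearrangement_def diagram_def)
qed

lemma diagram_expand:
  assumes "diagram f E1 E2 \<phi>" "e \<in> E1"
  obtains \<phi>' where "diagram f (expand E1 e) (expand E2 (\<phi> e)) \<phi>'"
proof -
  have E: "E1 \<in> expansions" "E2 \<in> expansions" "graph_iso E1 E2 \<phi>" using assms by (auto simp: diagram_def)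
  obtain \<phi>' where \<phi>': "graph_iso (expand E1 e) (expand E2 (\<phi> e)) \<phi>'"
    "\<And>r. \<phi>' (e \<rhd> [r]) = \<phi> e \<rhd> [r]" "\<And>z. z \<in> E1 \<Longrightarrow> z \<noteq> e \<Longrightarrow> \<phi>' z = \<phi> z"
    using graph_iso_expand[OF E assms(2)] by metis
  have "f (proj (cat_seq z \<zeta>)) = proj (cat_seq (\<phi>' z) \<zeta>)" if "z \<in> expand E1 e" for z \<zeta>
  proof -
    consider "z \<in> E1" "z \<noteq> e" | r where "z = e \<rhd> [r]" using \<open>z \<in> expand E1 e\<close> by (auto simp: in_expand_iff)
    then show ?thesis
      by cases (use assms in \<open>simp_all add: diagram_def cat_seq_extend \<phi>'(2,3)\<close>)
  qed
  then have "diagram f (expand E1 e) (expand E2 (\<phi> e)) \<phi>'"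
    using \<phi>'(1) E assms(2) expand_in_expansions graph_iso_in[OF E(3)] by (simp add: diagram_def)
  then show thesis using that by blast
qed

lemma diagram_refine_domain:
  assumes "diagram f E1 E2 \<phi>" "expansion_step\<^sup>*\<^sup>* E1 E"
  shows "\<exists>E' \<phi>'. diagram f E E' \<phi>'"
  using assms(2,1)
proof (induction rule: rtranclp_induct)
  case (step E E')
  then obtain F \<phi>' e where "diagram f E F \<phi>'" "e \<in> E" "E' = expand E e" by (auto elim: expansion_step.cases)
  then show ?case using diagram_expand by metis
qed blast

lemma diagram_refine_codomain:
  assumes "diagram f E1 E2 \<phi>" "expansion_step\<^sup>*\<^sup>* E2 E"
  shows "\<exists>E' \<phi>'. diagram f E' E \<phi>'"
  using assms(2,1)
proof (induction rule: rtranclp_induct)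
  case (step E E')
  then obtain F \<phi>' w where d: "diagram f F E \<phi>'" "w \<in> E" "E' = expand E w"
    by (auto elim: expansion_step.cases)
  then obtain e where "e \<in> F" "w = \<phi>' e"
    using graph_iso_bij by (metis bij_betw_def diagram_def imageE)
  then show ?case using d diagram_expand by metis
qed blast

text \<open>The codomain of one diagram and the domain of the other are refined to a common
  expansion, and each refinement is carried through its isomorphism.\<close>

lemma diagram_compose:
  assumes "diagram f E1 E2 \<phi>" "diagram g F1 F2 \<eta>"
  shows "\<exists>E F \<xi>. diagram (compose Xlim g f) E F \<xi>"
proof -
  obtain D where "expansion_step\<^sup>*\<^sup>* E2 D" "expansion_step\<^sup>*\<^sup>* F1 D"
    using common_expansion assms unfolding diagram_def by metis
  then obtain E F \<phi>' \<eta>' where d: "diagram f E D \<phi>'" "diagram g D F \<eta>'"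
    using diagram_refine_codomain[OF assms(1)] diagram_refine_domain[OF assms(2)] by metis
  then have "diagram (compose Xlim g f) E F (\<eta>' \<circ> \<phi>')"
    using graph_iso_compose graph_iso_in by (auto simp: diagram_def compose_def)
  then show ?thesis by blast
qed

lemma diagram_inverse:
  assumes "diagram f E1 E2 \<phi>"
  shows "diagram (\<lambda>x\<in>Xlim. inv_into Xlim f x) E2 E1 (inv_into E1 \<phi>)"
proof -
  have iso: "graph_iso E1 E2 \<phi>" using assms by (simp add: diagram_def)
  have "inv_into Xlim f (proj (cat_seq e \<zeta>)) = proj (cat_seq (inv_into E1 \<phi> e) \<zeta>)" if "e \<in> E2" for e \<zeta>
  proof -
    have "inv_into E1 \<phi> e \<in> E1" "\<phi> (inv_into E1 \<phi> e) = e"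
      using that graph_iso_in[OF graph_iso_inverse[OF iso]] graph_iso_bij[OF iso]
      by (simp_all add: bij_betw_inv_into_right)
    then have "f (proj (cat_seq (inv_into E1 \<phi> e) \<zeta>)) = proj (cat_seq e \<zeta>)"
      using assms by (simp add: diagram_def)
    then show ?thesis using diagram_bij[OF assms] by (metis bij_betw_inv_into_left proj_in_Xlim)
  qed
  then show ?thesis using assms graph_iso_inverse by (simp add: diagram_def)
qed

lemma subgroup_T_B: "subgroup (carrier T_B) (BijGroup Xlim)"
proof
  have Bij: "f \<in> Bij Xlim" if "f \<in> carrier T_B" for f using that by (simp add: T_B_def)
  show "carrier T_B \<subseteq> carrier (BijGroup Xlim)" using Bij by (auto simp: BijGroup_def)
  show "\<one>\<^bsub>BijGroup Xlim\<^esub> \<in> carrier T_B"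
  proof -
    have "graph_iso base_edges base_edges id"
      unfolding graph_iso_def by (intro conjI exI[of _ id]) auto
    then have "diagram (\<lambda>x\<in>Xlim. x) base_edges base_edges id"
      using base_in_expansions by (auto simp: diagram_def)
    then show ?thesis unfolding carrier_T_B by (auto simp: BijGroup_def)
  qed
  fix f assume f: "f \<in> carrier T_B"
  obtain E1 E2 \<phi> where "diagram f E1 E2 \<phi>" using f unfolding carrier_T_B by blast
  from diagram_inverse[OF this] show "inv\<^bsub>BijGroup Xlim\<^esub> f \<in> carrier T_B"
    unfolding inv_BijGroup[OF Bij[OF f]] carrier_T_B by auto
  fix g assume g: "g \<in> carrier T_B"
  have "f \<otimes>\<^bsub>BijGroup Xlim\<^esub> g = compose Xlim f g" using f g Bij by (simp add: BijGroup_def)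
  then show "f \<otimes>\<^bsub>BijGroup Xlim\<^esub> g \<in> carrier T_B"
    using f g diagram_compose unfolding carrier_T_B by (metis compose_extensional)
qed

lemma T_B_eq: "T_B = BijGroup Xlim\<lparr>carrier := carrier T_B\<rparr>"
  by (simp add: T_B_def)

interpretation T_B: translation T_B
  by (rule group.translation)
    (use subgroup.subgroup_is_group[OF subgroup_T_B group_BijGroup] T_B_eq in simp)

abbreviation times_T_B :: "(bseq set \<Rightarrow> bseq set) \<Rightarrow> _ \<Rightarrow> _" (infixl "\<odot>" 70) where
  "f \<odot> g \<equiv> f \<otimes>\<^bsub>T_B\<^esub> g"

abbreviation inv_T_B :: "(bseq set \<Rightarrow> bseq set) \<Rightarrow> _" where
  "inv_T_B f \<equiv> inv\<^bsub>T_B\<^esub> f"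

lemma mult_T_B:
  assumes "f \<in> carrier T_B" "g \<in> carrier T_B" "x \<in> Xlim"
  shows "(f \<odot> g) x = f (g x)"
  using assms by (auto simp: T_B_def BijGroup_def compose_def)

lemma one_T_B: "x \<in> Xlim \<Longrightarrow> \<one>\<^bsub>T_B\<^esub> x = x"
  by (simp add: T_B_def BijGroup_def)

lemma T_B_in_Xlim: "f \<in> carrier T_B \<Longrightarrow> x \<in> Xlim \<Longrightarrow> f x \<in> Xlim"
  using bij_betwE by (fastforce simp: T_B_def Bij_def)

lemma T_B_eqI:
  assumes "f \<in> carrier T_B" "g \<in> carrier T_B" "\<And>x. x \<in> Xlim \<Longrightarrow> f x = g x"
  shows "f = g"
  by (rule extensionalityI[of _ Xlim]) (use assms in \<open>auto simp: carrier_T_B\<close>)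

section \<open>Loops and cells\<close>

definition is_loop :: "addr \<Rightarrow> bool" where
  "is_loop w \<longleftrightarrow> origin w = terminus w"

text \<open>The midpoint of an expanded edge is new, so the children 1 and 3 join distinct vertices
  even when the expanded edge is a loop.\<close>

lemma is_loop_snoc: "is_loop (w \<rhd> (u @ [r])) \<longleftrightarrow> r = R2"
proof -
  have "Mid (w \<rhd> u) \<notin> ends (w \<rhd> u)" using Mid_in_ends_length by blast
  then show ?thesis by (cases r) (auto simp: is_loop_def ends_def)
qed

lemma is_loop_graph_iso:
  assumes "graph_iso E1 E2 \<phi>" "e \<in> E1" "is_loop (e \<rhd> u)"
  shows "is_loop (\<phi> e \<rhd> u)"
proof (cases u rule: rev_cases)
  case Nil
  obtain \<psi> where "\<And>e. e \<in> E1 \<Longrightarrow> origin (\<phi> e) = \<psi> (origin e)"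
    "\<And>e. e \<in> E1 \<Longrightarrow> terminus (\<phi> e) = \<psi> (terminus e)"
    by (rule graph_isoE[OF assms(1)]) (rule that; assumption)
  then show ?thesis using assms(2,3) Nil by (simp add: is_loop_def)
qed (use assms(3) is_loop_snoc in auto)

definition cell :: "addr \<Rightarrow> bseq set set" where
  "cell w = range (\<lambda>\<zeta>. proj (cat_seq w \<zeta>))"

definition base_point :: "addr \<Rightarrow> bseq set" where
  "base_point w = proj (cat_seq w (\<lambda>_. R1))"

text \<open>The attaching point is recorded so that an element stabilizing \<open>cell_a\<close>
  fixes the vertex x by definition.\<close>

definition pointed_cell :: "addr \<Rightarrow> bseq set set \<times> bseq set" where
  "pointed_cell w = (cell w, base_point w)"

definition push :: "(bseq set \<Rightarrow> bseq set) \<Rightarrow> bseq set set \<times> bseq set \<Rightarrow> bseq set set \<times> bseq set" where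
  "push f h = (f ` fst h, f (snd h))"

lemma cell_subset_Xlim: "cell w \<subseteq> Xlim"
  by (auto simp: cell_def)

lemma diagram_proj:
  "diagram f E1 E2 \<phi> \<Longrightarrow> e \<in> E1 \<Longrightarrow> f (proj (cat_seq (e \<rhd> u) \<zeta>)) = proj (cat_seq (\<phi> e \<rhd> u) \<zeta>)"
  by (simp add: diagram_def cat_seq_extend)

lemma diagram_cell:
  assumes "diagram f E1 E2 \<phi>" "e \<in> E1"
  shows "f ` cell (e \<rhd> u) = cell (\<phi> e \<rhd> u)"
  by (simp add: cell_def image_image diagram_proj[OF assms])

lemma diagram_pointed_cell:
  assumes "diagram f E1 E2 \<phi>" "e \<in> E1"
  shows "push f (pointed_cell (e \<rhd> u)) = pointed_cell (\<phi> e \<rhd> u)"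
  by (simp add: push_def pointed_cell_def base_point_def diagram_cell[OF assms] diagram_proj[OF assms])

text \<open>Along 222... both ends of the edge are replaced at each step, so no vertex persists and
  the class is a singleton. Such points detect addresses inside cells.\<close>

lemma proj_cat_seq_R2:
  assumes "proj (cat_seq w (\<lambda>_. R2)) = proj t"
  shows "t = cat_seq w (\<lambda>_. R2)"
proof -
  have "\<not> vertex_at (cat_seq w (\<lambda>_. R2)) v" for v
  proof
    assume "vertex_at (cat_seq w (\<lambda>_. R2)) v"
    then obtain N where N: "\<And>n. n \<ge> N \<Longrightarrow> v \<in> ends (w \<rhd> map (\<lambda>_. R2) [0..<n])"
      by (auto simp: vertex_at_cat_seq)
    have "v = Mid (w \<rhd> map (\<lambda>_. R2) [0..<n])" if "n \<ge> N" for n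
      using N[of "Suc n"] that by (simp add: ends_def)
    from this[of N] this[of "Suc N"] show False by simp
  qed
  then show ?thesis using assms unfolding proj_eq_iff seq_rel_iff by blast
qed

lemma cell_subset_iff:
  "cell w \<subseteq> cell v \<longleftrightarrow> (\<exists>u. w = v \<rhd> u)"
proof
  assume sub: "cell w \<subseteq> cell v"
  have cmp: "(\<exists>x. v = w \<rhd> u \<rhd> x) \<or> (\<exists>x. w \<rhd> u = v \<rhd> x)" for u
  proof -
    have "proj (cat_seq (w \<rhd> u) (\<lambda>_. R2)) \<in> cell w" by (auto simp: cell_def cat_seq_extend)
    then have "proj (cat_seq (w \<rhd> u) (\<lambda>_. R2)) \<in> cell v" using sub by blast
    then obtain \<zeta> where "cat_seq v \<zeta> = cat_seq (w \<rhd> u) (\<lambda>_. R2)"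
      using proj_cat_seq_R2 unfolding cell_def by blast
    then show ?thesis using cat_seq_eq_comparable by metis
  qed
  show "\<exists>u. w = v \<rhd> u"
  proof (rule ccontr)
    assume no: "\<nexists>u. w = v \<rhd> u"
    then obtain x where x: "v = w \<rhd> x" "x \<noteq> []" using cmp[of "[]"] by (metis extend_Nil)
    then obtain r x' where rx: "x = r # x'" by (cases x) auto
    \<comment> \<open>If v were strictly inside w, a sibling of the child of w containing v would
      have a point 222... outside the cell of v.\<close>
    obtain r' :: redge where "r' \<noteq> r" by (metis redge.distinct(1))
    then show False using cmp[of "[r']"] x rx by auto
  qed
next
  assume "\<exists>u. w = v \<rhd> u"
  then show "cell w \<subseteq> cell v" by (auto simp: cell_def cat_seq_extend)
qed

lemma cell_inj: "cell w = cell v \<Longrightarrow> w = v"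
  using cell_subset_iff[of w v] cell_subset_iff[of v w] by auto

definition loop_cells :: "(bseq set set \<times> bseq set) set" where
  "loop_cells = {pointed_cell w | w. is_loop w}"

lemma comparable_expansion:
  assumes "E \<in> expansions"
  obtains e u where "e \<in> E" "w = e \<rhd> u" | e u where "e \<in> E" "e = w \<rhd> u" "u \<noteq> []"
proof -
  obtain e \<zeta> where "e \<in> E" "cat_seq w (\<lambda>_. R2) = cat_seq e \<zeta>" using expansion_cover[OF assms] .
  then show thesis using cat_seq_eq_comparable that by (metis extend_Nil)
qed

lemma push_loop_cells:
  assumes "diagram f E1 E2 \<phi>" "is_loop (e \<rhd> u)" "e \<in> E1"
  shows "push f (pointed_cell (e \<rhd> u)) \<in> loop_cells"
proof -
  have "graph_iso E1 E2 \<phi>" using assms(1) by (simp add: diagram_def)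
  from is_loop_graph_iso[OF this assms(3,2)] have "is_loop (\<phi> e \<rhd> u)" .
  then show ?thesis unfolding diagram_pointed_cell[OF assms(1,3)] loop_cells_def by blast
qed

text \<open>A loop cell contained in the cell of an edge of \<open>E1\<close> is mapped canonically
  to a loop cell. The remaining addresses are prefixes of the finitely many edges of
  \<open>E1\<close>.\<close>

lemma finite_noncanonical_loop_cells:
  assumes "diagram f E1 E2 \<phi>"
  shows "finite {h \<in> loop_cells. push f h \<notin> loop_cells}"
proof (rule finite_subset)
  have E1: "E1 \<in> expansions" using assms by (simp add: diagram_def)
  let ?P = "(\<Union>e\<in>E1. (\<lambda>n. (fst e, take n (snd e))) ` {..length (snd e)})"
  show "finite (pointed_cell ` ?P)" using finite_expansion[OF E1] by simp
  show "{h \<in> loop_cells. push f h \<notin> loop_cells} \<subseteq> pointed_cell ` ?P"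
  proof
    fix h assume h: "h \<in> {h \<in> loop_cells. push f h \<notin> loop_cells}"
    then obtain w where w: "h = pointed_cell w" "is_loop w" by (auto simp: loop_cells_def)
    have "w \<in> ?P"
    proof (rule comparable_expansion[OF E1, of w])
      fix e u assume "e \<in> E1" "w = e \<rhd> u"
      then show ?thesis using push_loop_cells[OF assms] w h by auto
    next
      fix e u assume "e \<in> E1" "e = w \<rhd> u"
      then have "w = (fst e, take (length (snd w)) (snd e))" "length (snd w) \<le> length (snd e)" by auto
      then show ?thesis using \<open>e \<in> E1\<close> by blast
    qed
    then show "h \<in> pointed_cell ` ?P" using w by blast
  qed
qed

lemma push_T_B:
  assumes "f \<in> carrier T_B" "g \<in> carrier T_B" "fst h \<subseteq> Xlim" "snd h \<in> Xlim"
  shows "push (f \<odot> g) h = push f (push g h)"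
  using assms mult_T_B[OF assms(1,2)] by (auto simp: push_def subset_iff image_iff)

lemma loop_preimage:
  assumes "graph_iso E1 E2 \<phi>" "e' \<in> E2" "is_loop (e' \<rhd> u)"
  obtains e where "e \<in> E1" "e' = \<phi> e" "is_loop (e \<rhd> u)"
proof -
  obtain e where e: "e \<in> E1" "e' = \<phi> e" using assms(2) graph_iso_bij[OF assms(1)] by (metis bij_betw_def imageE)
  have "is_loop (inv_into E1 \<phi> e' \<rhd> u)" using is_loop_graph_iso[OF graph_iso_inverse[OF assms(1)] assms(2,3)] .
  then have "is_loop (e \<rhd> u)" using e bij_betw_inv_into_left[OF graph_iso_bij[OF assms(1)] e(1)] by simp
  then show thesis using that e by blast
qed

section \<open>Depth\<close>

text \<open>The distance, in the tree of circles, from the circle of the base edges \<open>b\<close>, \<open>d\<close> or from that of \<open>a\<close>,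
  whichever is on the same side of the vertex \<open>x\<close>.\<close>
definition depth :: "addr \<Rightarrow> nat" where
  "depth w = length (filter (\<lambda>r. r = R2) (snd w)) + (if fst w = Ec then 1 else 0)"

lemma depth_extend: "depth (w \<rhd> u) = depth w + length (filter (\<lambda>r. r = R2) u)"
  by (simp add: depth_def)

text \<open>Kirchhoff's law at the midpoint of an expanded edge forces equal labels on its two outer parts, so
  labels are constant on circles; \<open>depth\<close> is the largest labelling, hence preserved by isomorphisms.\<close>
definition labelling :: "addr set \<Rightarrow> (addr \<Rightarrow> nat) \<Rightarrow> bool" where
  "labelling E \<delta> \<longleftrightarrow>
     (\<forall>v. (\<Sum>e\<in>E. if origin e = v then \<delta> e else 0) = (\<Sum>e\<in>E. if terminus e = v then \<delta> e else 0)) \<and>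
     (\<forall>e\<in>E. \<forall>e'\<in>E. ends e \<inter> ends e' \<noteq> {} \<longrightarrow> \<delta> e \<le> \<delta> e' + 1) \<and>
     (\<forall>e\<in>E. Vx \<in> ends e \<longrightarrow> \<delta> e = 0)"

lemma sum_expand:
  fixes g :: "addr \<Rightarrow> nat"
  assumes "E \<in> expansions" "w \<in> E"
  shows "sum g (expand E w) = sum g (E - {w}) + g (w \<rhd> [R1]) + g (w \<rhd> [R2]) + g (w \<rhd> [R3])"
proof -
  have "w \<rhd> [r] \<notin> E" for r using expansion_antichain[OF assms, of "[r]"] by auto
  moreover have "finite (E - {w})" using finite_expansion[OF assms(1)] by simp
  ultimately show ?thesis unfolding expand_def by (subst sum.union_disjoint) auto
qed

lemma sum_contract:
  fixes g :: "addr \<Rightarrow> nat"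
  assumes "E \<in> expansions" "w \<in> E"
  shows "sum g E = sum g (E - {w}) + g w"
  using sum.remove[OF finite_expansion[OF assms(1)] assms(2), of g] by simp

lemma ends_expand_cases:
  assumes "E \<in> expansions" "w \<in> E" "e \<in> E"
  shows "Mid w \<notin> ends e" "origin e \<noteq> Mid w" "terminus e \<noteq> Mid w"
  using Mid_notin_vertices[OF assms(1,2), of "[]"] assms(3) by (auto simp: vertices_eq ends_def)

text \<open>Expanding w replaces it by a path through the midpoint with the same label and adds a
  loop. A loop contributes equally to both sides of Kirchhoff's law, so balance persists, and its
  label exceeds that of the path by one.\<close>

lemma labelling_depth: "E \<in> expansions \<Longrightarrow> labelling E depth"
proof (induction rule: expansions_induct)
  case base
  show ?case unfolding labelling_def base_edges_eq by (auto simp: depth_def ends_def)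
next
  case (expand E w)
  note E = expand.hyps
  have old: "(\<Sum>e\<in>E. if origin e = v then depth e else 0) = (\<Sum>e\<in>E. if terminus e = v then depth e else 0)"
    "e \<in> E \<Longrightarrow> e' \<in> E \<Longrightarrow> ends e \<inter> ends e' \<noteq> {} \<Longrightarrow> depth e \<le> depth e' + 1"
    "e \<in> E \<Longrightarrow> Vx \<in> ends e \<Longrightarrow> depth e = 0" for v e e'
    using expand.IH unfolding labelling_def by blast+
  have "(\<Sum>e\<in>expand E w. if origin e = v then depth e else 0) =
      (\<Sum>e\<in>expand E w. if terminus e = v then depth e else 0)" for v
    using old(1)[of v] unfolding sum_expand[OF E] sum_contract[OF E] by (simp add: depth_extend split: if_splits)
  moreover have "depth e \<le> depth e' + 1"
    if e: "e \<in> expand E w" and e': "e' \<in> expand E w" and sh: "ends e \<inter> ends e' \<noteq> {}" for e e'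
  proof -
    note M = ends_expand_cases(1)[OF E]
    \<comment> \<open>The loop meets only its midpoint, which no old edge contains; hence a child
      adjacent to an old edge carries the label of w.\<close>
    have new: "ends (w \<rhd> [r]) \<inter> ends z \<noteq> {} \<Longrightarrow> z \<in> E \<Longrightarrow> r \<noteq> R2 \<and> ends w \<inter> ends z \<noteq> {}" for r z
      using M[of z] by (cases r) (auto simp: ends_def)
    consider "e \<in> E" "e' \<in> E" | r where "e = w \<rhd> [r]" "e' \<in> E" | r where "e \<in> E" "e' = w \<rhd> [r]"
      | r r' where "e = w \<rhd> [r]" "e' = w \<rhd> [r']"
      using e e' by (auto simp: in_expand_iff)
    then show ?thesis
    proof cases
      case 1 then show ?thesis using old(2) sh by blast
    next
      case 2 then show ?thesis using new[of r e'] old(2)[of w e'] sh E(2) by (simp add: depth_extend)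
    next
      case 3 then show ?thesis using new[of r e] old(2)[of e w] sh E(2)
        by (auto simp: depth_extend Int_commute)
    next
      case 4 then show ?thesis by (simp add: depth_extend)
    qed
  qed
  moreover have "depth e = 0" if e: "e \<in> expand E w" "Vx \<in> ends e" for e
  proof -
    consider "e \<in> E" | r where "e = w \<rhd> [r]" using e by (auto simp: in_expand_iff)
    then show ?thesis
    proof cases
      case 1 then show ?thesis using old(3) e by blast
    next
      case 2
      then have "r \<noteq> R2" "Vx \<in> ends w" using e(2) by (cases r; auto simp: ends_def)+
      then show ?thesis using old(3)[OF E(2)] 2 by (simp add: depth_extend)
    qed
  qed
  ultimately show ?case unfolding labelling_def by blast
qed

text \<open>Undoing the last expansion turns a labelling into a labelling: w receives the common
  value of w1 and w3. The induction hypothesis bounds that value, and adjacency bounds the loop w2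
  by one more. On the base graph only the loop c can have a nonzero label, which is at most
  1.\<close>

lemma labelling_le_depth:
  "E \<in> expansions \<Longrightarrow> labelling E \<delta> \<Longrightarrow> e \<in> E \<Longrightarrow> \<delta> e \<le> depth e"
proof (induction arbitrary: \<delta> e rule: expansions_induct)
  case base
  have lip: "\<delta> (Ec, []) \<le> \<delta> (Eb, []) + 1" and
    zero: "\<delta> (Ea, []) = 0" "\<delta> (Eb, []) = 0" "\<delta> (Ed, []) = 0"
    using base.prems(1) unfolding labelling_def base_edges_eq by (auto simp: ends_def)
  then show ?case using base.prems(2) unfolding base_edges_eq by (auto simp: depth_def)
next
  case (expand E w)
  note E = expand.hyps
  let ?\<delta> = "\<delta>(w := \<delta> (w \<rhd> [R1]))"
  have circ: "(\<Sum>e\<in>expand E w. if origin e = v then \<delta> e else 0) =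
      (\<Sum>e\<in>expand E w. if terminus e = v then \<delta> e else 0)" for v
    using expand.prems(1) unfolding labelling_def by blast
  have lip: "\<delta> e \<le> \<delta> e' + 1" if "e \<in> expand E w" "e' \<in> expand E w" "ends e \<inter> ends e' \<noteq> {}" for e e'
    using expand.prems(1) that unfolding labelling_def by blast
  have zero: "\<delta> e = 0" if "e \<in> expand E w" "Vx \<in> ends e" for e
    using expand.prems(1) that unfolding labelling_def by blast
  note M = ends_expand_cases[OF E]
  have new: "w \<rhd> [r] \<in> expand E w" for r by (auto simp: in_expand_iff)
  have sums: "(\<Sum>e\<in>E - {w}. if origin e = v then ?\<delta> e else 0) = (\<Sum>e\<in>E - {w}. if origin e = v then \<delta> e else 0)"
    "(\<Sum>e\<in>E - {w}. if terminus e = v then ?\<delta> e else 0) = (\<Sum>e\<in>E - {w}. if terminus e = v then \<delta> e else 0)" for v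
    by (rule sum.cong; simp)+
  have none: "(\<Sum>e\<in>E - {w}. if origin e = Mid w then f e else 0) = 0"
    "(\<Sum>e\<in>E - {w}. if terminus e = Mid w then f e else 0) = 0" for f :: "addr \<Rightarrow> nat"
    using M by auto
  have \<delta>13: "\<delta> (w \<rhd> [R3]) = \<delta> (w \<rhd> [R1])"
    using circ[of "Mid w"] M[OF E(2)] unfolding sum_expand[OF E] none by simp
  have "labelling E ?\<delta>"
    unfolding labelling_def
  proof (intro conjI allI ballI impI)
    fix v
    show "(\<Sum>e\<in>E. if origin e = v then ?\<delta> e else 0) = (\<Sum>e\<in>E. if terminus e = v then ?\<delta> e else 0)"
    proof (cases "v = Mid w")
      case True then show ?thesis unfolding sum_contract[OF E] True none using M[OF E(2)] by simp
    next
      case False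
      then show ?thesis using circ[of v] \<delta>13
        unfolding sum_expand[OF E] sum_contract[OF E] sums by (simp split: if_splits)
    qed
  next
    fix e e' assume e: "e \<in> E" "e' \<in> E" "ends e \<inter> ends e' \<noteq> {}"
    \<comment> \<open>Each end of an edge of E remains an end of an edge of the expansion with the
      same label, through which the adjacency inequality is inherited.\<close>
    have child: "\<exists>z. z \<in> expand E w \<and> v \<in> ends z \<and> \<delta> z = ?\<delta> y" if y: "y \<in> E" "v \<in> ends y" for v y
    proof (cases "y = w")
      case True
      then show ?thesis using y(2) new[of R1] new[of R3] \<delta>13
        by (metis (no_types, lifting) ends_def fun_upd_same insertCI insertE origin_single redge.simps(7)
            redge.simps(9) singletonD terminus_single)
    next
      case False then show ?thesis using y by (intro exI[of _ y]) (simp add: in_expand_iff)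
    qed
    obtain v where "v \<in> ends e" "v \<in> ends e'" using e(3) by blast
    then obtain z z' where z: "z \<in> expand E w" "v \<in> ends z" "\<delta> z = ?\<delta> e"
      "z' \<in> expand E w" "v \<in> ends z'" "\<delta> z' = ?\<delta> e'"
      using child[OF e(1), of v] child[OF e(2), of v] by blast
    then have "ends z \<inter> ends z' \<noteq> {}" by blast
    from lip[OF z(1,4) this] show "?\<delta> e \<le> ?\<delta> e' + 1" unfolding z(3,6) .
  next
    fix e assume e: "e \<in> E" "Vx \<in> ends e"
    show "?\<delta> e = 0"
    proof (cases "e = w")
      case True
      then have "Vx \<in> ends (w \<rhd> [R1]) \<or> Vx \<in> ends (w \<rhd> [R3])" using e(2) by (auto simp: ends_def)
      then show ?thesis using zero[OF new] \<delta>13 True by auto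
    next
      case False then show ?thesis using zero[of e] e by (simp add: in_expand_iff)
    qed
  qed
  then have le: "?\<delta> z \<le> depth z" if "z \<in> E" for z using expand.IH that by blast
  have "\<delta> (w \<rhd> [R2]) \<le> \<delta> (w \<rhd> [R1]) + 1"
    by (rule lip[OF new new]) (simp add: ends_def)
  then have "\<delta> (w \<rhd> [r]) \<le> depth (w \<rhd> [r])" for r
    using le[OF E(2)] \<delta>13 by (cases r) (auto simp: depth_extend)
  then show ?case using expand.prems(2) le[of e] by (auto simp: in_expand_iff)
qed

section \<open>Invariance of depth under isomorphisms fixing x\<close>

abbreviation vertex_x :: "bseq set" where
  "vertex_x \<equiv> base_point (Ea, [])"

lemma origin_replicate_R1: "origin (w \<rhd> replicate n R1) = origin w"
proof (induction n)
  case (Suc n)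
  have "replicate (Suc n) R1 = replicate n R1 @ [R1]" by (simp add: replicate_append_same)
  then show ?case using Suc by (simp del: replicate_Suc)
qed simp

lemma map_const_upt: "map (\<lambda>_. c) [0..<n] = replicate n c"
  by (simp add: map_replicate_const)

lemma vertex_at_origin: "vertex_at (cat_seq w (\<lambda>_. R1)) (origin w)"
  by (auto simp: vertex_at_cat_seq map_const_upt ends_def origin_replicate_R1)

text \<open>The image of a sequence representing x is again one, so \<open>Vx\<close> persists along
  it; by transport \<open>\<psi> Vx\<close> persists along it too. Uniqueness of the cut vertex
  identifies the two.\<close>

lemma iso_fixes_Vx:
  assumes d: "diagram g E1 E2 \<phi>" and g: "g vertex_x = vertex_x"
    and \<psi>: "\<And>e. e \<in> E1 \<Longrightarrow> origin (\<phi> e) = \<psi> (origin e)" "\<And>e. e \<in> E1 \<Longrightarrow> terminus (\<phi> e) = \<psi> (terminus e)"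
  shows "\<psi> Vx = Vx"
proof -
  let ?s = "cat_seq (Ea, []) (\<lambda>_. R1)"
  have E: "E1 \<in> expansions" using d by (simp add: diagram_def)
  have s: "vertex_at ?s Vx" using vertex_at_origin[of "(Ea, [])"] by simp
  obtain e \<zeta> where e: "e \<in> E1" "?s = cat_seq e \<zeta>" using expansion_cover[OF E] .
  have "proj (cat_seq (\<phi> e) \<zeta>) = proj ?s" using d e g by (auto simp: base_point_def diagram_def)
  then have "cat_seq (\<phi> e) \<zeta> = ?s \<or> (\<exists>v. vertex_at (cat_seq (\<phi> e) \<zeta>) v \<and> vertex_at ?s v)"
    by (simp add: proj_eq_iff seq_rel_iff)
  then have at: "vertex_at (cat_seq (\<phi> e) \<zeta>) Vx" using s vertex_at_unique by metis
  have "vertex_at (cat_seq (\<phi> e) \<zeta>) (\<psi> Vx)"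
  proof -
    obtain N where N: "\<And>n. n \<ge> N \<Longrightarrow> Vx \<in> ends (e \<rhd> map \<zeta> [0..<n])"
      using s e(2) by (auto simp: vertex_at_cat_seq)
    have "\<psi> Vx \<in> ends (\<phi> e \<rhd> map \<zeta> [0..<n])" if "n \<ge> N" for n
      using N[OF that] ends_transport[where \<phi> = \<phi> and \<psi> = \<psi>, OF \<psi> e(1), of "map \<zeta> [0..<n]"]
      by (auto simp: ends_def)
    then show ?thesis by (auto simp: vertex_at_cat_seq)
  qed
  then show ?thesis using at vertex_at_unique by blast
qed

lemma labelling_transport:
  assumes iso: "graph_iso E1 E2 \<phi>" and \<psi>: "bij_betw \<psi> (vertices E1) (vertices E2)"
    "\<And>e. e \<in> E1 \<Longrightarrow> origin (\<phi> e) = \<psi> (origin e)" "\<And>e. e \<in> E1 \<Longrightarrow> terminus (\<phi> e) = \<psi> (terminus e)"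
    and x: "\<psi> Vx = Vx" and lab: "labelling E2 \<delta>"
  shows "labelling E1 (\<delta> \<circ> \<phi>)"
  unfolding labelling_def
proof (intro conjI allI ballI impI)
  note bij = graph_iso_bij[OF iso]
  have in2: "\<phi> e \<in> E2" if "e \<in> E1" for e using graph_iso_in[OF iso that] .
  have vert: "origin e \<in> vertices E1" "terminus e \<in> vertices E1" if "e \<in> E1" for e
    using that by (auto simp: vertices_def)
  fix v
  show "(\<Sum>e\<in>E1. if origin e = v then (\<delta> \<circ> \<phi>) e else 0) = (\<Sum>e\<in>E1. if terminus e = v then (\<delta> \<circ> \<phi>) e else 0)"
  proof (cases "v \<in> vertices E1")
    case True
    have eq: "origin e = v \<longleftrightarrow> origin (\<phi> e) = \<psi> v" "terminus e = v \<longleftrightarrow> terminus (\<phi> e) = \<psi> v"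
      if "e \<in> E1" for e
      using \<psi> vert[OF that] that True by (metis bij_betw_def inj_onD)+
    have "(\<Sum>e\<in>E1. if origin e = v then (\<delta> \<circ> \<phi>) e else 0) = (\<Sum>e\<in>E1. (\<lambda>e. if origin e = \<psi> v then \<delta> e else 0) (\<phi> e))"
      by (rule sum.cong) (simp_all add: eq)
    also have "\<dots> = (\<Sum>e\<in>E2. if origin e = \<psi> v then \<delta> e else 0)" by (rule sum.reindex_bij_betw[OF bij])
    also have "\<dots> = (\<Sum>e\<in>E2. if terminus e = \<psi> v then \<delta> e else 0)" using lab by (simp add: labelling_def)
    also have "\<dots> = (\<Sum>e\<in>E1. (\<lambda>e. if terminus e = \<psi> v then \<delta> e else 0) (\<phi> e))"
      by (rule sum.reindex_bij_betw[OF bij, symmetric])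
    also have "\<dots> = (\<Sum>e\<in>E1. if terminus e = v then (\<delta> \<circ> \<phi>) e else 0)"
      by (rule sum.cong) (simp_all add: eq)
    finally show ?thesis .
  next
    case False
    then have "origin e \<noteq> v" "terminus e \<noteq> v" if "e \<in> E1" for e using vert that by metis+
    then show ?thesis by simp
  qed
next
  fix e e' assume e: "e \<in> E1" "e' \<in> E1" "ends e \<inter> ends e' \<noteq> {}"
  then have "ends (\<phi> e) \<inter> ends (\<phi> e') \<noteq> {}" using \<psi> by (auto simp: ends_def)
  then show "(\<delta> \<circ> \<phi>) e \<le> (\<delta> \<circ> \<phi>) e' + 1"
    using lab graph_iso_in[OF iso] e unfolding labelling_def by auto
next
  fix e assume e: "e \<in> E1" "Vx \<in> ends e"
  then have "Vx \<in> ends (\<phi> e)" using \<psi> x by (auto simp: ends_def)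
  then show "(\<delta> \<circ> \<phi>) e = 0"
    using lab graph_iso_in[OF iso] e unfolding labelling_def by auto
qed

text \<open>Depth pulled back along the isomorphism is a labelling of \<open>E1\<close>, and depth
  is the largest one. The inverse diagram gives the reverse inequality.\<close>

lemma depth_iso_le:
  assumes d: "diagram g E1 E2 \<phi>" and g: "g vertex_x = vertex_x" and e: "e \<in> E1"
  shows "depth (\<phi> e) \<le> depth e"
proof -
  have E: "E1 \<in> expansions" "E2 \<in> expansions" "graph_iso E1 E2 \<phi>" using d by (auto simp: diagram_def)
  obtain \<psi> where \<psi>: "bij_betw \<psi> (vertices E1) (vertices E2)"
    "\<And>e. e \<in> E1 \<Longrightarrow> origin (\<phi> e) = \<psi> (origin e)" "\<And>e. e \<in> E1 \<Longrightarrow> terminus (\<phi> e) = \<psi> (terminus e)"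
    by (rule graph_isoE[OF E(3)]) (rule that; assumption)
  have "labelling E1 (depth \<circ> \<phi>)"
    using labelling_transport[OF E(3) \<psi> iso_fixes_Vx[OF d g \<psi>(2,3)] labelling_depth[OF E(2)]] .
  then show ?thesis using labelling_le_depth[OF E(1) _ e] by fastforce
qed

lemma depth_iso:
  assumes d: "diagram g E1 E2 \<phi>" and g: "g vertex_x = vertex_x" and e: "e \<in> E1"
  shows "depth (\<phi> e) = depth e"
proof -
  have iso: "graph_iso E1 E2 \<phi>" using d by (auto simp: diagram_def)
  let ?g = "\<lambda>x\<in>Xlim. inv_into Xlim g x"
  have "inv_into Xlim g vertex_x = vertex_x"
    using diagram_bij[OF d] g by (metis base_point_def bij_betw_inv_into_left proj_in_Xlim)
  then have "?g vertex_x = vertex_x" by (simp add: base_point_def)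
  then have "depth (inv_into E1 \<phi> (\<phi> e)) \<le> depth (\<phi> e)"
    using depth_iso_le[OF diagram_inverse[OF d]] graph_iso_in[OF iso e] by blast
  then show ?thesis
    using depth_iso_le[OF assms] bij_betw_inv_into_left[OF graph_iso_bij[OF iso] e] by simp
qed

section \<open>Three rearrangements\<close>

text \<open>Every vertex is an end of some edge, so compatibility with ends already makes
  \<open>\<psi>\<close> map onto the vertices of \<open>E2\<close>; injectivity is what remains to
  be checked.\<close>

lemma graph_isoI:
  assumes "bij_betw \<phi> E1 E2" "inj_on \<psi> (vertices E1)"
    "\<And>e. e \<in> E1 \<Longrightarrow> origin (\<phi> e) = \<psi> (origin e) \<and> terminus (\<phi> e) = \<psi> (terminus e)"
  shows "graph_iso E1 E2 \<phi>"
proof -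
  have E2: "E2 = \<phi> ` E1" using assms(1) by (simp add: bij_betw_def)
  have "origin ` E2 = \<psi> ` origin ` E1" "terminus ` E2 = \<psi> ` terminus ` E1"
    using assms(3) unfolding E2 image_image by (auto intro!: image_cong)
  then have "vertices E2 = \<psi> ` vertices E1" by (simp add: vertices_def image_Un)
  then show ?thesis unfolding graph_iso_def using assms by (auto simp: bij_betw_def)
qed

fun rotate_base :: "bedge \<Rightarrow> bedge" where
  "rotate_base Ea = Ec" | "rotate_base Eb = Ed" | "rotate_base Ec = Ea" | "rotate_base Ed = Eb"

definition rotate_edge :: "addr \<Rightarrow> addr" where
  "rotate_edge w = (rotate_base (fst w), snd w)"

text \<open>Expanding a gives a circle a1, a3 through x with the loop a2 opposite to x, a copy of
  the circle b, d with its loop c. The map exchanges the two.\<close>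

definition swap_edge :: "addr \<Rightarrow> addr" where
  "swap_edge = id((Ea, [R1]) := (Eb, []), (Eb, []) := (Ea, [R1]), (Ea, [R2]) := (Ec, []),
     (Ec, []) := (Ea, [R2]), (Ea, [R3]) := (Ed, []), (Ed, []) := (Ea, [R3]))"

text \<open>On the circle of b and d cut open at x, the arcs b1, b3, d go to b, d1, d3, which is a
  standard generator of Thompson's group F up to inversion. The loops b2 and c, hanging between
  consecutive arcs, go to c and d2.\<close>

definition shift_edge :: "addr \<Rightarrow> addr" where
  "shift_edge = id((Eb, [R1]) := (Eb, []), (Eb, [R2]) := (Ec, []), (Eb, [R3]) := (Ed, [R1]),
     (Ec, []) := (Ed, [R2]), (Ed, []) := (Ed, [R3]))"

lemma expand_a: "expand base_edges (Ea, []) =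
    {(Ea, [R1]), (Ea, [R2]), (Ea, [R3]), (Eb, []), (Ec, []), (Ed, [])}"
  and expand_b: "expand base_edges (Eb, []) =
    {(Ea, []), (Eb, [R1]), (Eb, [R2]), (Eb, [R3]), (Ec, []), (Ed, [])}"
  and expand_d: "expand base_edges (Ed, []) =
    {(Ea, []), (Eb, []), (Ec, []), (Ed, [R1]), (Ed, [R2]), (Ed, [R3])}"
  unfolding base_edges_eq by (auto simp: expand_def extend_def)

lemma graph_iso_rotate: "graph_iso base_edges base_edges rotate_edge"
  by (rule graph_isoI[where \<psi> = "\<lambda>v. if v = Vx then Vy else Vx"]; unfold base_edges_eq)
    (auto simp: bij_betw_def inj_on_def rotate_edge_def vertices_def)

lemma graph_iso_swap: "graph_iso (expand base_edges (Ea, [])) (expand base_edges (Ea, [])) swap_edge"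
  by (rule graph_isoI[where \<psi> = "id(Vy := Mid (Ea, []), Mid (Ea, []) := Vy)"]; unfold expand_a)
    (auto simp: bij_betw_def inj_on_def swap_edge_def vertices_def origin_def terminus_def)

lemma graph_iso_shift: "graph_iso (expand base_edges (Eb, [])) (expand base_edges (Ed, [])) shift_edge"
  by (rule graph_isoI[where \<psi> = "id(Vy := Mid (Ed, []), Mid (Eb, []) := Vy)"]; unfold expand_b expand_d)
    (auto simp: bij_betw_def inj_on_def shift_edge_def vertices_def origin_def terminus_def)

definition rotation :: "bseq set \<Rightarrow> bseq set" where
  "rotation = lim_map base_edges rotate_edge"

definition swap :: "bseq set \<Rightarrow> bseq set" where
  "swap = lim_map (expand base_edges (Ea, [])) swap_edge"

definition shift :: "bseq set \<Rightarrow> bseq set" where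
  "shift = lim_map (expand base_edges (Eb, [])) shift_edge"

lemma base_expand_in_expansions: "expand base_edges (b, []) \<in> expansions"
  by (rule expand_in_expansions[OF base_in_expansions]) simp

lemma diagram_rotation: "diagram rotation base_edges base_edges rotate_edge"
  unfolding rotation_def by (rule diagram_lim_map[OF base_in_expansions base_in_expansions graph_iso_rotate])

lemma diagram_swap:
  "diagram swap (expand base_edges (Ea, [])) (expand base_edges (Ea, [])) swap_edge"
  unfolding swap_def
  by (rule diagram_lim_map[OF base_expand_in_expansions base_expand_in_expansions graph_iso_swap])

lemma diagram_shift:
  "diagram shift (expand base_edges (Eb, [])) (expand base_edges (Ed, [])) shift_edge"
  unfolding shift_def
  by (rule diagram_lim_map[OF base_expand_in_expansions base_expand_in_expansions graph_iso_shift])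

lemma in_T_B: "rotation \<in> carrier T_B" "swap \<in> carrier T_B" "shift \<in> carrier T_B"
  unfolding carrier_T_B using diagram_rotation diagram_swap diagram_shift
  by (auto simp: rotation_def swap_def shift_def lim_map_def)

lemma rotation_proj: "rotation (proj (cat_seq (b, u) \<zeta>)) = proj (cat_seq (rotate_base b, u) \<zeta>)"
  using diagram_proj[OF diagram_rotation, of "(b, [])" u \<zeta>] by (simp add: extend_def rotate_edge_def)

lemma swap_proj:
  "swap (proj (cat_seq (Ea, R1 # u) \<zeta>)) = proj (cat_seq (Eb, u) \<zeta>)"
  "swap (proj (cat_seq (Ea, R2 # u) \<zeta>)) = proj (cat_seq (Ec, u) \<zeta>)"
  "swap (proj (cat_seq (Ea, R3 # u) \<zeta>)) = proj (cat_seq (Ed, u) \<zeta>)"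
  "swap (proj (cat_seq (Eb, u) \<zeta>)) = proj (cat_seq (Ea, R1 # u) \<zeta>)"
  "swap (proj (cat_seq (Ec, u) \<zeta>)) = proj (cat_seq (Ea, R2 # u) \<zeta>)"
  "swap (proj (cat_seq (Ed, u) \<zeta>)) = proj (cat_seq (Ea, R3 # u) \<zeta>)"
  using diagram_proj[OF diagram_swap, of "(Ea, [R1])" u \<zeta>] diagram_proj[OF diagram_swap, of "(Ea, [R2])" u \<zeta>]
    diagram_proj[OF diagram_swap, of "(Ea, [R3])" u \<zeta>] diagram_proj[OF diagram_swap, of "(Eb, [])" u \<zeta>]
    diagram_proj[OF diagram_swap, of "(Ec, [])" u \<zeta>] diagram_proj[OF diagram_swap, of "(Ed, [])" u \<zeta>]
  unfolding expand_a by (simp_all add: extend_def swap_edge_def)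

lemma shift_proj:
  "shift (proj (cat_seq (Ea, u) \<zeta>)) = proj (cat_seq (Ea, u) \<zeta>)"
  "shift (proj (cat_seq (Eb, R1 # u) \<zeta>)) = proj (cat_seq (Eb, u) \<zeta>)"
  using diagram_proj[OF diagram_shift, of "(Ea, [])" u \<zeta>] diagram_proj[OF diagram_shift, of "(Eb, [R1])" u \<zeta>]
  unfolding expand_b by (simp_all add: extend_def shift_edge_def)

lemma involution:
  assumes "f \<in> carrier T_B" "diagram f E E \<phi>" "\<And>e. e \<in> E \<Longrightarrow> \<phi> (\<phi> e) = e"
  shows "f \<odot> f = \<one>\<^bsub>T_B\<^esub>"
proof (rule T_B_eqI)
  fix y assume "y \<in> Xlim"
  then obtain s where s: "y = proj s" by (auto simp: Xlim_eq)
  have E: "E \<in> expansions" and iso: "graph_iso E E \<phi>" using assms(2) by (auto simp: diagram_def)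
  obtain e \<zeta> where e: "e \<in> E" "s = cat_seq e \<zeta>" using expansion_cover[OF E] .
  have "f (f y) = y"
    using diagram_proj[OF assms(2), of _ "[]"] e s assms(3) graph_iso_in[OF iso] by simp
  then show "(f \<odot> f) y = \<one>\<^bsub>T_B\<^esub> y"
    using mult_T_B[OF assms(1,1)] one_T_B \<open>y \<in> Xlim\<close> by simp
qed (use assms(1) in auto)

lemma rotation_rotation: "rotation \<odot> rotation = \<one>\<^bsub>T_B\<^esub>"
proof (rule involution[OF in_T_B(1) diagram_rotation])
  fix e :: addr show "rotate_edge (rotate_edge e) = e"
    by (cases e; cases "fst e") (auto simp: rotate_edge_def)
qed

lemma swap_swap: "swap \<odot> swap = \<one>\<^bsub>T_B\<^esub>"
  by (rule involution[OF in_T_B(2) diagram_swap]) (auto simp: expand_a swap_edge_def)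

lemma involution_apply:
  assumes "f \<in> carrier T_B" "f \<odot> f = \<one>\<^bsub>T_B\<^esub>" "y \<in> Xlim"
  shows "f (f y) = y"
  using mult_T_B[OF assms(1,1,3)] assms(2) one_T_B[OF assms(3)] by simp

section \<open>The two sides of the vertex x and the supports of the deep shifts\<close>

abbreviation inner :: "bseq set set" where "inner \<equiv> cell (Ea, [])"
abbreviation outer :: "bseq set set" where "outer \<equiv> cell (Eb, []) \<union> cell (Ec, []) \<union> cell (Ed, [])"

lemma inner_Un_outer: "inner \<union> outer = Xlim"
proof -
  have "proj s \<in> inner \<union> outer" for s
  proof -
    obtain e \<zeta> where "e \<in> base_edges" "s = cat_seq e \<zeta>" using expansion_cover[OF base_in_expansions] .
    then show ?thesis unfolding base_edges_eq by (auto simp: cell_def)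
  qed
  then have "Xlim \<subseteq> inner \<union> outer" by (auto simp: Xlim_eq)
  then show ?thesis using cell_subset_Xlim by blast
qed

lemma vertex_at_Vx_proj: "vertex_at s Vx \<Longrightarrow> proj s = vertex_x"
  using vertex_at_origin[of "(Ea, [])"] by (auto simp: base_point_def proj_eq_iff seq_rel_iff)

text \<open>A point common to both sides comes from a vertex shared by addresses below different
  base edges. Midpoints remember their base edge, so that vertex is an end of a and hence is
  \<open>Vx\<close>.\<close>

lemma inner_Int_outer: "inner \<inter> outer = {vertex_x}"
proof (intro equalityI subsetI)
  fix y assume y: "y \<in> inner \<inter> outer"
  then obtain \<zeta> where \<zeta>: "y = proj (cat_seq (Ea, []) \<zeta>)" by (auto simp: cell_def)
  obtain b \<zeta>' where b: "b \<noteq> Ea" "y = proj (cat_seq (b, []) \<zeta>')" using y by (auto simp: cell_def)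
  have "cat_seq (Ea, []) \<zeta> \<noteq> cat_seq (b, []) \<zeta>'" using b(1) by (simp add: cat_seq_def)
  then obtain v where v: "vertex_at (cat_seq (Ea, []) \<zeta>) v" "vertex_at (cat_seq (b, []) \<zeta>') v"
    using \<zeta> b(2) proj_eq_iff seq_rel_iff by metis
  then obtain n n' where n: "v \<in> ends ((Ea, []) \<rhd> map \<zeta> [0..<n])" "v \<in> ends ((b, []) \<rhd> map \<zeta>' [0..<n'])"
    unfolding vertex_at_cat_seq by blast
  have "v = Vx"
    using ends_extendD[OF n(1)] ends_extendD[OF n(2)] b(1) by (cases b) (auto simp: ends_def extend_def)
  then show "y \<in> {vertex_x}" using vertex_at_Vx_proj v(1) \<zeta> by simp
next
  fix y assume "y \<in> {vertex_x}"
  moreover have "vertex_x = base_point (Eb, [])"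
    using vertex_at_Vx_proj vertex_at_origin[of "(Eb, [])"] by (simp add: base_point_def)
  ultimately show "y \<in> inner \<inter> outer" by (auto simp: base_point_def cell_def)
qed

lemma swap_vertex_x: "swap vertex_x = vertex_x"
proof -
  have "vertex_x = proj (cat_seq (Ea, [R1]) (\<lambda>_. R1))"
    using vertex_at_origin[of "(Ea, [R1])"] vertex_at_Vx_proj by (simp add: origin_def)
  moreover have "vertex_x = proj (cat_seq (Eb, []) (\<lambda>_. R1))"
    using vertex_at_origin[of "(Eb, [])"] vertex_at_Vx_proj by simp
  ultimately show ?thesis using swap_proj(1)[of "[]" "\<lambda>_. R1"] by simp
qed

lemma swap_inner: "swap ` inner = outer"
proof -
  have split: "cell w = cell (w \<rhd> [R1]) \<union> cell (w \<rhd> [R2]) \<union> cell (w \<rhd> [R3])" for w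
  proof (intro equalityI subsetI)
    fix y assume "y \<in> cell w"
    then obtain \<zeta> where "y = proj (cat_seq w \<zeta>)" by (auto simp: cell_def)
    moreover have "\<zeta> = lcat [\<zeta> 0] (\<lambda>i. \<zeta> (Suc i))" by (auto simp: lcat_def fun_eq_iff)
    ultimately have "y = proj (cat_seq (w \<rhd> [\<zeta> 0]) (\<lambda>i. \<zeta> (Suc i)))" by (metis cat_seq_extend)
    then have "y \<in> cell (w \<rhd> [\<zeta> 0])" by (auto simp: cell_def)
    then show "y \<in> cell (w \<rhd> [R1]) \<union> cell (w \<rhd> [R2]) \<union> cell (w \<rhd> [R3])" by (cases "\<zeta> 0") auto
  qed (auto simp: cell_def cat_seq_extend)
  show ?thesis
    unfolding split[of "(Ea, [])"] image_Un
    by (simp add: cell_def image_image extend_def swap_proj)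
qed

lemma swap_outer: "swap ` outer = inner"
proof -
  have "swap ` swap ` inner = inner"
    unfolding image_image using involution_apply[OF in_T_B(2) swap_swap] cell_subset_Xlim
    by (auto simp: subset_iff image_iff)
  then show ?thesis by (simp only: swap_inner)
qed

lemma T_B_inj: "f \<in> carrier T_B \<Longrightarrow> inj_on f Xlim"
  by (simp add: T_B_def Bij_def bij_betw_def)

text \<open>\<open>deep_shift j\<close> is a copy of \<open>shift\<close> acting at depth \<open>j\<close>.\<close>
primrec deep_shift :: "nat \<Rightarrow> bseq set \<Rightarrow> bseq set" where
  "deep_shift 0 = shift"
| "deep_shift (Suc j) = rotation \<odot> (swap \<odot> deep_shift j \<odot> swap) \<odot> rotation"

lemma deep_shift_in_T_B: "deep_shift j \<in> carrier T_B"
  by (induction j) (simp_all add: in_T_B)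

lemma deep_shift_Suc_apply:
  assumes "y \<in> Xlim"
  shows "deep_shift (Suc j) y = rotation (swap (deep_shift j (swap (rotation y))))"
  using assms in_T_B deep_shift_in_T_B by (simp add: mult_T_B T_B_in_Xlim)

lemma conj_swap_apply:
  assumes "y \<in> Xlim" "g \<in> carrier T_B"
  shows "(swap \<odot> g \<odot> swap) y = swap (g (swap y))"
  using assms in_T_B by (simp add: mult_T_B T_B_in_Xlim)

text \<open>\<open>rotation\<close> takes the inner side into the cell of c, and \<open>swap\<close>
  brings it back inside; there the previous deep shift is trivial, so the conjugation undoes
  itself.\<close>

lemma deep_shift_inner: "y \<in> inner \<Longrightarrow> deep_shift j y = y"
proof (induction j arbitrary: y)
  case 0
  then show ?case by (auto simp: cell_def shift_proj)
next
  case (Suc j)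
  have y: "y \<in> Xlim" using Suc.prems cell_subset_Xlim by blast
  have "rotation y \<in> outer" using Suc.prems by (auto simp: cell_def rotation_proj)
  then have "swap (rotation y) \<in> inner" using swap_outer by blast
  then have "deep_shift (Suc j) y = rotation (swap (swap (rotation y)))"
    using Suc.IH y by (simp add: deep_shift_Suc_apply del: deep_shift.simps)
  then show ?case
    using involution_apply[OF in_T_B(2) swap_swap T_B_in_Xlim[OF in_T_B(1) y]]
      involution_apply[OF in_T_B(1) rotation_rotation y] by simp
qed

lemma conj_deep_shift_outer:
  assumes "y \<in> outer"
  shows "(swap \<odot> deep_shift j \<odot> swap) y = y"
proof -
  have y: "y \<in> Xlim" using assms inner_Un_outer by blast
  have "swap y \<in> inner" using assms swap_outer by blast
  then show ?thesis
    using deep_shift_inner conj_swap_apply[OF y deep_shift_in_T_B] involution_apply[OF in_T_B(2) swap_swap y] by simp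
qed

lemma disjoint_support_commute:
  assumes f: "f \<in> carrier T_B" and g: "g \<in> carrier T_B" and S: "S \<union> R = Xlim"
    and fS: "\<And>y. y \<in> S \<Longrightarrow> f y = y" and gR: "\<And>y. y \<in> R \<Longrightarrow> g y = y"
  shows "f \<odot> g = g \<odot> f"
proof (rule T_B_eqI)
  \<comment> \<open>The two sets may overlap, so complements are of no use; injectivity shows
    instead that a point sent into the fixed set was fixed already.\<close>
  have stay: "h y \<in> U" if h: "h \<in> carrier T_B" and hW: "\<And>y. y \<in> W \<Longrightarrow> h y = y"
    and UW: "U \<union> W = Xlim" and y: "y \<in> U" for h U W y
  proof (rule ccontr)
    assume "h y \<notin> U"
    have yX: "y \<in> Xlim" using y UW by blast
    then have "h y \<in> W" using T_B_in_Xlim[OF h] \<open>h y \<notin> U\<close> UW by blast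
    then have "h (h y) = h y" using hW by blast
    then have "h y = y" using T_B_inj[OF h] T_B_in_Xlim[OF h] yX by (auto dest: inj_onD)
    then show False using y \<open>h y \<notin> U\<close> by simp
  qed
  fix y assume y: "y \<in> Xlim"
  have "f (g y) = g (f y)"
  proof (cases "y \<in> S")
    case True then show ?thesis using stay[OF g gR S True] fS by simp
  next
    case False
    then have "y \<in> R" using y S by blast
    then show ?thesis using stay[OF f fS _ \<open>y \<in> R\<close>] S gR by (simp add: Un_commute)
  qed
  then show "(f \<odot> g) y = (g \<odot> f) y" using mult_T_B f g y by simp
qed (use f g in auto)

lemma deep_shift_commute:
  "(swap \<odot> deep_shift j \<odot> swap) \<odot> deep_shift j =
   deep_shift j \<odot> (swap \<odot> deep_shift j \<odot> swap)"
  by (rule disjoint_support_commute[of _ _ outer inner])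
    (use in_T_B deep_shift_in_T_B deep_shift_inner conj_deep_shift_outer inner_Un_outer in auto)

text \<open>Conjugation by \<open>swap\<close> and \<open>rotation\<close> carries the germ b1 to b
  of \<open>shift\<close> first to the loop c, then one loop deeper at each stage. The lost letter 1
  witnesses that the germ at the base point is not respected.\<close>

lemma deep_shift_proj:
  "deep_shift (Suc j) (proj (cat_seq (Ec, replicate j R2 @ R1 # R1 # u) \<zeta>)) =
   proj (cat_seq (Ec, replicate j R2 @ R1 # u) \<zeta>)"
proof (induction j)
  case 0
  show ?case by (simp add: deep_shift_Suc_apply rotation_proj swap_proj shift_proj del: deep_shift.simps(2))
next
  case (Suc j)
  then show ?case
    by (simp add: deep_shift_Suc_apply[of _ "Suc j"] rotation_proj swap_proj del: deep_shift.simps(2))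
qed

section \<open>The filtration of the stabilizer of a pointed loop cell\<close>

text \<open>Mapping the cell of \<open>w1\<close> to that of \<open>w'1\<close> fixes the germ at the base point of the loop \<open>w\<close>.\<close>
definition shift_cells :: "nat \<Rightarrow> bseq set set set" where
  "shift_cells i = {cell (w \<rhd> [R1]) | w. is_loop w \<and> depth w = i}"

abbreviation cell_a :: "bseq set set \<times> bseq set" where
  "cell_a \<equiv> pointed_cell (Ea, [])"

text \<open>The germ condition is imposed on all loops of one depth jointly, because elements of the
  stabilizer may permute them.\<close>

definition filtration :: "nat \<Rightarrow> (bseq set \<Rightarrow> bseq set) set" where
  "filtration m = {g \<in> carrier T_B. push g cell_a = cell_a \<and> (\<forall>i>m. (`) g ` shift_cells i = shift_cells i)}"

lemma image_T_B:
  assumes "f \<in> carrier T_B" "g \<in> carrier T_B" "S \<subseteq> Xlim"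
  shows "(f \<odot> g) ` S = f ` g ` S"
  unfolding image_image using mult_T_B[OF assms(1,2)] assms(3) by (intro image_cong) auto

lemma image_image_T_B:
  assumes "f \<in> carrier T_B" "g \<in> carrier T_B" "\<And>S. S \<in> D \<Longrightarrow> S \<subseteq> Xlim"
  shows "(`) (f \<odot> g) ` D = (`) f ` (`) g ` D"
  unfolding image_image[of "(`) f"] by (rule image_cong[OF refl]) (rule image_T_B[OF assms(1,2) assms(3)])

lemma shift_cells_subset: "S \<in> shift_cells i \<Longrightarrow> S \<subseteq> Xlim"
  unfolding shift_cells_def using cell_subset_Xlim by blast

lemma pointed_cell_subset: "fst (pointed_cell w) \<subseteq> Xlim" "snd (pointed_cell w) \<in> Xlim"
  using cell_subset_Xlim by (simp_all add: pointed_cell_def base_point_def)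

lemma push_subset:
  assumes "f \<in> carrier T_B" "fst h \<subseteq> Xlim" "snd h \<in> Xlim"
  shows "fst (push f h) \<subseteq> Xlim" "snd (push f h) \<in> Xlim"
  using T_B_in_Xlim[OF assms(1)] assms(2,3) by (auto simp: push_def)

lemma push_one:
  assumes "fst h \<subseteq> Xlim" "snd h \<in> Xlim"
  shows "push \<one>\<^bsub>T_B\<^esub> h = h"
  using assms one_T_B by (cases h) (auto simp: push_def subset_iff image_iff)

lemma push_inv:
  assumes "f \<in> carrier T_B" "fst h \<subseteq> Xlim" "snd h \<in> Xlim"
  shows "push (inv_T_B f) (push f h) = h" "push f (push (inv_T_B f) h) = h"
  using push_T_B[of "inv_T_B f" f h] push_T_B[of f "inv_T_B f" h] push_one assms by simp_all

lemma subgroup_filtration: "subgroup (filtration m) T_B"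
proof (rule T_B.subgroupI)
  have "(`) \<one>\<^bsub>T_B\<^esub> ` shift_cells i = shift_cells i" for i
  proof -
    have "\<one>\<^bsub>T_B\<^esub> ` S = S" if "S \<in> shift_cells i" for S
      using shift_cells_subset[OF that] one_T_B by (auto simp: subset_iff image_iff)
    then show ?thesis by simp
  qed
  then have "\<one>\<^bsub>T_B\<^esub> \<in> filtration m"
    by (simp add: filtration_def push_one pointed_cell_subset)
  then show "filtration m \<noteq> {}" by blast
  fix f assume f: "f \<in> filtration m"
  then have fc: "f \<in> carrier T_B" and fa: "push f cell_a = cell_a"
    and fi: "\<And>i. i > m \<Longrightarrow> (`) f ` shift_cells i = shift_cells i" by (auto simp: filtration_def)
  have "push (inv_T_B f) cell_a = cell_a"
    using push_inv(1)[OF fc, of cell_a] fa pointed_cell_subset by simp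
  moreover have "(`) (inv_T_B f) ` shift_cells i = shift_cells i" if "i > m" for i
  proof -
    have "(`) (inv_T_B f) ` shift_cells i = (`) (inv_T_B f) ` (`) f ` shift_cells i" using fi[OF that] by simp
    also have "\<dots> = (`) \<one>\<^bsub>T_B\<^esub> ` shift_cells i"
      using image_image_T_B[of "inv_T_B f" f] fc shift_cells_subset by (metis T_B.inv_closed T_B.l_inv)
    finally show ?thesis using \<open>\<And>i. (`) \<one>\<^bsub>T_B\<^esub> ` shift_cells i = shift_cells i\<close> by simp
  qed
  ultimately show "inv_T_B f \<in> filtration m" using fc by (simp add: filtration_def)
  fix g assume "g \<in> filtration m"
  then have gc: "g \<in> carrier T_B" and ga: "push g cell_a = cell_a"
    and gi: "\<And>i. i > m \<Longrightarrow> (`) g ` shift_cells i = shift_cells i" by (auto simp: filtration_def)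
  have "(`) (f \<odot> g) ` shift_cells i = shift_cells i" if "i > m" for i
    using image_image_T_B[OF fc gc shift_cells_subset] fi[OF that] gi[OF that] by simp
  then show "f \<odot> g \<in> filtration m"
    using push_T_B[OF fc gc, of cell_a] fc gc fa ga pointed_cell_subset by (simp add: filtration_def)
qed (auto simp: filtration_def)

lemma incseq_filtration: "incseq filtration"
  unfolding incseq_def filtration_def by (blast intro: le_less_trans)

text \<open>The bound says that no loop deeper than m is cut by the two expansions, so every such
  loop lies within one edge and is mapped canonically to a loop. Since g fixes x, its depth is kept;
  the codomain expansion gives surjectivity.\<close>

lemma shift_cells_invariant:
  assumes d: "diagram g E1 E2 \<phi>" and g: "g vertex_x = vertex_x" and i: "i > m"
    and bound: "\<And>w u. w \<rhd> u \<in> E1 \<union> E2 \<Longrightarrow> u \<noteq> [] \<Longrightarrow> is_loop w \<Longrightarrow> depth w \<le> m"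
  shows "(`) g ` shift_cells i = shift_cells i"
proof -
  have E: "E1 \<in> expansions" "E2 \<in> expansions" and iso: "graph_iso E1 E2 \<phi>" using d by (auto simp: diagram_def)
  show ?thesis
  proof (intro equalityI subsetI)
    fix S assume "S \<in> (`) g ` shift_cells i"
    then obtain w where w: "S = g ` cell (w \<rhd> [R1])" "is_loop w" "depth w = i" by (auto simp: shift_cells_def)
    obtain e u where e: "e \<in> E1" "w = e \<rhd> u"
      using comparable_expansion[OF E(1), of w] bound[of w] w(2,3) i by (metis UnCI not_le)
    have "S = cell (\<phi> e \<rhd> u \<rhd> [R1])" using diagram_cell[OF d e(1), of "u @ [R1]"] w(1) e(2) by simp
    moreover have "depth (\<phi> e \<rhd> u) = i" using depth_iso[OF d g e(1)] w(3) e(2) by (simp add: depth_extend)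
    moreover have "is_loop (\<phi> e \<rhd> u)" using is_loop_graph_iso[OF iso e(1)] w(2) e(2) by simp
    ultimately show "S \<in> shift_cells i" unfolding shift_cells_def by blast
  next
    fix S assume "S \<in> shift_cells i"
    then obtain w where w: "S = cell (w \<rhd> [R1])" "is_loop w" "depth w = i" by (auto simp: shift_cells_def)
    obtain e' u where e': "e' \<in> E2" "w = e' \<rhd> u"
      using comparable_expansion[OF E(2), of w] bound[of w] w(2,3) i by (metis UnCI not_le)
    obtain e where e: "e \<in> E1" "e' = \<phi> e" and loop: "is_loop (e \<rhd> u)"
      using loop_preimage[OF iso e'(1)] w(2) e'(2) by blast
    have "depth (e \<rhd> u) = i" using depth_iso[OF d g e(1)] w(3) e'(2) e(2) by (simp add: depth_extend)
    moreover have "S = g ` cell (e \<rhd> u \<rhd> [R1])"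
      using diagram_cell[OF d e(1), of "u @ [R1]"] w(1) e'(2) e(2) by simp
    ultimately show "S \<in> (`) g ` shift_cells i" using loop unfolding shift_cells_def by blast
  qed
qed

abbreviation stab_a :: "(bseq set \<Rightarrow> bseq set) set" where
  "stab_a \<equiv> \<Union>m. filtration m"

text \<open>A prefix is never deeper than the whole address, so the largest depth of an edge in a
  diagram serves as the stage.\<close>

lemma Union_filtration: "stab_a = {g \<in> carrier T_B. push g cell_a = cell_a}"
proof (intro equalityI subsetI)
  fix g assume "g \<in> {g \<in> carrier T_B. push g cell_a = cell_a}"
  then have gc: "g \<in> carrier T_B" and ga: "push g cell_a = cell_a" by auto
  then obtain E1 E2 \<phi> where d: "diagram g E1 E2 \<phi>" unfolding carrier_T_B by blast
  have gx: "g vertex_x = vertex_x" using ga by (simp add: push_def pointed_cell_def)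
  define m where "m = Max (depth ` (E1 \<union> E2))"
  have fin: "finite (E1 \<union> E2)" using d finite_expansion by (simp add: diagram_def)
  have "depth w \<le> m" if "w \<rhd> u \<in> E1 \<union> E2" for w u
  proof -
    have "depth (w \<rhd> u) \<le> m" unfolding m_def using that fin by (intro Max_ge) auto
    then show ?thesis by (simp add: depth_extend)
  qed
  then have "g \<in> filtration m"
    using shift_cells_invariant[OF d gx] gc ga by (auto simp: filtration_def)
  then show "g \<in> stab_a" by blast
qed (auto simp: filtration_def)

lemma swap_shift_cells: "i > m \<Longrightarrow> (`) swap ` shift_cells i = shift_cells i"
proof (rule shift_cells_invariant[OF diagram_swap swap_vertex_x])
  fix w u assume "w \<rhd> u \<in> expand base_edges (Ea, []) \<union> expand base_edges (Ea, [])" "u \<noteq> []"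
  then have "w = (Ea, [])" unfolding expand_a by (cases w) (auto simp: extend_def append_eq_Cons_conv)
  then show "depth w \<le> m" by (simp add: depth_def)
qed

lemma stabilizer_outer:
  assumes g: "g \<in> carrier T_B" and ga: "push g cell_a = cell_a"
  shows "g ` outer = outer"
proof -
  have outer: "outer = (Xlim - inner) \<union> {vertex_x}" using inner_Un_outer inner_Int_outer by blast
  have "g ` inner = inner" "g vertex_x = vertex_x" using ga by (auto simp: push_def pointed_cell_def)
  moreover have "g ` (Xlim - inner) = g ` Xlim - g ` inner"
    by (rule inj_on_image_set_diff[OF T_B_inj[OF g]]) (use cell_subset_Xlim in auto)
  moreover have "g ` Xlim = Xlim" using g by (simp add: T_B_def Bij_def bij_betw_def)
  ultimately show ?thesis unfolding outer by (simp add: image_Un)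
qed

text \<open>An element fixing the inner side and x preserves the outer side, which
  \<open>swap\<close> exchanges with the inner one. \<open>swap\<close> itself respects all positive
  depths, as the only loop cut by its diagram is a, of depth 0.\<close>

lemma swap_conj_filtration:
  assumes g: "g \<in> filtration m"
  shows "swap \<odot> g \<odot> swap \<in> filtration m"
proof -
  have gc: "g \<in> carrier T_B" and ga: "push g cell_a = cell_a"
    and gi: "\<And>i. i > m \<Longrightarrow> (`) g ` shift_cells i = shift_cells i" using g by (auto simp: filtration_def)
  have gx: "g vertex_x = vertex_x" using ga by (simp add: push_def pointed_cell_def)
  have sg: "swap \<odot> g \<in> carrier T_B" using gc in_T_B by simp
  have "push (swap \<odot> g \<odot> swap) cell_a = push swap (push g (push swap cell_a))"
    using push_T_B[OF sg in_T_B(2) pointed_cell_subset] push_T_B[OF in_T_B(2) gc]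
      push_subset[OF in_T_B(2) pointed_cell_subset] by simp
  also have "\<dots> = cell_a"
    using stabilizer_outer[OF gc ga] swap_inner swap_outer gx swap_vertex_x
    by (simp add: push_def pointed_cell_def)
  finally have "push (swap \<odot> g \<odot> swap) cell_a = cell_a" .
  moreover have "(`) (swap \<odot> g \<odot> swap) ` shift_cells i = shift_cells i" if "i > m" for i
    using image_image_T_B[OF sg in_T_B(2) shift_cells_subset] image_image_T_B[OF in_T_B(2) gc shift_cells_subset]
      swap_shift_cells[OF that] gi[OF that] by simp
  ultimately show ?thesis using gc in_T_B by (simp add: filtration_def)
qed

lemma deep_shift_in_filtration: "deep_shift j \<in> stab_a"
proof -
  have "vertex_x \<in> inner" by (auto simp: base_point_def cell_def)
  then have "push (deep_shift j) cell_a = cell_a"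
    using deep_shift_inner by (simp add: push_def pointed_cell_def image_def)
  then show ?thesis unfolding Union_filtration using deep_shift_in_T_B by simp
qed

text \<open>The loop w = \<open>c 2...2\<close> with m letters 2 has depth m+1, since c itself
  counts one. The cell of w11 is carried onto that of w1; invariance would make w11 the first child
  of a loop, but w1 is not a loop.\<close>

lemma deep_shift_notin_filtration: "deep_shift (Suc m) \<notin> filtration m"
proof
  assume "deep_shift (Suc m) \<in> filtration m"
  then have inv: "(`) (deep_shift (Suc m)) ` shift_cells (Suc m) = shift_cells (Suc m)" by (simp add: filtration_def)
  define w where "w = (Ec, []) \<rhd> replicate m R2"
  have loop: "is_loop w"
  proof (cases m)
    case 0 then show ?thesis by (simp add: w_def is_loop_def)
  next
    case (Suc n)
    then show ?thesis using is_loop_snoc[of "(Ec, [])" "replicate n R2" R2]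
      by (simp add: w_def replicate_append_same)
  qed
  have "depth w = Suc m" by (simp add: w_def depth_def)
  then have "cell (w \<rhd> [R1]) \<in> shift_cells (Suc m)" using loop unfolding shift_cells_def by blast
  then have "cell (w \<rhd> [R1]) \<in> (`) (deep_shift (Suc m)) ` shift_cells (Suc m)" by (simp only: inv)
  then obtain w' where w': "is_loop w'" "cell (w \<rhd> [R1]) = deep_shift (Suc m) ` cell (w' \<rhd> [R1])"
    unfolding shift_cells_def by blast
  have "deep_shift (Suc m) ` cell (w \<rhd> [R1, R1]) = cell (w \<rhd> [R1])"
    using deep_shift_proj[of m "[]"] by (simp add: cell_def image_image w_def extend_def del: deep_shift.simps)
  then have "cell (w \<rhd> [R1, R1]) = cell (w' \<rhd> [R1])"
    using w'(2) inj_on_image_eq_iff[OF T_B_inj[OF deep_shift_in_T_B] cell_subset_Xlim cell_subset_Xlim] by metis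
  then have "w \<rhd> [R1, R1] = w' \<rhd> [R1]" by (rule cell_inj)
  then have "w' = w \<rhd> [R1]" by (cases w; cases w') (simp add: extend_def)
  then show False using w'(1) is_loop_snoc[of w "[]" R1] by simp
qed

section \<open>The almost invariant set of loop cells\<close>

text \<open>The set of loop cells, pulled back to the group along the orbit map of
  \<open>cell_a\<close>; as a function on the group it is constant on cosets of the
  stabilizer.\<close>

definition loop_indicator :: "(bseq set \<Rightarrow> bseq set) \<Rightarrow> int" where
  "loop_indicator g = (if push g cell_a \<in> loop_cells then 1 else 0)"

lemma loop_cells_subset: "h \<in> loop_cells \<Longrightarrow> fst h \<subseteq> Xlim \<and> snd h \<in> Xlim"
  using pointed_cell_subset by (auto simp: loop_cells_def)

lemma push_cell_a_subset: "g \<in> carrier T_B \<Longrightarrow> fst (push g cell_a) \<subseteq> Xlim \<and> snd (push g cell_a) \<in> Xlim"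
  using push_subset[OF _ pointed_cell_subset] by simp

lemma inv_mult_in_filtration_iff:
  assumes "d \<in> carrier T_B" "g \<in> carrier T_B"
  shows "inv_T_B d \<odot> g \<in> stab_a \<longleftrightarrow> push d cell_a = push g cell_a"
proof -
  have "push (inv_T_B d \<odot> g) cell_a = push (inv_T_B d) (push g cell_a)"
    using push_T_B assms pointed_cell_subset by simp
  moreover have "push (inv_T_B d) (push g cell_a) = cell_a \<longleftrightarrow> push d cell_a = push g cell_a"
    using push_inv[OF assms(1)] push_cell_a_subset[OF assms(2)] pointed_cell_subset by metis
  ultimately show ?thesis unfolding Union_filtration using assms by simp
qed

lemma finite_noncanonical: "f \<in> carrier T_B \<Longrightarrow> finite {h \<in> loop_cells. push f h \<notin> loop_cells}"
  unfolding carrier_T_B using finite_noncanonical_loop_cells by blast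

lemma loop_indicator_almost_invariant:
  assumes f: "f \<in> carrier T_B"
  shows "\<exists>D. finite D \<and> D \<subseteq> carrier T_B \<and> (\<forall>g\<in>carrier T_B.
    loop_indicator g \<noteq> loop_indicator (inv_T_B f \<odot> g) \<longrightarrow>
    (\<exists>d\<in>D. inv_T_B d \<odot> g \<in> stab_a))"
proof -
  \<comment> \<open>The two ways to change status: a loop cell whose preimage under f is not one, or
    the image under f of a loop cell that ceases to be one. Cosets of \<open>stab_a\<close>
    correspond to points of the orbit of \<open>cell_a\<close>, so finiteness of \<open>H\<close>
    suffices.\<close>
  define H where "H = {h \<in> loop_cells. push (inv_T_B f) h \<notin> loop_cells} \<union>
    push f ` {h \<in> loop_cells. push f h \<notin> loop_cells}"
  have fin: "finite H" using finite_noncanonical f by (simp add: H_def)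
  define pick where "pick h = (SOME g. g \<in> carrier T_B \<and> push g cell_a = h)" for h
  define D where "D = pick ` (H \<inter> (\<lambda>g. push g cell_a) ` carrier T_B)"
  have pick: "pick (push g cell_a) \<in> carrier T_B" "push (pick (push g cell_a)) cell_a = push g cell_a"
    if "g \<in> carrier T_B" for g
    unfolding pick_def using someI[of "\<lambda>x. x \<in> carrier T_B \<and> push x cell_a = push g cell_a" g] that by auto
  have "\<exists>d\<in>D. inv_T_B d \<odot> g \<in> stab_a"
    if g: "g \<in> carrier T_B" and ne: "loop_indicator g \<noteq> loop_indicator (inv_T_B f \<odot> g)" for g
  proof -
    let ?h = "push g cell_a"
    have "push (inv_T_B f \<odot> g) cell_a = push (inv_T_B f) ?h"
      using push_T_B f g pointed_cell_subset by simp
    then have "(?h \<in> loop_cells) \<noteq> (push (inv_T_B f) ?h \<in> loop_cells)"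
      using ne unfolding loop_indicator_def by metis
    moreover have "push f (push (inv_T_B f) ?h) = ?h"
      using push_inv(2)[OF f] push_cell_a_subset[OF g] by blast
    ultimately have "?h \<in> H" unfolding H_def by (metis (mono_tags, lifting) UnCI imageI mem_Collect_eq)
    then have "pick ?h \<in> D" using g by (auto simp: D_def)
    moreover have "inv_T_B (pick ?h) \<odot> g \<in> stab_a"
      using inv_mult_in_filtration_iff[OF pick(1)[OF g] g] pick(2)[OF g] by simp
    ultimately show ?thesis by blast
  qed
  moreover have "finite D" "D \<subseteq> carrier T_B" using fin pick by (auto simp: D_def)
  ultimately show ?thesis by blast
qed

lemma subgroup_Union_filtration: "subgroup stab_a T_B"
proof (rule T_B.subgroupI)
  fix f g assume "f \<in> stab_a" "g \<in> stab_a"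
  then obtain m n where "f \<in> filtration m" "g \<in> filtration n" by blast
  then have "f \<in> filtration (max m n)" "g \<in> filtration (max m n)"
    using incseqD[OF incseq_filtration] by (meson max.cobounded1 max.cobounded2 subsetD)+
  then show "f \<odot> g \<in> stab_a"
    using subgroup.m_closed[OF subgroup_filtration] by blast
next
  show "stab_a \<subseteq> carrier T_B" by (auto simp: filtration_def)
  show "stab_a \<noteq> {}" using deep_shift_in_filtration[of 0] by (metis empty_iff)
  fix f assume "f \<in> stab_a"
  then show "inv_T_B f \<in> stab_a"
    using subgroup.m_inv_closed[OF subgroup_filtration] by blast
qed

text \<open>When neither expansion cuts a loop, every loop cell is mapped canonically, so the set of
  loop cells is invariant. This makes the derivation vanish on \<open>rotation\<close> and
  \<open>shift\<close>.\<close>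

lemma push_loop_cells_bij:
  assumes f: "f \<in> carrier T_B" and d: "diagram f E1 E2 \<phi>"
    and no: "\<And>w u. w \<rhd> u \<in> E1 \<union> E2 \<Longrightarrow> u \<noteq> [] \<Longrightarrow> \<not> is_loop w"
    and h: "fst h \<subseteq> Xlim" "snd h \<in> Xlim"
  shows "push (inv_T_B f) h \<in> loop_cells \<longleftrightarrow> h \<in> loop_cells"
proof -
  have E: "E1 \<in> expansions" "E2 \<in> expansions" and iso: "graph_iso E1 E2 \<phi>" using d by (auto simp: diagram_def)
  have 1: "push f h \<in> loop_cells" if hl: "h \<in> loop_cells" for h
  proof -
    obtain w where w: "h = pointed_cell w" "is_loop w" using hl by (auto simp: loop_cells_def)
    obtain e u where "e \<in> E1" "w = e \<rhd> u"
      using comparable_expansion[OF E(1), of w] no[of w] w(2) by (metis UnCI)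
    then show ?thesis using push_loop_cells[OF d] w by simp
  qed
  have 2: "\<exists>h'\<in>loop_cells. h = push f h'" if hl: "h \<in> loop_cells" for h
  proof -
    obtain w where w: "h = pointed_cell w" "is_loop w" using hl by (auto simp: loop_cells_def)
    obtain e' u where e': "e' \<in> E2" "w = e' \<rhd> u"
      using comparable_expansion[OF E(2), of w] no[of w] w(2) by (metis UnCI)
    obtain e where e: "e \<in> E1" "e' = \<phi> e" and loop: "is_loop (e \<rhd> u)"
      using loop_preimage[OF iso e'(1)] w(2) e'(2) by blast
    have "pointed_cell (e \<rhd> u) \<in> loop_cells" using loop unfolding loop_cells_def by blast
    moreover have "h = push f (pointed_cell (e \<rhd> u))"
      using diagram_pointed_cell[OF d e(1)] w(1) e'(2) e(2) by simp
    ultimately show ?thesis by blast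
  qed
  show ?thesis
    using 1[of "push (inv_T_B f) h"] 2[of h] push_inv[OF f] h loop_cells_subset by metis
qed

lemma is_loop_base: "\<not> is_loop (Eb, [])" "\<not> is_loop (Ed, [])" "is_loop (Ea, [])"
  by (simp_all add: is_loop_def)

lemma swap_cell_a: "push swap cell_a = (outer, vertex_x)"
  using swap_inner swap_vertex_x by (simp add: push_def pointed_cell_def)

text \<open>The outer side contains the cells of both b and d, and no single address is a prefix of
  both.\<close>

lemma swap_cell_a_notin: "push swap cell_a \<notin> loop_cells"
proof
  assume "push swap cell_a \<in> loop_cells"
  then have "(outer, vertex_x) \<in> loop_cells" by (simp only: swap_cell_a)
  then obtain w where "outer = cell w" unfolding loop_cells_def pointed_cell_def by blast
  then have "cell (Eb, []) \<subseteq> cell w" "cell (Ed, []) \<subseteq> cell w" by auto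
  then show False unfolding cell_subset_iff by (metis bedge.distinct(9) fst_conv fst_extend)
qed

lemma cell_a_in: "cell_a \<in> loop_cells"
  using is_loop_base(3) by (auto simp: loop_cells_def)

lemma push_swap_loop_cells:
  assumes "h \<in> loop_cells" "h \<noteq> cell_a"
  shows "push swap h \<in> loop_cells"
proof -
  obtain w where w: "h = pointed_cell w" "is_loop w" using assms by (auto simp: loop_cells_def)
  have "w \<noteq> (Ea, [])" using w(1) assms(2) by blast
  then have "w \<rhd> u \<notin> expand base_edges (Ea, [])" if "u \<noteq> []" for u
    using that unfolding expand_a by (cases w) (auto simp: extend_def append_eq_Cons_conv)
  then obtain e u where "e \<in> expand base_edges (Ea, [])" "w = e \<rhd> u"
    by (rule_tac comparable_expansion[OF base_expand_in_expansions[of Ea], of w]) auto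
  then show ?thesis using push_loop_cells[OF diagram_swap] w by simp
qed

lemma not_derivations_lift: "\<not> T_B.derivations_lift"
proof -
  have inv_swap: "inv_T_B swap = swap" by (rule T_B.inv_equality[OF swap_swap in_T_B(2,2)])
  obtain \<delta> where \<delta>: "T_B.derivation_mod (T_B.coset_null stab_a) \<delta>"
    "\<And>f. f \<in> carrier T_B \<Longrightarrow> T_B.fin_supp (\<delta> f)"
    "\<And>f g. f \<in> carrier T_B \<Longrightarrow> g \<in> carrier T_B \<Longrightarrow>
       T_B.coset_sum stab_a (\<delta> f) g = loop_indicator g - loop_indicator (inv_T_B f \<odot> g)"
  proof (rule T_B.almost_invariant_derivation[of _ loop_indicator, OF subgroup_Union_filtration _ loop_indicator_almost_invariant])
    fix g c assume "g \<in> carrier T_B" "c \<in> stab_a"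
    then show "loop_indicator (g \<odot> c) = loop_indicator g"
      unfolding Union_filtration using push_T_B pointed_cell_subset by (simp add: loop_indicator_def)
  qed blast+
  have invariant: "\<delta> f \<in> T_B.coset_null stab_a"
    if f: "f \<in> carrier T_B" and d: "diagram f E1 E2 \<phi>"
      and no: "\<And>w u. w \<rhd> u \<in> E1 \<union> E2 \<Longrightarrow> u \<noteq> [] \<Longrightarrow> \<not> is_loop w" for f E1 E2 \<phi>
  proof -
    have "loop_indicator (inv_T_B f \<odot> g) = loop_indicator g" if g: "g \<in> carrier T_B" for g
      using push_loop_cells_bij[OF f d no] push_cell_a_subset[OF g] push_T_B[of "inv_T_B f" g cell_a]
        f g pointed_cell_subset by (simp add: loop_indicator_def)
    then show ?thesis using \<delta>(2,3) f by (simp add: T_B.coset_null_def)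
  qed
  have "\<delta> shift \<in> T_B.coset_null stab_a"
  proof (rule invariant[OF in_T_B(3) diagram_shift])
    fix w u assume "w \<rhd> u \<in> expand base_edges (Eb, []) \<union> expand base_edges (Ed, [])" "u \<noteq> []"
    then have "w = (Eb, []) \<or> w = (Ed, [])"
      unfolding expand_b expand_d by (cases w) (auto simp: extend_def append_eq_Cons_conv)
    then show "\<not> is_loop w" using is_loop_base by blast
  qed
  moreover have "\<delta> rotation \<in> T_B.coset_null stab_a"
  proof (rule invariant[OF in_T_B(1) diagram_rotation])
    fix w u assume "w \<rhd> u \<in> base_edges \<union> base_edges" "u \<noteq> []"
    then show "\<not> is_loop w" by (auto simp: extend_def)
  qed
  moreover have "\<delta> swap - (T_B.pt \<one>\<^bsub>T_B\<^esub> - T_B.pt swap) \<in> T_B.coset_null stab_a"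
  proof -
    have "T_B.coset_sum stab_a (\<delta> swap - (T_B.pt \<one>\<^bsub>T_B\<^esub> - T_B.pt swap)) g = 0" if g: "g \<in> carrier T_B" for g
    proof -
      let ?h = "push g cell_a"
      have "inv_T_B g \<odot> \<one>\<^bsub>T_B\<^esub> \<in> stab_a \<longleftrightarrow> ?h = cell_a"
        using inv_mult_in_filtration_iff[OF g T_B.one_closed] push_one[OF pointed_cell_subset] by simp
      moreover have "inv_T_B g \<odot> swap \<in> stab_a \<longleftrightarrow> ?h = push swap cell_a"
        using inv_mult_in_filtration_iff[OF g in_T_B(2)] .
      moreover have "loop_indicator (inv_T_B swap \<odot> g) = (if push swap ?h \<in> loop_cells then 1 else 0)"
        unfolding inv_swap loop_indicator_def using push_T_B[OF in_T_B(2) g pointed_cell_subset] by simp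
      moreover have "push swap (push swap ?h) = ?h" "push swap (push swap cell_a) = cell_a"
        using push_inv(1)[OF in_T_B(2), unfolded inv_swap] push_cell_a_subset[OF g] pointed_cell_subset by blast+
      \<comment> \<open>\<open>swap\<close> permutes the loop cells other than
        \<open>cell_a\<close>: the image of such a cell is a loop cell, and it is not
        \<open>cell_a\<close> because the image of \<open>cell_a\<close> is no loop cell. So the
        loop cells and their images differ only in \<open>cell_a\<close> and its image.\<close>
      ultimately have "loop_indicator g - loop_indicator (inv_T_B swap \<odot> g) =
          (if inv_T_B g \<odot> \<one>\<^bsub>T_B\<^esub> \<in> stab_a then 1 else 0) -
          (if inv_T_B g \<odot> swap \<in> stab_a then 1 else 0)"
        using push_swap_loop_cells[of ?h] push_swap_loop_cells[of "push swap ?h"] swap_cell_a_notin cell_a_in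
        unfolding loop_indicator_def by (smt (verit))
      then show ?thesis
        using \<delta>(2,3) g in_T_B(2) by (simp add: T_B.coset_sum_diff T_B.fin_supp_diff T_B.fin_supp_pt T_B.coset_sum_pt)
    qed
    then show ?thesis using \<delta>(2) in_T_B(2) by (simp add: T_B.coset_null_def T_B.fin_supp_diff T_B.fin_supp_pt)
  qed
  moreover have "swap \<notin> stab_a"
    unfolding Union_filtration using swap_cell_a_notin cell_a_in by auto
  moreover have "\<exists>j. deep_shift j \<notin> filtration m" for m
    using deep_shift_notin_filtration by blast
  ultimately show ?thesis
    by (intro T_B.no_lift[of filtration \<delta> shift rotation swap deep_shift])
      (use subgroup_filtration incseq_filtration subgroup_Union_filtration \<delta>(1) in_T_B rotation_rotation
        swap_swap swap_conj_filtration deep_shift_in_filtration deep_shift_commute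
        in \<open>auto simp del: UN_iff\<close>)
qed

theorem mainTheorem1:
  shows "\<not> FP2 T_B \<and> \<not> finitely_presented T_B"
  using T_B.FP2_derivations_lift T_B.finitely_presented_derivations_lift not_derivations_lift by blast

end
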